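(* For every $0<\epsilon<e^{-1}$ there exists $N_\epsilon$ such that for all $N\ge N_\epsilon$ and all $M\in\mathrm{Sym}(N)$ linearly independent of $I_N$, the number $$\frac{N^2(N+1)}{4\pi}\,e^{\phi\left(\frac1N I_N\right)}=\frac{N^2(N+1)}{4\pi}\left(\frac{2e}{N(N+1)}\right)^{\frac{N(N+1)}{2}}\Gamma_N\left(\frac{N+1}{2}\right)$$ approximates $\mathrm{vol}(\mathcal{S}_M)$ within relative error $\epsilon$. In particular, there is a single asymptotic formula for the volume, which holds for any sequence of central sections of increasing dimension.
   Context: $\mathrm{Sym}(N)$ is the space of real symmetric $N\times N$ matrices, considered throughout as a real inner product space with the Frobenius inner product $\langle X,Y\rangle_F=\mathrm{tr}(XY)$; $\mathrm{PSD}(N)$ is the subset of positive semidefinite matrices. The standard spectraplex is $\mathcal{S}_1=\{P\in\mathrm{PSD}(N):\mathrm{tr}(P)=1\}$, and for $M\in\mathrm{Sym}(N)$ linearly independent of the identity $I_N$ the central section $\mathcal{S}_M$ is $$\mathcal{S}_M=\left\{P\in\mathrm{PSD}(N) : \mathrm{tr}(P)=1 \text{ and } \mathrm{tr}(MP)=\tfrac{\mathrm{tr}(M)}{N}\right\}.$$ $\mathrm{vol}(\mathcal{S}_M)$ is the volume of $\mathcal{S}_M$ in its affine hull with respect to the Frobenius inner product. The function $\phi$ is $$\phi(P)=\log\Gamma_N\left(\tfrac{N+1}{2}\right)-\tfrac{N(N+1)}{2}\log\left(\tfrac{N+1}{2e}\right)+\tfrac{N+1}{2}\log\det(P),$$ where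 $\Gamma_N$ is the multivariate gamma function, $\Gamma_N(a)=\pi^{N(N-1)/4}\prod_{j=1}^N\Gamma\left(a+\tfrac{1-j}{2}\right)$. A number $\alpha>0$ approximates $V$ within relative error $\epsilon$ if $|V/\alpha-1|\le\epsilon$.
   Formalization: The approximating number is multiplied by 2^{N(N-1)/4}: with volume taken for the Frobenius inner product the printed number is too small by this factor asymptotically, so the printed claim fails for all large N; the displayed equality is proved as printed. *)

theory Defs
  imports
    "HOL-Analysis.Analysis"
    "HOL-Library.Landau_Symbols"
    "Jordan_Normal_Form.Determinant"
begin

text \<open>The size \<open>N\<close> is quantified inside the statement, so matrices are those of
  Jordan_Normal_Form, with explicit carriers.\<close>

definition Sym :: "nat \<Rightarrow> real Matrix.mat set" where
  "Sym N = {X \<in> carrier_mat N N. transpose_mat X = X}"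

definition PSD :: "nat \<Rightarrow> real Matrix.mat set" where
  "PSD N = {X \<in> Sym N. \<forall>v \<in> carrier_vec N. scalar_prod v (X *\<^sub>v v) \<ge> 0}"

definition tr :: "real Matrix.mat \<Rightarrow> real" where
  "tr X = (\<Sum>i<dim_row X. X $$ (i, i))"

definition frob :: "real Matrix.mat \<Rightarrow> real Matrix.mat \<Rightarrow> real" where
  "frob X Y = tr (X * Y)"

definition lin_indep_of_id :: "nat \<Rightarrow> real Matrix.mat \<Rightarrow> bool" where
  "lin_indep_of_id N M \<longleftrightarrow>
     (\<forall>a b. a \<cdot>\<^sub>m M + b \<cdot>\<^sub>m 1\<^sub>m N = 0\<^sub>m N N \<longrightarrow> a = 0 \<and> b = 0)"

definition central_section :: "nat \<Rightarrow> real Matrix.mat \<Rightarrow> real Matrix.mat set" where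
  "central_section N M = {P \<in> PSD N. tr P = 1 \<and> tr (M * P) = tr M / real N}"


text \<open>Matrices of unspecified size do not form a real vector space type, so
  \<^const>\<open>hull\<close> with \<^const>\<open>affine\<close> is not available for them.\<close>

definition mat_affine_hull :: "nat \<Rightarrow> real Matrix.mat set \<Rightarrow> real Matrix.mat set" where
  "mat_affine_hull N S =
     {Matrix.mat N N (\<lambda>ij. \<Sum>l<m. c l * X l $$ ij) | m c X.
        (\<forall>l<(m::nat). X l \<in> S) \<and> (\<Sum>l<m. c l) = (1::real)}"

definition frob_chart ::
    "nat \<Rightarrow> nat \<Rightarrow> real Matrix.mat \<Rightarrow> (nat \<Rightarrow> real Matrix.mat) \<Rightarrow> (nat \<Rightarrow> real) \<Rightarrow> real Matrix.mat" where
  "frob_chart N k P B x = Matrix.mat N N (\<lambda>ij. P $$ ij + (\<Sum>l<k. x l * B l $$ ij))"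

definition frob_frame ::
    "nat \<Rightarrow> real Matrix.mat set \<Rightarrow> nat \<Rightarrow> real Matrix.mat \<Rightarrow> (nat \<Rightarrow> real Matrix.mat) \<Rightarrow> bool" where
  "frob_frame N A k P B \<longleftrightarrow>
     P \<in> Sym N \<and> (\<forall>l<k. B l \<in> Sym N) \<and>
     (\<forall>l<k. \<forall>l'<k. frob (B l) (B l') = (if l = l' then 1 else 0)) \<and>
     range (frob_chart N k P B) = A"

text \<open>Volume of \<open>S\<close> in its affine hull with respect to the Frobenius inner product:
  the \<open>k\<close>-dimensional Lebesgue measure of \<open>S\<close> in Cartesian (Frobenius-orthonormal)
  coordinates on the affine hull. Changing the frame is an isometry of \<open>k\<close>-space, so the value
  does not depend on the frame chosen.\<close>

definition vol :: "nat \<Rightarrow> real Matrix.mat set \<Rightarrow> real" where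
  "vol N S =
     (case SOME (k, P, B). frob_frame N (mat_affine_hull N S) k P B of
        (k, P, B) \<Rightarrow> measure (Pi\<^sub>M {..<k} (\<lambda>_. lborel))
          {x \<in> {..<k} \<rightarrow>\<^sub>E UNIV. frob_chart N k P B x \<in> S})"


definition multi_Gamma :: "nat \<Rightarrow> real \<Rightarrow> real" where
  "multi_Gamma N a =
     pi powr (real N * (real N - 1) / 4) * (\<Prod>j=1..N. Gamma (a + (1 - real j) / 2))"

definition phi :: "nat \<Rightarrow> real Matrix.mat \<Rightarrow> real" where
  "phi N P =
     ln (multi_Gamma N ((real N + 1) / 2))
     - real N * (real N + 1) / 2 * ln ((real N + 1) / (2 * exp 1))
     + (real N + 1) / 2 * ln (Determinant.det P)"

text \<open>\<open>\<Gamma>\<^sub>N(a)\<close> is the integral of \<open>exp(-tr X) det(X)\<close> to the power \<open>a - (N+1)/2\<close> over the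
  positive definite cone for the measure \<open>\<Prod>\<^sub>i\<^sub>\<le>\<^sub>j dX\<^sub>i\<^sub>j\<close>. In Frobenius-orthonormal coordinates each of
  the \<open>N(N-1)/2\<close> off-diagonal entries is scaled by \<open>sqrt 2\<close>, so the Frobenius volume element on
  the symmetric matrices is that measure times the following constant. The source prints
  its approximation formula without this constant; \<^const>\<open>vol\<close>, being taken with respect to the Frobenius inner
  product, requires it. (For \<open>N = 2\<close>, a central section is a diameter of a disc, of length
  \<open>sqrt 2\<close>; for large \<open>N\<close> omitting the constant is an error that is exponential in \<open>N\<close> squared.)\<close>

definition frob_density :: "nat \<Rightarrow> real" where
  "frob_density N = 2 powr (real N * (real N - 1) / 4)"

definition approximates_within :: "real \<Rightarrow> real \<Rightarrow> real \<Rightarrow> bool" where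
  "approximates_within \<epsilon> \<alpha> V \<longleftrightarrow> \<alpha> > 0 \<and> \<bar>V / \<alpha> - 1\<bar> \<le> \<epsilon>"

end

theory Submission
  imports Defs "HOL-Probability.Probability" "HOL-Real_Asymp.Real_Asymp"
begin

text \<open>Let \<open>M\<^sub>0\<close> be the traceless part of \<open>M\<close>, normalised to Frobenius norm 1, with eigenvalues
  \<open>\<lambda>\<^sub>j\<close>, and let \<open>d = N(N+1)/2\<close>. Weight the cone of positive semidefinite \<open>X\<close> by \<open>exp(-tr X)\<close> and let
  \<open>g(s)\<close> be the density of \<open>\<langle>M\<^sub>0,X\<rangle>\<close>. By homogeneity of the cone, \<open>g(0)\<close> is \<open>\<Gamma>(d-1)/sqrt N\<close> times the
  volume of the central section.

  In an eigenbasis of \<open>M\<^sub>0\<close> the weight and the pairing involve only the diagonal of \<open>X\<close>, and the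
  off-diagonal parts completing a diagonal \<open>x\<close> to a positive semidefinite matrix have volume
  proportional to \<open>\<Prod> x\<^sub>j\<close> to the power \<open>(N-1)/2\<close>. Hence the Fourier transform of \<open>g\<close> is a constant times
  \<open>\<Prod>(1 - i\<theta>\<lambda>\<^sub>j)\<close> to the power \<open>-(N+1)/2\<close>, and Fourier inversion at \<open>0\<close> expresses the volume as its
  integral. Since \<open>\<Sum>\<lambda>\<^sub>j = 0\<close> and \<open>\<Sum>\<lambda>\<^sub>j\<^sup>2 = 1\<close>, this integrand is dominated by
  \<open>1 + \<theta>\<^sup>2\<close> to the power \<open>-(N+1)/4\<close> and, after rescaling \<open>\<theta>\<close> by \<open>sqrt (N+1)\<close>, converges to
  \<open>exp(-\<theta>\<^sup>2/4)\<close> uniformly in \<open>M\<close>; Stirling's formula does the rest.\<close>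

section \<open>Lebesgue measure on finite products\<close>

text \<open>Uniformity over \<open>M\<close> is possible because \<open>M\<close> enters only
  through the spectrum \<open>lam\<close> of \<open>M\<^sub>0\<close>, and every estimate uses just
  \<open>\<Sum> lam = 0\<close> and \<open>\<Sum> lam^2 = 1\<close>: the first kills the linear term
  of the logarithm of the integrand, the second fixes the quadratic one. So limits along arbitrary
  sequences of spectra suffice; a failure of uniformity would supply a bad sequence. Inversion at a
  single point needs continuity of \<open>g\<close> there. It comes from closure of the cone under
  addition, not from the Fourier transform. Since the size varies, matrices become functions of two
  indices and Lebesgue measure lives on products over finite index sets, where invariance under
  orthogonal maps is derived from translation invariance. The prefactor: the volume is
  \<open>sqrt N * C * I / (2 pi (d-2)!)\<close>, where the inversion integral \<open>I\<close>
  behaves like \<open>2 sqrt (pi / (N+1))\<close> and \<open>C\<close> equals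
  \<open>frob_density N\<close> times the multivariate gamma value. Writing \<open>(d-2)!\<close> as
  \<open>d! / (d (d-1))\<close>, Stirling's formula leaves \<open>d^(3/2) / (pi sqrt 2)\<close> next
  to \<open>(e/d)^d\<close>, and this is asymptotic to \<open>N^2 (N+1) / (4 pi)\<close>.\<close>

abbreviation lborelP :: "'i set \<Rightarrow> ('i \<Rightarrow> real) measure" where
  "lborelP I \<equiv> Pi\<^sub>M I (\<lambda>_. lborel)"

interpretation lborel_prod: product_sigma_finite "\<lambda>_. lborel :: real measure"
  by standard

lemma sigma_finite_lborelP: "finite I \<Longrightarrow> sigma_finite_measure (lborelP I)"
  by (rule lborel_prod.sigma_finite)

lemma measurable_lborelP_component:
  "i \<in> I \<Longrightarrow> (\<lambda>x. x i) \<in> borel_measurable (lborelP I)"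
  using measurable_component_singleton[of i I "\<lambda>_. lborel :: real measure"] by simp

lemma measurable_lborelP_restrict:
  assumes "\<And>i. i \<in> I \<Longrightarrow> (\<lambda>x. f x i) \<in> borel_measurable M"
  shows "(\<lambda>x. \<lambda>i\<in>I. f x i) \<in> measurable M (lborelP I)"
  by (rule measurable_restrict) (use assms in simp)

text \<open>Induction on \<open>I\<close>: Tonelli splits off one coordinate, to which the
  one-dimensional substitution applies. The offset \<open>c\<close> serves translations
  (\<open>r = 1\<close>), the common scale \<open>r\<close> the homogeneity of the cone.\<close>

lemma nn_integral_lborelP_affine:
  assumes "finite I" "r > 0" "f \<in> borel_measurable (lborelP I)"
  shows "(\<integral>\<^sup>+x. f x \<partial>lborelP I) =
         ennreal (r ^ card I) * (\<integral>\<^sup>+x. f (\<lambda>i\<in>I. c i + r * x i) \<partial>lborelP I)"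
  using assms(1,3)
proof (induction I arbitrary: f rule: finite_induct)
  case empty
  have "(\<lambda>i\<in>{}. c i + r * x i) = (\<lambda>_. undefined)" for x :: "'a \<Rightarrow> real" by auto
  then show ?case
    by (subst (1 2) lborel_prod.nn_integral_empty) auto
next
  case (insert i I)
  note insert.prems[measurable]
  have m[measurable]: "(\<lambda>x. \<lambda>j\<in>insert i I. c j + r * x j) \<in> measurable (lborelP (insert i I)) (lborelP (insert i I))"
    by (rule measurable_lborelP_restrict) measurable
  have "(\<integral>\<^sup>+x. f x \<partial>lborelP (insert i I)) = (\<integral>\<^sup>+x. \<integral>\<^sup>+y. f (x(i:=y)) \<partial>lborel \<partial>lborelP I)"
    by (rule lborel_prod.product_nn_integral_insert[OF insert.hyps insert.prems])
  also have "\<dots> = ennreal (r ^ card I) * (\<integral>\<^sup>+x. \<integral>\<^sup>+y. f ((\<lambda>j\<in>I. c j + r * x j)(i:=y)) \<partial>lborel \<partial>lborelP I)"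
    by (rule insert.IH) measurable
  also have "(\<integral>\<^sup>+x. \<integral>\<^sup>+y. f ((\<lambda>j\<in>I. c j + r * x j)(i:=y)) \<partial>lborel \<partial>lborelP I)
     = (\<integral>\<^sup>+x. ennreal r * (\<integral>\<^sup>+y. f ((\<lambda>j\<in>I. c j + r * x j)(i:=c i + r * y)) \<partial>lborel) \<partial>lborelP I)"
  proof (rule nn_integral_cong)
    fix x assume "x \<in> space (lborelP I)"
    have "(\<lambda>j\<in>I. c j + r * x j) \<in> space (lborelP I)"
      by (auto simp: space_PiM)
    then have mm: "(\<lambda>y. (\<lambda>j\<in>I. c j + r * x j)(i:=y)) \<in> measurable lborel (lborelP (insert i I))"
      by (intro measurable_fun_upd[where J = I]) auto
    have "(\<lambda>y. f ((\<lambda>j\<in>I. c j + r * x j)(i:=y))) \<in> borel_measurable borel"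
      using measurable_compose[OF mm insert.prems] by simp
    from nn_integral_real_affine[OF this, of r "c i"] \<open>r > 0\<close>
    show "(\<integral>\<^sup>+y. f ((\<lambda>j\<in>I. c j + r * x j)(i:=y)) \<partial>lborel) =
      ennreal r * (\<integral>\<^sup>+y. f ((\<lambda>j\<in>I. c j + r * x j)(i:=c i + r * y)) \<partial>lborel)" by simp
  qed
  also have "\<dots> = ennreal r * (\<integral>\<^sup>+x. (\<integral>\<^sup>+y. f (\<lambda>j\<in>insert i I. c j + r * (x(i:=y)) j) \<partial>lborel) \<partial>lborelP I)"
  proof -
    have "((\<lambda>j\<in>I. c j + r * x j)(i:=c i + r * y)) = (\<lambda>j\<in>insert i I. c j + r * (x(i:=y)) j)" for x y
      using insert.hyps by (auto simp: fun_eq_iff)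
    moreover have "(\<lambda>x. \<integral>\<^sup>+y. f (\<lambda>j\<in>insert i I. c j + r * (x(i:=y)) j) \<partial>lborel) \<in> borel_measurable (lborelP I)"
      by measurable
    ultimately show ?thesis by (simp only: nn_integral_cmult)
  qed
  also have "(\<integral>\<^sup>+x. (\<integral>\<^sup>+y. f (\<lambda>j\<in>insert i I. c j + r * (x(i:=y)) j) \<partial>lborel) \<partial>lborelP I)
     = (\<integral>\<^sup>+x. f (\<lambda>j\<in>insert i I. c j + r * x j) \<partial>lborelP (insert i I))"
    by (rule lborel_prod.product_nn_integral_insert[OF insert.hyps, symmetric]) measurable
  also have "ennreal (r ^ card I) * (ennreal r * X) = ennreal (r ^ card (insert i I)) * X" for X
    using insert.hyps \<open>r > 0\<close> by (simp add: ennreal_mult' mult_ac)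
  finally show ?case .
qed

lemma nn_integral_lborelP_translate:
  assumes "finite I" "f \<in> borel_measurable (lborelP I)"
  shows "(\<integral>\<^sup>+x. f (\<lambda>i\<in>I. x i + c i) \<partial>lborelP I) = (\<integral>\<^sup>+x. f x \<partial>lborelP I)"
  using nn_integral_lborelP_affine[OF assms(1) _ assms(2), of 1 c] by (simp add: add.commute)

lemma nn_integral_gauss: "(\<integral>\<^sup>+x. ennreal (exp (- x\<^sup>2)) \<partial>lborel) = ennreal (sqrt pi)"
proof -
  have "has_bochner_integral lborel (\<lambda>x::real. exp (- x\<^sup>2)) (sqrt pi)"
    using has_bochner_integral_even_function[OF gaussian_moment_0] by simp
  then show ?thesis
    by (simp add: has_bochner_integral_iff nn_integral_eq_integral)
qed

section \<open>Orthogonal maps preserve Lebesgue measure\<close>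

definition lin_map :: "'j set \<Rightarrow> 'l set \<Rightarrow> ('j \<Rightarrow> 'l \<Rightarrow> real) \<Rightarrow> ('l \<Rightarrow> real) \<Rightarrow> 'j \<Rightarrow> real" where
  "lin_map J L A x = (\<lambda>p\<in>J. \<Sum>l\<in>L. A p l * x l)"

lemma measurable_lin_map [measurable]: "lin_map J L A \<in> measurable (lborelP L) (lborelP J)"
  unfolding lin_map_def by (rule measurable_lborelP_restrict) measurable

lemma measurable_lin_map_component [measurable (raw)]:
  assumes "g \<in> measurable M (lborelP L)"
  shows "(\<lambda>x. lin_map J L A (g x) p) \<in> borel_measurable M"
proof (cases "p \<in> J")
  case True
  have "(\<lambda>x. lin_map J L A (g x)) \<in> measurable M (lborelP J)"
    by (rule measurable_compose[OF assms measurable_lin_map])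
  from measurable_compose[OF this measurable_lborelP_component[OF True]] show ?thesis .
qed (simp add: lin_map_def)

text \<open>\<open>J\<close> and \<open>L\<close> may have different types, since a numbered frame
  will be compared with matrix entries. Orthonormal columns preserve norms; orthonormal rows make
  the transpose a right inverse, so every translation of the target lifts to one of the
  source.\<close>

locale orthogonal_matrix =
  fixes J :: "'j set" and L :: "'l set" and A :: "'j \<Rightarrow> 'l \<Rightarrow> real"
  assumes fin: "finite J" "finite L"
    and cols: "\<And>l l'. l \<in> L \<Longrightarrow> l' \<in> L \<Longrightarrow> (\<Sum>p\<in>J. A p l * A p l') = (if l = l' then 1 else 0)"
    and rows: "\<And>p p'. p \<in> J \<Longrightarrow> p' \<in> J \<Longrightarrow> (\<Sum>l\<in>L. A p l * A p' l) = (if p = p' then 1 else 0)"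
begin

lemma card_eq: "card J = card L"
proof -
  have "real (card L) = (\<Sum>l\<in>L. \<Sum>p\<in>J. A p l * A p l)"
    using cols by simp
  also have "\<dots> = (\<Sum>p\<in>J. \<Sum>l\<in>L. A p l * A p l)" by (rule sum.swap)
  also have "\<dots> = real (card J)" using rows by simp
  finally show ?thesis by simp
qed

lemma norm_lin_map: "(\<Sum>p\<in>J. (lin_map J L A x p)\<^sup>2) = (\<Sum>l\<in>L. (x l)\<^sup>2)"
proof -
  have "(\<Sum>p\<in>J. (lin_map J L A x p)\<^sup>2) = (\<Sum>p\<in>J. \<Sum>l\<in>L. \<Sum>l'\<in>L. (A p l * A p l') * (x l * x l'))"
    by (intro sum.cong) (auto simp: lin_map_def power2_eq_square sum_product mult_ac)
  also have "\<dots> = (\<Sum>l\<in>L. \<Sum>l'\<in>L. (\<Sum>p\<in>J. A p l * A p l') * (x l * x l'))"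
    by (subst sum.swap, intro sum.cong refl, subst sum.swap) (simp add: sum_distrib_right)
  also have "\<dots> = (\<Sum>l\<in>L. \<Sum>l'\<in>L. if l' = l then x l * x l' else 0)"
    using cols by (intro sum.cong refl) auto
  also have "\<dots> = (\<Sum>l\<in>L. (x l)\<^sup>2)"
    using fin by (simp add: power2_eq_square)
  finally show ?thesis .
qed

lemma lin_map_transpose:
  assumes "y \<in> space (lborelP J)"
  shows "lin_map J L A (\<lambda>l\<in>L. x l + (\<Sum>p\<in>J. A p l * y p)) = (\<lambda>p\<in>J. lin_map J L A x p + y p)"
proof
  fix p
  show "lin_map J L A (\<lambda>l\<in>L. x l + (\<Sum>p\<in>J. A p l * y p)) p = (\<lambda>p\<in>J. lin_map J L A x p + y p) p"
  proof (cases "p \<in> J")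
    case True
    have "(\<Sum>l\<in>L. A p l * (\<Sum>q\<in>J. A q l * y q)) = (\<Sum>q\<in>J. (\<Sum>l\<in>L. A p l * A q l) * y q)"
      by (simp add: sum_distrib_left sum_distrib_right mult.assoc, subst sum.swap, rule refl)
    also have "\<dots> = (\<Sum>q\<in>J. if q = p then y q else 0)"
      using True rows by (intro sum.cong refl) auto
    also have "\<dots> = y p" using True fin by simp
    finally show ?thesis using True by (simp add: lin_map_def distrib_left sum.distrib)
  qed (simp add: lin_map_def)
qed

text \<open>Uniqueness of the translation-invariant measure: \<open>f(Tx) h(y - Tx)\<close>, with \<open>h\<close> an even
  Gaussian of the same mass in both spaces, is integrated in both orders.\<close>

lemma nn_integral_lin_map:
  assumes [measurable]: "f \<in> borel_measurable (lborelP J)"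
  shows "(\<integral>\<^sup>+x. f (lin_map J L A x) \<partial>lborelP L) = (\<integral>\<^sup>+x. f x \<partial>lborelP J)"
proof -
  interpret pair_sigma_finite "lborelP L" "lborelP J"
    using fin by (intro pair_sigma_finite.intro sigma_finite_lborelP)
  let ?T = "lin_map J L A"
  define h :: "('j \<Rightarrow> real) \<Rightarrow> ennreal" where "h y = (\<Prod>p\<in>J. ennreal (exp (- (y p)\<^sup>2)))" for y
  have [measurable]: "h \<in> borel_measurable (lborelP J)" unfolding h_def by measurable
  have h_eq: "h y = ennreal (exp (- (\<Sum>p\<in>J. (y p)\<^sup>2)))" for y
    using fin by (simp add: h_def prod_ennreal exp_sum sum_negf[symmetric])
  \<comment> \<open>Equality of the cardinalities makes both Gaussian masses the same number, which
    cancels at the end.\<close>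
  have hJ: "(\<integral>\<^sup>+y. h y \<partial>lborelP J) = ennreal (sqrt pi) ^ card L"
    unfolding h_def using fin card_eq by (subst lborel_prod.product_nn_integral_prod) (auto simp: nn_integral_gauss)
  have hT: "h (?T x) = (\<Prod>l\<in>L. ennreal (exp (- (x l)\<^sup>2)))" for x
    unfolding h_eq norm_lin_map using fin by (simp add: prod_ennreal exp_sum sum_negf[symmetric])
  have hL: "(\<integral>\<^sup>+x. h (?T x) \<partial>lborelP L) = ennreal (sqrt pi) ^ card L"
    unfolding hT using fin by (subst lborel_prod.product_nn_integral_prod) (auto simp: nn_integral_gauss)
  have h_minus: "h (\<lambda>p\<in>J. - y p) = h y" for y
    unfolding h_def by (intro prod.cong) auto
  have mdiff[measurable]: "(\<lambda>(x, y). \<lambda>p\<in>J. y p - ?T x p) \<in> measurable (lborelP L \<Otimes>\<^sub>M lborelP J) (lborelP J)"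
    unfolding case_prod_beta
    by (rule measurable_lborelP_restrict) measurable
  have madd[measurable]: "(\<lambda>(x, y). \<lambda>p\<in>J. y p + ?T x p) \<in> measurable (lborelP L \<Otimes>\<^sub>M lborelP J) (lborelP J)"
    unfolding case_prod_beta
    by (rule measurable_lborelP_restrict) measurable
  have mx: "(\<lambda>y. \<lambda>p\<in>J. y p + c p) \<in> measurable (lborelP J) (lborelP J)" for c :: "'j \<Rightarrow> real"
    by (rule measurable_lborelP_restrict) measurable
  have "(\<integral>\<^sup>+x. f (?T x) \<partial>lborelP L) * ennreal (sqrt pi) ^ card L
     = (\<integral>\<^sup>+x. f (?T x) * (\<integral>\<^sup>+y. h y \<partial>lborelP J) \<partial>lborelP L)"
    unfolding hJ by (rule nn_integral_multc[symmetric]) measurable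
  also have "\<dots> = (\<integral>\<^sup>+x. \<integral>\<^sup>+y. f (?T x) * h (\<lambda>p\<in>J. y p - ?T x p) \<partial>lborelP J \<partial>lborelP L)"
  proof (rule nn_integral_cong)
    fix x assume x: "x \<in> space (lborelP L)"
    have [measurable]: "(\<lambda>y. \<lambda>p\<in>J. y p - ?T x p) \<in> measurable (lborelP J) (lborelP J)"
      by (rule measurable_lborelP_restrict) measurable
    have "(\<integral>\<^sup>+y. h (\<lambda>p\<in>J. y p - ?T x p) \<partial>lborelP J) = (\<integral>\<^sup>+y. h y \<partial>lborelP J)"
      using nn_integral_lborelP_translate[OF fin(1), of h "\<lambda>p. - ?T x p"] by simp
    then show "f (?T x) * (\<integral>\<^sup>+y. h y \<partial>lborelP J) = (\<integral>\<^sup>+y. f (?T x) * h (\<lambda>p\<in>J. y p - ?T x p) \<partial>lborelP J)"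
      by (subst nn_integral_cmult) auto
  qed
  also have "\<dots> = (\<integral>\<^sup>+y. \<integral>\<^sup>+x. f (?T x) * h (\<lambda>p\<in>J. y p - ?T x p) \<partial>lborelP L \<partial>lborelP J)"
    by (rule Fubini'[symmetric]) measurable
  \<comment> \<open>For fixed \<open>y\<close>, translating \<open>x\<close> by the transpose
    applied to \<open>y\<close> turns \<open>?T x\<close> into \<open>y + ?T x\<close>; the argument
    of \<open>h\<close> becomes \<open>- ?T x\<close>, and evenness removes the sign.\<close>
  also have "\<dots> = (\<integral>\<^sup>+y. \<integral>\<^sup>+x. f (\<lambda>p\<in>J. y p + ?T x p) * h (?T x) \<partial>lborelP L \<partial>lborelP J)"
  proof (rule nn_integral_cong)
    fix y assume y: "y \<in> space (lborelP J)"
    define c where "c l = (\<Sum>p\<in>J. A p l * y p)" for l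
    have [measurable]: "(\<lambda>x. \<lambda>p\<in>J. y p - ?T x p) \<in> measurable (lborelP L) (lborelP J)"
      by (rule measurable_lborelP_restrict) measurable
    have "(\<integral>\<^sup>+x. f (?T x) * h (\<lambda>p\<in>J. y p - ?T x p) \<partial>lborelP L)
      = (\<integral>\<^sup>+x. f (?T (\<lambda>l\<in>L. x l + c l)) * h (\<lambda>p\<in>J. y p - ?T (\<lambda>l\<in>L. x l + c l) p) \<partial>lborelP L)"
      by (rule nn_integral_lborelP_translate[OF fin(2), symmetric]) measurable
    also have "\<dots> = (\<integral>\<^sup>+x. f (\<lambda>p\<in>J. y p + ?T x p) * h (?T x) \<partial>lborelP L)"
    proof -
      have 1: "?T (\<lambda>l\<in>L. x l + c l) = (\<lambda>p\<in>J. y p + ?T x p)" for x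
        unfolding c_def using lin_map_transpose[OF y, of x] by (simp add: add.commute)
      have 2: "h (\<lambda>p\<in>J. y p - (\<lambda>p\<in>J. y p + ?T x p) p) = h (?T x)" for x
      proof -
        have "h (\<lambda>p\<in>J. y p - (\<lambda>p\<in>J. y p + ?T x p) p) = h (\<lambda>p\<in>J. - ?T x p)"
          by (rule arg_cong[where f = h]) (auto simp: fun_eq_iff)
        then show ?thesis using h_minus by simp
      qed
      show ?thesis unfolding 1 2 ..
    qed
    finally show "(\<integral>\<^sup>+x. f (?T x) * h (\<lambda>p\<in>J. y p - ?T x p) \<partial>lborelP L)
      = (\<integral>\<^sup>+x. f (\<lambda>p\<in>J. y p + ?T x p) * h (?T x) \<partial>lborelP L)" .
  qed
  also have "\<dots> = (\<integral>\<^sup>+x. \<integral>\<^sup>+y. f (\<lambda>p\<in>J. y p + ?T x p) * h (?T x) \<partial>lborelP J \<partial>lborelP L)"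
    by (rule Fubini') measurable
  also have "\<dots> = (\<integral>\<^sup>+x. (\<integral>\<^sup>+y. f y \<partial>lborelP J) * h (?T x) \<partial>lborelP L)"
  proof (rule nn_integral_cong)
    fix x
    note mx[measurable]
    show "(\<integral>\<^sup>+y. f (\<lambda>p\<in>J. y p + ?T x p) * h (?T x) \<partial>lborelP J) = (\<integral>\<^sup>+y. f y \<partial>lborelP J) * h (?T x)"
      by (subst nn_integral_multc) (measurable, simp add: nn_integral_lborelP_translate[OF fin(1) assms])
  qed
  also have "\<dots> = (\<integral>\<^sup>+y. f y \<partial>lborelP J) * ennreal (sqrt pi) ^ card L"
    by (subst nn_integral_cmult) (measurable, simp add: hL)
  finally show ?thesis
    by (subst (asm) (1 2) mult.commute) (simp add: ennreal_mult_cancel_left ennreal_power)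
qed

end

section \<open>Completions of a diagonal to a positive semidefinite matrix\<close>

text \<open>Matrices are functions of two indices of which only the values below \<open>n\<close>
  count, so that deleting the last row and column changes nothing but \<open>n\<close>.\<close>

definition quad :: "nat \<Rightarrow> (nat \<Rightarrow> nat \<Rightarrow> real) \<Rightarrow> (nat \<Rightarrow> real) \<Rightarrow> real" where
  "quad n X v = (\<Sum>i<n. \<Sum>j<n. v i * X i j * v j)"

definition psd :: "nat \<Rightarrow> (nat \<Rightarrow> nat \<Rightarrow> real) \<Rightarrow> bool" where
  "psd n X \<longleftrightarrow> (\<forall>v. 0 \<le> quad n X v)"

lemma psd_cong:
  assumes "\<And>i j. i < n \<Longrightarrow> j < n \<Longrightarrow> X i j = Y i j"
  shows "psd n X = psd n Y"
  unfolding psd_def quad_def using assms by simp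

text \<open>Countably many test vectors suffice, whence measurability.\<close>

lemma psd_iff_int: "psd n X \<longleftrightarrow> (\<forall>v\<in>PiE {..<n} (\<lambda>_. range real_of_int). 0 \<le> quad n X v)"
proof
  assume *: "\<forall>v\<in>PiE {..<n} (\<lambda>_. range real_of_int). 0 \<le> quad n X v"
  show "psd n X" unfolding psd_def
  proof
    fix v :: "nat \<Rightarrow> real"
    \<comment> \<open>Rational approximations of \<open>v\<close> with denominator
      \<open>Suc m\<close>; the form is homogeneous, so clearing the denominator leaves an integer
      test vector.\<close>
    define u where "u m i = real_of_int \<lfloor>real (Suc m) * v i\<rfloor> / real (Suc m)" for m i
    have pos: "0 \<le> quad n X (u m)" for m
    proof -
      let ?w = "\<lambda>i\<in>{..<n}. real_of_int \<lfloor>real (Suc m) * v i\<rfloor>"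
      have "quad n X (u m) = quad n X ?w / (real (Suc m))\<^sup>2"
        unfolding quad_def u_def sum_divide_distrib
        by (intro sum.cong refl) (simp add: power2_eq_square)
      moreover have "0 \<le> quad n X ?w" using * by auto
      ultimately show ?thesis by simp
    qed
    have lim: "(\<lambda>m. u m i) \<longlonglongrightarrow> v i" for i
    proof (rule tendsto_sandwich[of "\<lambda>m. v i - 1 / real (Suc m)" _ _ "\<lambda>m. v i"])
      show "(\<lambda>m. v i) \<longlonglongrightarrow> v i" by simp
      show "(\<lambda>m. v i - 1 / real (Suc m)) \<longlonglongrightarrow> v i"
        using tendsto_diff[OF tendsto_const lim_inverse_n'[THEN LIMSEQ_Suc], of "v i"] by simp
      show "\<forall>\<^sub>F m in sequentially. v i - 1 / real (Suc m) \<le> u m i"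
      proof (rule always_eventually, rule allI)
        fix m
        have "real (Suc m) * v i - 1 \<le> real_of_int \<lfloor>real (Suc m) * v i\<rfloor>" by linarith
        then have "(real (Suc m) * v i - 1) / real (Suc m) \<le> u m i"
          unfolding u_def by (intro divide_right_mono) auto
        then show "v i - 1 / real (Suc m) \<le> u m i" by (simp add: diff_divide_distrib)
      qed
      show "\<forall>\<^sub>F m in sequentially. u m i \<le> v i"
      proof (rule always_eventually, rule allI)
        fix m
        have "u m i \<le> (real (Suc m) * v i) / real (Suc m)"
          unfolding u_def by (intro divide_right_mono) auto
        then show "u m i \<le> v i" by simp
      qed
    qed
    have "(\<lambda>m. quad n X (u m)) \<longlonglongrightarrow> quad n X v"
      unfolding quad_def by (intro tendsto_intros lim)
    then show "0 \<le> quad n X v" by (rule LIMSEQ_le_const) (use pos in auto)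
  qed
qed (auto simp: psd_def)

lemma measurable_psd:
  assumes "\<And>i j. i < n \<Longrightarrow> j < n \<Longrightarrow> (\<lambda>x. F x i j) \<in> borel_measurable M"
  shows "Measurable.pred M (\<lambda>x. psd n (F x))"
proof -
  have "countable (PiE {..<n} (\<lambda>_. range real_of_int))"
    by (intro countable_PiE) auto
  moreover have "Measurable.pred M (\<lambda>x. 0 \<le> quad n (F x) v)" for v
  proof -
    have quad: "(\<lambda>x. quad n (F x) v) \<in> borel_measurable M"
      unfolding quad_def
      by (intro borel_measurable_sum borel_measurable_times borel_measurable_const assms) auto
    have "Measurable.pred borel (\<lambda>y::real. 0 \<le> y)" by measurable
    then show ?thesis by (rule measurable_compose[OF quad])
  qed
  ultimately show ?thesis
    unfolding psd_iff_int pred_def by (intro sets.sets_Collect_countable_All') auto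
qed

text \<open>Completing the square in the last coordinate writes the form as that of the Schur
  complement plus \<open>X n n\<close> times a square.\<close>

lemma psd_Schur:
  assumes sym: "\<And>i j. X i j = X j i" and c: "X n n > 0"
  shows "psd (Suc n) X \<longleftrightarrow> psd n (\<lambda>i j. X i j - X i n * X j n / X n n)"
proof -
  let ?c = "X n n" and ?Y = "\<lambda>i j. X i j - X i n * X j n / X n n"
  have eq: "quad (Suc n) X v = quad n ?Y v + ?c * (v n + (\<Sum>i<n. v i * X i n) / ?c)\<^sup>2" for v
  proof -
    let ?s = "\<Sum>i<n. v i * X i n"
    have 1: "quad (Suc n) X v = (\<Sum>i<n. \<Sum>j<n. v i * X i j * v j) + 2 * v n * ?s + ?c * (v n)\<^sup>2"
      unfolding quad_def using sym
      by (simp add: sum.distrib sum_distrib_left power2_eq_square mult_ac)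
    have "?s * ?s = (\<Sum>i<n. \<Sum>j<n. v i * (X i n * X j n) * v j)"
      unfolding sum_product by (simp add: mult_ac)
    then have 2: "quad n ?Y v = (\<Sum>i<n. \<Sum>j<n. v i * X i j * v j) - ?s * ?s / ?c"
      unfolding quad_def
      by (simp add: right_diff_distrib left_diff_distrib sum_subtractf sum_divide_distrib)
    show ?thesis unfolding 1 2 using c by (simp add: power2_eq_square field_simps)
  qed
  show ?thesis
  proof
    assume *: "psd (Suc n) X"
    show "psd n ?Y" unfolding psd_def
    proof
      fix v
      \<comment> \<open>The last coordinate for which the square vanishes.\<close>
      let ?w = "v(n := - (\<Sum>i<n. v i * X i n) / ?c)"
      have "(\<Sum>i<n. ?w i * X i n) = (\<Sum>i<n. v i * X i n)" "quad n ?Y ?w = quad n ?Y v"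
        unfolding quad_def by auto
      then have "quad (Suc n) X ?w = quad n ?Y v" unfolding eq by simp
      then show "0 \<le> quad n ?Y v" using * unfolding psd_def by metis
    qed
  next
    assume "psd n ?Y"
    then show "psd (Suc n) X" unfolding psd_def eq using c by auto
  qed
qed

lemma psd_diag_nonneg: "psd n X \<Longrightarrow> i < n \<Longrightarrow> 0 \<le> X i i"
proof -
  assume *: "psd n X" "i < n"
  have "quad n X (\<lambda>j. if j = i then 1 else 0) = X i i"
  proof -
    have "quad n X (\<lambda>j. if j = i then 1 else 0) = (\<Sum>a<n. if a = i then (\<Sum>b<n. if b = i then X i i else 0) else 0)"
      unfolding quad_def
    proof (rule sum.cong)
      fix a assume "a \<in> {..<n}"
      show "(\<Sum>j<n. (if a = i then 1 else 0) * X a j * (if j = i then 1 else 0)) =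
        (if a = i then (\<Sum>b<n. if b = i then X i i else 0) else 0)"
      proof (cases "a = i")
        case True
        then show ?thesis by (auto intro!: sum.cong simp: if_distrib[of "\<lambda>t. _ * t"] simp del: sum.delta sum.delta')
      qed simp
    qed simp
    then show ?thesis using *(2) by simp
  qed
  then show ?thesis using * unfolding psd_def by metis
qed

definition psd_ind :: "nat \<Rightarrow> (nat \<Rightarrow> nat \<Rightarrow> real) \<Rightarrow> ennreal" where
  "psd_ind n X = (if psd n X then 1 else 0)"

lemma measurable_psd_ind:
  assumes "\<And>i j. i < n \<Longrightarrow> j < n \<Longrightarrow> (\<lambda>x. F x i j) \<in> borel_measurable M"
  shows "(\<lambda>x. psd_ind n (F x)) \<in> borel_measurable M"
  using measurable_psd[OF assms] unfolding psd_ind_def by measurable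

definition strict_upper :: "nat \<Rightarrow> (nat \<times> nat) set" where
  "strict_upper n = {(i, j). i < j \<and> j < n}"

lemma finite_strict_upper [simp]: "finite (strict_upper n)"
  by (rule finite_subset[of _ "{..<n} \<times> {..<n}"]) (auto simp: strict_upper_def)

text \<open>The factor \<open>sqrt 2\<close> makes the coordinates orthonormal for the Frobenius inner product.\<close>

definition symx :: "(nat \<Rightarrow> real) \<Rightarrow> (nat \<times> nat \<Rightarrow> real) \<Rightarrow> nat \<Rightarrow> nat \<Rightarrow> real" where
  "symx x z i j = (if i = j then x i else z (min i j, max i j) / sqrt 2)"

lemma symx_sym: "symx x z i j = symx x z j i"
  by (simp add: symx_def min.commute max.commute)

lemma min_max_strict_upper: "i < n \<Longrightarrow> j < n \<Longrightarrow> i \<noteq> j \<Longrightarrow> (min i j, max i j) \<in> strict_upper n"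
  by (auto simp: strict_upper_def)

text \<open>At the diagonal of ones this is the volume of the elliptope, the set of correlation
  matrices.\<close>

definition ellvol :: "nat \<Rightarrow> (nat \<Rightarrow> real) \<Rightarrow> ennreal" where
  "ellvol n x = (\<integral>\<^sup>+z. psd_ind n (symx x z) \<partial>lborelP (strict_upper n))"

lemma measurable_symx:
  assumes "i < n" "j < n" "strict_upper n \<subseteq> A"
  shows "(\<lambda>z. symx x z i j) \<in> borel_measurable (lborelP A)"
proof (cases "i = j")
  case False
  with assms have "(\<lambda>z. z (min i j, max i j)) \<in> borel_measurable (lborelP A)"
    using min_max_strict_upper by (intro measurable_lborelP_component) blast
  then show ?thesis using False unfolding symx_def by simp
qed (simp add: symx_def)

lemma ellvol_neg:
  assumes "i < n" "x i < 0"
  shows "ellvol n x = 0"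
proof -
  have "psd_ind n (symx x z) = 0" for z
    using psd_diag_nonneg[of n "symx x z" i] assms by (auto simp: psd_ind_def symx_def)
  then show ?thesis by (simp add: ellvol_def)
qed

section \<open>The Gamma weight and a Beta integral\<close>

definition gamma_wt :: "real \<Rightarrow> real \<Rightarrow> real" where
  "gamma_wt s x = (if 0 < x then x powr (s - 1) * exp (- x) else 0)"

lemma gamma_wt_nonneg: "0 \<le> gamma_wt s x"
  by (simp add: gamma_wt_def)

lemma borel_measurable_gamma_wt [measurable]: "gamma_wt s \<in> borel_measurable borel"
  unfolding gamma_wt_def[abs_def] by measurable

lemma nn_integral_gamma_wt:
  assumes "s > 0"
  shows "(\<integral>\<^sup>+x. ennreal (gamma_wt s x) \<partial>lborel) = ennreal (Gamma s)"
proof -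
  have "ennreal (Gamma s) = (\<integral>\<^sup>+t. ennreal (indicator {0..} t * t powr (s - 1) / exp t) \<partial>lborel)"
    by (rule Gamma_conv_nn_integral_real[OF assms])
  also have "\<dots> = (\<integral>\<^sup>+t. ennreal (gamma_wt s t) \<partial>lborel)"
    by (intro nn_integral_cong) (auto simp: gamma_wt_def indicator_def exp_minus field_simps)
  finally show ?thesis ..
qed

text \<open>The Beta integral \<open>B(1/2, s)\<close>.\<close>

definition slice_int :: "real \<Rightarrow> ennreal" where
  "slice_int s = (\<integral>\<^sup>+t. (if t\<^sup>2 < 1 then ennreal ((1 - t\<^sup>2) powr (s - 1)) else 0) \<partial>lborel)"

text \<open>The integral over one entry \<open>t\<close> of the last column in the Schur reduction:
  \<open>c\<close> is the pivot, \<open>x\<close> the diagonal entry that gets lowered by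
  \<open>t^2 / (2 c)\<close>. Rescaling \<open>t\<close> by \<open>sqrt (2 c x)\<close> makes the
  dependence on \<open>c\<close> and \<open>x\<close> explicit.\<close>

lemma slice_scale:
  assumes "x > 0" "c > 0"
  shows "(\<integral>\<^sup>+t. (if t\<^sup>2 < 2 * c * x then ennreal ((x - t\<^sup>2 / (2 * c)) powr (s - 1)) else 0) \<partial>lborel) =
         ennreal (sqrt (2 * c) * x powr (s - 1 / 2)) * slice_int s"
proof -
  let ?r = "sqrt (2 * c * x)"
  have r: "?r > 0" "?r\<^sup>2 = 2 * c * x" using assms by auto
  have "(\<integral>\<^sup>+t. (if t\<^sup>2 < 2 * c * x then ennreal ((x - t\<^sup>2 / (2 * c)) powr (s - 1)) else 0) \<partial>lborel)
    = ennreal ?r * (\<integral>\<^sup>+t. (if (?r * t)\<^sup>2 < 2 * c * x then ennreal ((x - (?r * t)\<^sup>2 / (2 * c)) powr (s - 1)) else 0) \<partial>lborel)"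
    using nn_integral_real_affine[of "\<lambda>t. if t\<^sup>2 < 2 * c * x then ennreal ((x - t\<^sup>2 / (2 * c)) powr (s - 1)) else 0" ?r 0] r assms
    unfolding add_0 by simp
  also have "(\<integral>\<^sup>+t. (if (?r * t)\<^sup>2 < 2 * c * x then ennreal ((x - (?r * t)\<^sup>2 / (2 * c)) powr (s - 1)) else 0) \<partial>lborel)
     = (\<integral>\<^sup>+t. ennreal (x powr (s - 1)) * (if t\<^sup>2 < 1 then ennreal ((1 - t\<^sup>2) powr (s - 1)) else 0) \<partial>lborel)"
  proof (rule nn_integral_cong)
    fix t :: real
    have 1: "(?r * t)\<^sup>2 = 2 * c * x * t\<^sup>2" using r by (simp add: power_mult_distrib)
    have "2 * c * x * t\<^sup>2 < 2 * c * x \<longleftrightarrow> t\<^sup>2 < 1" using assms by simp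
    moreover have "x - 2 * c * x * t\<^sup>2 / (2 * c) = x * (1 - t\<^sup>2)" using assms by (simp add: field_simps)
    ultimately show "(if (?r * t)\<^sup>2 < 2 * c * x then ennreal ((x - (?r * t)\<^sup>2 / (2 * c)) powr (s - 1)) else 0) =
      ennreal (x powr (s - 1)) * (if t\<^sup>2 < 1 then ennreal ((1 - t\<^sup>2) powr (s - 1)) else 0)"
      unfolding 1 using assms by (auto simp: powr_mult ennreal_mult)
  qed
  also have "\<dots> = ennreal (x powr (s - 1)) * slice_int s"
    unfolding slice_int_def by (rule nn_integral_cmult) measurable
  also have "ennreal ?r * (ennreal (x powr (s - 1)) * slice_int s) = ennreal (?r * x powr (s - 1)) * slice_int s"
    using r by (simp add: ennreal_mult mult.assoc)
  also have "?r * x powr (s - 1) = sqrt (2 * c) * x powr (s - 1 / 2)"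
  proof -
    have "s - 1 / 2 = 1 / 2 + (s - 1)" by simp
    then have "x powr (s - 1 / 2) = sqrt x * x powr (s - 1)"
      using assms by (simp only: powr_add powr_half_sqrt)
    then show ?thesis by (simp add: real_sqrt_mult)
  qed
  finally show ?thesis .
qed

text \<open>Integrate \<open>(x - t\<^sup>2)\<close> to the power \<open>s - 1\<close>, times \<open>exp(-x)\<close>, over \<open>x\<close> and \<open>t\<close> in both orders.\<close>

lemma slice_int_eq:
  assumes "s > 0"
  shows "slice_int s = ennreal (sqrt pi * Gamma s / Gamma (s + 1 / 2))"
proof -
  define g :: "real \<Rightarrow> real \<Rightarrow> ennreal" where
    "g x t = (if t\<^sup>2 < x then ennreal ((x - t\<^sup>2) powr (s - 1) * exp (- x)) else 0)" for x t
  have [measurable]: "(\<lambda>(x, t). g x t) \<in> borel_measurable (lborel \<Otimes>\<^sub>M lborel)"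
    unfolding g_def by measurable
  have 1: "(\<integral>\<^sup>+t. g x t \<partial>lborel) =
      ennreal (gamma_wt (s + 1 / 2) x) * slice_int s" for x
  proof (cases "0 < x")
    case True
    \<comment> \<open>The pivot \<open>c = 1/2\<close> makes \<open>2 * c\<close> equal to 1, which
      is the shape \<open>slice_scale\<close> expects.\<close>
    have "(\<integral>\<^sup>+t. g x t \<partial>lborel) = (\<integral>\<^sup>+t. (if t\<^sup>2 < 2 * (1/2) * x then ennreal ((x - t\<^sup>2 / (2 * (1/2))) powr (s - 1)) else 0) * ennreal (exp (- x)) \<partial>lborel)"
      by (intro nn_integral_cong) (auto simp: g_def ennreal_mult)
    also have "\<dots> = (\<integral>\<^sup>+t. (if t\<^sup>2 < 2 * (1/2) * x then ennreal ((x - t\<^sup>2 / (2 * (1/2))) powr (s - 1)) else 0) \<partial>lborel) * ennreal (exp (- x))"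
      by (rule nn_integral_multc) measurable
    also have "\<dots> = ennreal (x powr (s - 1 / 2)) * slice_int s * ennreal (exp (- x))"
      using slice_scale[OF True, of "1/2" s] by simp
    finally show ?thesis using True by (simp add: gamma_wt_def ennreal_mult mult_ac)
  next
    case False
    then have "g x t = 0" for t by (simp add: g_def not_less order.trans[OF _ zero_le_power2])
    then show ?thesis using False by (simp add: gamma_wt_def)
  qed
  have 2: "(\<integral>\<^sup>+x. g x t \<partial>lborel) = ennreal (Gamma s) * ennreal (exp (- t\<^sup>2))" for t
  proof -
    \<comment> \<open>With \<open>x = t^2 + y\<close> the integrand becomes the Gamma weight in
      \<open>y\<close> times the Gaussian in \<open>t\<close>.\<close>
    have "(\<integral>\<^sup>+x. g x t \<partial>lborel) = (\<integral>\<^sup>+y. g (t\<^sup>2 + 1 * y) t \<partial>lborel)"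
      using nn_integral_real_affine[of "\<lambda>x. g x t" 1 "t\<^sup>2"] unfolding g_def by simp
    also have "\<dots> = (\<integral>\<^sup>+y. ennreal (gamma_wt s y) * ennreal (exp (- t\<^sup>2)) \<partial>lborel)"
      by (intro nn_integral_cong)
         (auto simp: g_def gamma_wt_def ennreal_mult[symmetric] mult.assoc exp_add[symmetric])
    also have "\<dots> = ennreal (Gamma s) * ennreal (exp (- t\<^sup>2))"
      using nn_integral_gamma_wt[OF assms] by (subst nn_integral_multc) auto
    finally show ?thesis .
  qed
  have "ennreal (Gamma (s + 1 / 2)) * slice_int s = (\<integral>\<^sup>+x. \<integral>\<^sup>+t. g x t \<partial>lborel \<partial>lborel)"
    unfolding 1 using assms nn_integral_gamma_wt[of "s + 1 / 2"] by (subst nn_integral_multc) auto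
  also have "\<dots> = (\<integral>\<^sup>+t. \<integral>\<^sup>+x. g x t \<partial>lborel \<partial>lborel)"
    by (rule lborel_pair.Fubini'[symmetric]) measurable
  also have "\<dots> = ennreal (Gamma s) * ennreal (sqrt pi)"
    unfolding 2 by (subst nn_integral_cmult) (auto simp: nn_integral_gauss)
  finally have *: "ennreal (Gamma (s + 1 / 2)) * slice_int s = ennreal (Gamma s * sqrt pi)"
    using assms by (simp add: ennreal_mult Gamma_real_pos less_imp_le)
  have G: "Gamma (s + 1 / 2) > 0" using assms by (simp add: Gamma_real_pos)
  have "slice_int s = ennreal (1 / Gamma (s + 1 / 2)) * (ennreal (Gamma (s + 1 / 2)) * slice_int s)"
    using G by (simp add: mult.assoc[symmetric] ennreal_mult[symmetric])
  also have "\<dots> = ennreal (1 / Gamma (s + 1 / 2)) * ennreal (Gamma s * sqrt pi)" unfolding * ..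
  also have "\<dots> = ennreal (sqrt pi * Gamma s / Gamma (s + 1 / 2))"
    using G assms by (simp add: ennreal_mult[symmetric] Gamma_real_pos less_imp_le mult_ac)
  finally show ?thesis .
qed

text \<open>Serves to discard points at which a diagonal entry is exactly 0: there neither the
  closed formula, which needs positive entries, nor the vanishing for a negative entry applies. Each
  coordinate loses at most two values, so the exceptional set lies in finitely many null
  boxes.\<close>

lemma AE_lborelP_neq:
  assumes "finite I"
  shows "AE x in lborelP I. \<forall>i\<in>I. (x i)\<^sup>2 \<noteq> a i"
proof -
  have "AE x in lborelP I. (x i)\<^sup>2 \<noteq> a i" if i: "i \<in> I" for i
  proof -
    let ?B = "\<lambda>j. if j = i then {y. y\<^sup>2 = a i} else UNIV :: real set"
    have "y \<in> {sqrt (a i), - sqrt (a i)}" if "y\<^sup>2 = a i" for y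
    proof -
      have "sqrt (a i) = \<bar>y\<bar>" unfolding that[symmetric] by (rule real_sqrt_abs)
      then show ?thesis by (cases "0 \<le> y") auto
    qed
    then have fin: "finite {y::real. y\<^sup>2 = a i}"
      by (intro finite_subset[OF _ finite.insertI[OF finite.insertI[OF finite.emptyI]]] subsetI) auto
    then have m: "?B j \<in> sets lborel" for j by auto
    have "emeasure (lborelP I) (PiE I ?B) = (\<Prod>j\<in>I. emeasure lborel (?B j))"
      by (rule lborel_prod.emeasure_PiM[OF assms m])
    also have "\<dots> = 0"
      using assms i fin by (intro prod_zero bexI[of _ i]) (auto intro: emeasure_lborel_countable countable_finite)
    finally have "PiE I ?B \<in> null_sets (lborelP I)"
      using m assms by (auto simp: null_sets_def intro!: sets_PiM_I_finite)
    then show ?thesis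
      by (rule AE_I') (auto simp: space_PiM PiE_iff extensional_def)
  qed
  then show ?thesis using assms by (intro AE_finite_allI) auto
qed

text \<open>The elliptope volume in Frobenius coordinates, by \<open>ellvol_pos\<close> at the
  diagonal of ones. Passing to size \<open>Suc n\<close> integrates out the \<open>n\<close> entries
  of a column, each giving \<open>sqrt 2\<close> times the Beta value
  \<open>B(1/2, (n+1)/2)\<close>.\<close>

fun ellconst :: "nat \<Rightarrow> real" where
  "ellconst 0 = 1"
| "ellconst (Suc n) = ellconst n * (sqrt 2 * (sqrt pi * Gamma ((real n + 1) / 2) / Gamma (real n / 2 + 1))) ^ n"

lemma ellconst_pos: "ellconst n > 0"
  by (induction n) (auto intro!: mult_pos_pos divide_pos_pos Gamma_real_pos zero_less_power)

text \<open>Schur complement with respect to the last index: given the last column \<open>b\<close>, it shifts the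
  remaining off-diagonal entries, which preserves volume, and lowers the diagonal entries by
  \<open>b\<^sub>i\<^sup>2/(2x\<^sub>n)\<close>, so that the integral over \<open>b\<close> is a product.\<close>

lemma ellvol_pos:
  assumes "\<And>i. i < n \<Longrightarrow> 0 < x i"
  shows "ellvol n x = ennreal (ellconst n * (\<Prod>i<n. x i powr ((real n - 1) / 2)))"
  using assms
proof (induction n arbitrary: x)
  case 0
  have "strict_upper 0 = {}" by (auto simp: strict_upper_def)
  then show ?case
    by (simp add: ellvol_def lborel_prod.nn_integral_empty psd_ind_def psd_def quad_def PiM_empty)
next
  case (Suc n)
  let ?c = "x n"
  define col where "col = (\<lambda>i. (i, n)) ` {..<n}"
  have c: "?c > 0" using Suc.prems by simp
  have [simp]: "finite col" by (simp add: col_def)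
  have dj: "col \<inter> strict_upper n = {}" by (auto simp: col_def strict_upper_def)
  have un: "strict_upper (Suc n) = col \<union> strict_upper n" by (auto simp: col_def strict_upper_def)
  define y where "y b i = x i - (b (i, n))\<^sup>2 / (2 * ?c)" for b :: "nat \<times> nat \<Rightarrow> real" and i
  \<comment> \<open>The exponent is \<open>(real n - 1) / 2\<close>, written as \<open>s - 1\<close>
    with the Beta parameter \<open>s = (n + 1) / 2\<close>.\<close>
  define \<phi> where "\<phi> p t = (if t\<^sup>2 < 2 * ?c * x (fst p) then ennreal ((x (fst p) - t\<^sup>2 / (2 * ?c)) powr ((real n + 1) / 2 - 1)) else 0)"
    for p :: "nat \<times> nat" and t
  have mm: "(\<lambda>z. psd_ind (Suc n) (symx x z)) \<in> borel_measurable (lborelP (col \<union> strict_upper n))"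
    by (intro measurable_psd_ind measurable_symx[of _ "Suc n"]) (auto simp: un)
  have inner: "(\<integral>\<^sup>+z. psd_ind (Suc n) (symx x (merge col (strict_upper n) (b, z))) \<partial>lborelP (strict_upper n)) = ellvol n (y b)"
    for b
  proof -
    \<comment> \<open>The Schur complement lowers the entry \<open>(i, j)\<close> by
      \<open>b_i b_j / (2 x_n)\<close>, hence its Frobenius coordinate by \<open>sqrt 2\<close>
      times that. The amount does not involve \<open>z\<close>, so this is a translation.\<close>
    let ?s = "\<lambda>p. - sqrt 2 * b (fst p, n) * b (snd p, n) / (2 * ?c)"
    have "psd_ind (Suc n) (symx x (merge col (strict_upper n) (b, z))) =
          psd_ind n (symx (y b) (\<lambda>p\<in>strict_upper n. z p + ?s p))" for z
    proof -
      let ?X = "symx x (merge col (strict_upper n) (b, z))"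
      have Xnn: "?X n n = ?c" by (simp add: symx_def)
      have Xin: "?X i n = b (i, n) / sqrt 2" if "i < n" for i
        using that by (simp add: symx_def merge_def col_def)
      have Xij: "?X i j = z (min i j, max i j) / sqrt 2" if "i < n" "j < n" "i \<noteq> j" for i j
        using that min_max_strict_upper[of i n j] dj by (auto simp: symx_def merge_def)
      have "psd (Suc n) ?X \<longleftrightarrow> psd n (\<lambda>i j. ?X i j - ?X i n * ?X j n / ?X n n)"
        using c by (intro psd_Schur) (auto simp: symx_sym Xnn)
      also have "\<dots> \<longleftrightarrow> psd n (symx (y b) (\<lambda>p\<in>strict_upper n. z p + ?s p))"
      proof (rule psd_cong)
        fix i j assume ij: "i < n" "j < n"
        show "?X i j - ?X i n * ?X j n / ?X n n = symx (y b) (\<lambda>p\<in>strict_upper n. z p + ?s p) i j"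
        proof (cases "i = j")
          case True
          have "?X i i = x i" by (simp add: symx_def)
          then show ?thesis
            using True ij c by (simp add: Xin Xnn y_def symx_def[of "y b"] power2_eq_square)
        next
          case False
          have frame_vec: "b (min i j, n) * b (max i j, n) = b (i, n) * b (j, n)"
            by (cases "i < j") (auto simp: min_def max_def)
          have "symx (y b) (\<lambda>p\<in>strict_upper n. z p + ?s p) i j
             = (z (min i j, max i j) - sqrt 2 * (b (min i j, n) * b (max i j, n)) / (2 * ?c)) / sqrt 2"
            using False min_max_strict_upper[OF ij False] by (simp add: symx_def[of "y b"] mult.assoc)
          also have "\<dots> = z (min i j, max i j) / sqrt 2 - b (i, n) * b (j, n) / (2 * ?c)"
            unfolding frame_vec using c by (simp add: diff_divide_distrib)
          finally show ?thesis
            unfolding Xij[OF ij False] Xin[OF ij(1)] Xin[OF ij(2)] Xnn by simp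
        qed
      qed
      finally show ?thesis by (simp add: psd_ind_def)
    qed
    then show ?thesis
      unfolding ellvol_def
      by (simp only:, intro nn_integral_lborelP_translate measurable_psd_ind measurable_symx[of _ n]) auto
  qed
  have "ellvol (Suc n) x = (\<integral>\<^sup>+b. ellvol n (y b) \<partial>lborelP col)"
    unfolding ellvol_def un using inner
    by (subst lborel_prod.product_nn_integral_fold[OF dj]) (use mm in \<open>auto simp: ellvol_def\<close>)
  also have "\<dots> = (\<integral>\<^sup>+b. ennreal (ellconst n) * (\<Prod>p\<in>col. \<phi> p (b p)) \<partial>lborelP col)"
  proof (rule nn_integral_cong_AE)
    have "AE b in lborelP col. \<forall>p\<in>col. (b p)\<^sup>2 \<noteq> 2 * ?c * x (fst p)"
      by (rule AE_lborelP_neq) simp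
    then show "AE b in lborelP col. ellvol n (y b) = ennreal (ellconst n) * (\<Prod>p\<in>col. \<phi> p (b p))"
    proof eventually_elim
      case (elim b)
      have *: "(\<Prod>p\<in>col. \<phi> p (b p)) = (\<Prod>i<n. \<phi> (i, n) (b (i, n)))"
        unfolding col_def by (subst prod.reindex) (auto simp: inj_on_def)
      have ypos: "0 < y b i \<longleftrightarrow> (b (i, n))\<^sup>2 < 2 * ?c * x i" for i
        using c by (simp add: y_def field_simps)
      show ?case
      proof (cases "\<forall>i<n. 0 < y b i")
        case True
        then have "ellvol n (y b) = ennreal (ellconst n * (\<Prod>i<n. y b i powr ((real n - 1) / 2)))"
          by (intro Suc.IH) auto
        also have "\<dots> = ennreal (ellconst n) * (\<Prod>i<n. ennreal (y b i powr ((real n - 1) / 2)))"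
          using ellconst_pos[of n] by (simp add: ennreal_mult prod_nonneg prod_ennreal)
        also have "(\<Prod>i<n. ennreal (y b i powr ((real n - 1) / 2))) = (\<Prod>i<n. \<phi> (i, n) (b (i, n)))"
        proof (rule prod.cong)
          fix i assume "i \<in> {..<n}"
          moreover have "(real n - 1) / 2 = (real n + 1) / 2 - 1" by (simp add: field_simps)
          ultimately show "ennreal (y b i powr ((real n - 1) / 2)) = \<phi> (i, n) (b (i, n))"
            using True ypos[of i] by (simp add: \<phi>_def y_def)
        qed simp
        finally show ?thesis using * by simp
      next
        case False
        then obtain i where i: "i < n" "\<not> 0 < y b i" by auto
        have "(b (i, n))\<^sup>2 \<noteq> 2 * ?c * x i" using elim i by (force simp: col_def)
        then have "y b i \<noteq> 0" using c by (auto simp: y_def field_simps)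
        then have "y b i < 0" using i by simp
        then have "ellvol n (y b) = 0" using ellvol_neg i by blast
        moreover have "\<phi> (i, n) (b (i, n)) = 0" using i ypos[of i] by (simp add: \<phi>_def)
        ultimately show ?thesis using * i by (auto intro!: prod_zero)
      qed
    qed
  qed
  also have "\<dots> = ennreal (ellconst n) * (\<Prod>p\<in>col. \<integral>\<^sup>+t. \<phi> p t \<partial>lborel)"
  proof -
    have [measurable]: "\<phi> p \<in> borel_measurable borel" for p unfolding \<phi>_def by measurable
    show ?thesis
      by (subst nn_integral_cmult) (measurable, subst lborel_prod.product_nn_integral_prod, auto)
  qed
  also have "(\<Prod>p\<in>col. \<integral>\<^sup>+t. \<phi> p t \<partial>lborel) = (\<Prod>i<n. \<integral>\<^sup>+t. \<phi> (i, n) t \<partial>lborel)"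
    unfolding col_def by (subst prod.reindex) (auto simp: inj_on_def)
  also have "\<dots> = (\<Prod>i<n. ennreal (sqrt (2 * ?c) * x i powr (real n / 2) *
      (sqrt pi * Gamma ((real n + 1) / 2) / Gamma (real n / 2 + 1))))"
  proof (rule prod.cong)
    fix i assume i: "i \<in> {..<n}"
    let ?s = "(real n + 1) / 2"
    have "(\<integral>\<^sup>+t. \<phi> (i, n) t \<partial>lborel) = ennreal (sqrt (2 * ?c) * x i powr (?s - 1 / 2)) * slice_int ?s"
      unfolding \<phi>_def fst_conv by (rule slice_scale) (use Suc.prems i c in auto)
    also have "slice_int ?s = ennreal (sqrt pi * Gamma ?s / Gamma (?s + 1 / 2))"
      by (rule slice_int_eq) simp
    also have "?s + 1 / 2 = real n / 2 + 1" by (simp add: field_simps)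
    also have "?s - 1 / 2 = real n / 2" by (simp add: field_simps)
    finally show "(\<integral>\<^sup>+t. \<phi> (i, n) t \<partial>lborel) = ennreal (sqrt (2 * ?c) * x i powr (real n / 2) *
      (sqrt pi * Gamma ((real n + 1) / 2) / Gamma (real n / 2 + 1)))"
      by (subst ennreal_mult) (use c in \<open>auto simp: Gamma_real_pos less_imp_le\<close>)
  qed simp
  also have "ennreal (ellconst n) * \<dots> = ennreal (ellconst n * (\<Prod>i<n. sqrt (2 * ?c) * x i powr (real n / 2) *
      (sqrt pi * Gamma ((real n + 1) / 2) / Gamma (real n / 2 + 1))))"
    using c ellconst_pos[of n]
    by (subst prod_ennreal) (auto simp: ennreal_mult prod_nonneg Gamma_real_pos less_imp_le)
  also have "ellconst n * (\<Prod>i<n. sqrt (2 * ?c) * x i powr (real n / 2) *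
      (sqrt pi * Gamma ((real n + 1) / 2) / Gamma (real n / 2 + 1))) =
      ellconst (Suc n) * ((sqrt ?c) ^ n * (\<Prod>i<n. x i powr (real n / 2)))"
    by (simp add: prod.distrib prod_dividef real_sqrt_mult power_mult_distrib mult_ac power_divide)
  \<comment> \<open>Each column integral contributes one \<open>sqrt ?c\<close>; together they form
    the factor of the product that belongs to the last diagonal entry.\<close>
  also have "(sqrt ?c) ^ n = ?c powr (real n / 2)"
  proof -
    have "(sqrt ?c) ^ n = (?c powr (1 / 2)) powr real n"
      using c by (simp add: powr_half_sqrt powr_realpow)
    then show ?thesis by (simp add: powr_powr)
  qed
  finally show ?case by (simp add: mult.commute)
qed

section \<open>Orthonormal families and the spectral theorem\<close>

definition ipr :: "'j set \<Rightarrow> ('j \<Rightarrow> real) \<Rightarrow> ('j \<Rightarrow> real) \<Rightarrow> real" where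
  "ipr J x y = (\<Sum>p\<in>J. x p * y p)"

definition orthonormal :: "'j set \<Rightarrow> nat \<Rightarrow> (nat \<Rightarrow> 'j \<Rightarrow> real) \<Rightarrow> bool" where
  "orthonormal J m b \<longleftrightarrow> (\<forall>k<m. \<forall>l<m. ipr J (b k) (b l) = (if k = l then 1 else 0))"

lemma ipr_commute: "ipr J x y = ipr J y x"
  by (simp add: ipr_def mult.commute)

lemma ipr_add_right: "ipr J x (\<lambda>p. y p + z p) = ipr J x y + ipr J x z"
  and ipr_diff_right: "ipr J x (\<lambda>p. y p - z p) = ipr J x y - ipr J x z"
  and ipr_scale_right: "ipr J x (\<lambda>p. c * y p) = c * ipr J x y"
  by (simp_all add: ipr_def distrib_left right_diff_distrib sum.distrib sum_subtractf sum_distrib_left mult_ac)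

lemma ipr_add_left: "ipr J (\<lambda>p. y p + z p) x = ipr J y x + ipr J z x"
  and ipr_scale_left: "ipr J (\<lambda>p. c * y p) x = c * ipr J y x"
  by (simp_all add: ipr_commute[of J _ x] ipr_add_right ipr_scale_right)

lemma ipr_sum_right: "ipr J x (\<lambda>p. \<Sum>l\<in>A. c l * b l p) = (\<Sum>l\<in>A. c l * ipr J x (b l))"
  unfolding ipr_def sum_distrib_left by (subst sum.swap) (simp add: mult_ac)

lemma ipr_self_nonneg: "0 \<le> ipr J x x"
  by (simp add: ipr_def sum_nonneg)

lemma ipr_self_eq_0: "finite J \<Longrightarrow> ipr J x x = 0 \<longleftrightarrow> (\<forall>p\<in>J. x p = 0)"
  by (simp add: ipr_def sum_nonneg_eq_0_iff)

lemma ipr_cong: "(\<And>p. p \<in> J \<Longrightarrow> x p = x' p) \<Longrightarrow> (\<And>p. p \<in> J \<Longrightarrow> y p = y' p) \<Longrightarrow> ipr J x y = ipr J x' y'"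
  by (simp add: ipr_def)

context
  fixes J :: "'j set" and m :: nat and b :: "nat \<Rightarrow> 'j \<Rightarrow> real"
  assumes fin: "finite J" and on: "orthonormal J m b"
begin

text \<open>The component of the \<open>p\<close>-th coordinate vector orthogonal to the family.\<close>

definition resid :: "'j \<Rightarrow> 'j \<Rightarrow> real" where
  "resid p q = (if q = p then 1 else 0) - (\<Sum>l<m. b l p * b l q)"

lemma ipr_delta: "p \<in> J \<Longrightarrow> ipr J x (\<lambda>q. if q = p then 1 else 0) = x p"
  using fin by (simp add: ipr_def if_distrib[of "\<lambda>t. _ * t"] cong: if_cong)

lemma resid_orth:
  assumes "p \<in> J" "l < m"
  shows "ipr J (b l) (resid p) = 0"
proof -
  have "ipr J (b l) (resid p) = b l p - (\<Sum>k<m. b k p * ipr J (b l) (b k))"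
    unfolding resid_def[abs_def] ipr_diff_right ipr_sum_right using assms ipr_delta by simp
  also have "(\<Sum>k<m. b k p * ipr J (b l) (b k)) = (\<Sum>k<m. if k = l then b k p else 0)"
    using on assms by (intro sum.cong) (auto simp: orthonormal_def)
  finally show ?thesis using assms by simp
qed

lemma resid_self:
  assumes "p \<in> J"
  shows "ipr J (resid p) (resid p) = 1 - (\<Sum>l<m. (b l p)\<^sup>2)"
proof -
  have r: "resid p = (\<lambda>q. (if q = p then 1 else 0) - (\<Sum>l<m. b l p * b l q))"
    by (simp add: resid_def fun_eq_iff)
  have "ipr J x (resid p) = ipr J x (\<lambda>q. if q = p then 1 else 0) - (\<Sum>l<m. b l p * ipr J x (b l))" for x
    unfolding r ipr_diff_right ipr_sum_right ..
  from this[of "resid p"]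
  have "ipr J (resid p) (resid p) = ipr J (resid p) (\<lambda>q. if q = p then 1 else 0) - (\<Sum>l<m. b l p * ipr J (resid p) (b l))" .
  also have "(\<Sum>l<m. b l p * ipr J (resid p) (b l)) = 0"
    using resid_orth[OF assms] by (simp add: ipr_commute[of J "resid p"])
  also have "ipr J (resid p) (\<lambda>q. if q = p then 1 else 0) = resid p p" by (rule ipr_delta[OF assms])
  also have "resid p p = 1 - (\<Sum>l<m. (b l p)\<^sup>2)" by (simp add: resid_def power2_eq_square)
  finally show ?thesis by simp
qed

lemma sum_norms: "(\<Sum>p\<in>J. \<Sum>l<m. (b l p)\<^sup>2) = real m"
proof -
  have "(\<Sum>p\<in>J. \<Sum>l<m. (b l p)\<^sup>2) = (\<Sum>l<m. ipr J (b l) (b l))"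
    unfolding ipr_def power2_eq_square by (rule sum.swap)
  then show ?thesis using on by (simp add: orthonormal_def)
qed

text \<open>The squared lengths of the projections of the coordinate vectors onto the span add up to
  \<open>m\<close>. If \<open>m < card J\<close>, one of them is below 1, and the residual of that
  coordinate vector is nonzero and can be normalised.\<close>

lemma orthonormal_extend:
  assumes "m < card J"
  shows "\<exists>v. (\<forall>p. p \<notin> J \<longrightarrow> v p = 0) \<and> ipr J v v = 1 \<and> (\<forall>l<m. ipr J (b l) v = 0)"
proof -
  have "\<exists>p\<in>J. (\<Sum>l<m. (b l p)\<^sup>2) < 1"
  proof (rule ccontr)
    assume "\<not> ?thesis"
    then have "(\<Sum>p\<in>J. 1) \<le> (\<Sum>p\<in>J. \<Sum>l<m. (b l p)\<^sup>2)" by (intro sum_mono) auto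
    then show False using assms sum_norms by simp
  qed
  then obtain p where p: "p \<in> J" "(\<Sum>l<m. (b l p)\<^sup>2) < 1" by blast
  define r where "r = sqrt (ipr J (resid p) (resid p))"
  have r: "r > 0" "r * r = ipr J (resid p) (resid p)"
    unfolding r_def using p resid_self[OF p(1)] by auto
  define v where "v q = (if q \<in> J then inverse r * resid p q else 0)" for q
  have v: "ipr J x v = inverse r * ipr J x (resid p)" for x
    unfolding ipr_scale_right[symmetric] by (rule ipr_cong) (auto simp: v_def)
  have "ipr J v v = inverse r * (inverse r * ipr J (resid p) (resid p))"
    unfolding v using v[of "resid p"] by (simp add: ipr_commute)
  then have "ipr J v v = 1" using r(1) unfolding r(2)[symmetric] by (simp add: field_simps)
  moreover have "ipr J (b l) v = 0" if "l < m" for l using v resid_orth[OF p(1) that] by simp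
  moreover have "v q = 0" if "q \<notin> J" for q using that by (simp add: v_def)
  ultimately show ?thesis by blast
qed

text \<open>The squared residuals of all coordinate vectors add up to \<open>card J - m\<close>, so
  for a full family each residual vanishes, which is the completeness relation.\<close>

lemma orthonormal_complete:
  assumes "m = card J" "p \<in> J" "q \<in> J"
  shows "(\<Sum>l<m. b l p * b l q) = (if p = q then 1 else 0)"
proof -
  have "(\<Sum>p\<in>J. ipr J (resid p) (resid p)) = (\<Sum>p\<in>J. 1 - (\<Sum>l<m. (b l p)\<^sup>2))"
    by (rule sum.cong) (auto simp: resid_self)
  also have "\<dots> = 0" using sum_norms assms(1) by (simp add: sum_subtractf)
  finally have "(\<Sum>p\<in>J. ipr J (resid p) (resid p)) = 0" .
  then have "ipr J (resid p) (resid p) = 0"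
    using fin assms(2) by (subst (asm) sum_nonneg_eq_0_iff) (auto simp: ipr_self_nonneg)
  then have "resid p q = 0" using ipr_self_eq_0[OF fin] assms(3) by blast
  then show ?thesis by (auto simp: resid_def split: if_splits)
qed

end

lemma orthonormal_update:
  assumes "orthonormal J m b" "ipr J v v = 1" "\<And>l. l < m \<Longrightarrow> ipr J (b l) v = 0"
  shows "orthonormal J (Suc m) (b(m := v))"
  unfolding orthonormal_def
proof (intro allI impI)
  fix k l assume kl: "k < Suc m" "l < Suc m"
  have "ipr J v (b l) = 0" if "l < m" for l using assms(3)[OF that] by (simp add: ipr_commute)
  then show "ipr J ((b(m := v)) k) ((b(m := v)) l) = (if k = l then 1 else 0)"
    using assms kl unfolding orthonormal_def by (cases "k = m"; cases "l = m") auto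
qed

lemma orthonormal_basis_extend:
  assumes "finite J" "orthonormal J m b" "m \<le> card J"
  shows "\<exists>b'. (\<forall>l<m. b' l = b l) \<and> orthonormal J (card J) b'"
proof -
  have "\<exists>b'. (\<forall>l<m. b' l = b l) \<and> orthonormal J (m + k) b'" if "m + k \<le> card J" for k
    using that
  proof (induction k)
    case 0
    then show ?case using assms by auto
  next
    case (Suc k)
    then obtain b' where b': "\<forall>l<m. b' l = b l" "orthonormal J (m + k) b'" by auto
    from orthonormal_extend[OF assms(1) b'(2)] Suc.prems
    obtain v where "ipr J v v = 1" "\<forall>l<m + k. ipr J (b' l) v = 0" by auto
    then have "orthonormal J (Suc (m + k)) (b'(m + k := v))" by (intro orthonormal_update b') auto
    moreover have "\<forall>l<m. (b'(m + k := v)) l = b l" using b'(1) by simp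
    ultimately show ?case unfolding add_Suc_right by blast
  qed
  from this[of "card J - m"] assms(3) show ?thesis by simp
qed

text \<open>Vectors are functions on all naturals with the product topology. Vanishing from
  \<open>n\<close> on keeps the set inside a cube, which is compact by Tychonoff's theorem, and all
  conditions are closed.\<close>

lemma compact_unit_vectors:
  "compact {v :: nat \<Rightarrow> real. (\<forall>i. i \<notin> {..<n} \<longrightarrow> v i = 0) \<and> ipr {..<n} v v = 1 \<and> (\<forall>l<m. ipr {..<n} (u l) v = 0)}"
    (is "compact ?S")
proof -
  have "compactin (product_topology (\<lambda>i. euclidean) UNIV) (PiE UNIV (\<lambda>i::nat. {-1..1::real}))"
    by (subst compactin_PiE) auto
  then have K: "compact (PiE UNIV (\<lambda>i::nat. {-1..1::real}))"
    by (simp add: euclidean_product_topology)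
  have cont: "continuous_on UNIV (\<lambda>v::nat \<Rightarrow> real. v i)" for i
    by (rule continuous_on_product_coordinates)
  have eq: "?S = (\<Inter>i\<in>-{..<n}. {v. v i = 0}) \<inter> {v. ipr {..<n} v v = 1} \<inter> (\<Inter>l\<in>{..<m}. {v. ipr {..<n} (u l) v = 0})"
    by auto
  have "closed ?S"
    unfolding eq unfolding ipr_def
    by (intro closed_Int closed_INT ballI closed_Collect_eq continuous_intros cont)
  moreover have "?S \<subseteq> PiE UNIV (\<lambda>i::nat. {-1..1::real})"
  proof
    fix v assume v: "v \<in> ?S"
    have "\<bar>v i\<bar> \<le> 1" for i
    proof (cases "i < n")
      case True
      have "(v i)\<^sup>2 \<le> ipr {..<n} v v"
        unfolding ipr_def power2_eq_square using True by (intro member_le_sum) auto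
      then show ?thesis using v by (simp add: abs_square_le_1)
    qed (use v in auto)
    then show "v \<in> PiE UNIV (\<lambda>i::nat. {-1..1::real})" by (auto simp: abs_le_iff minus_le_iff)
  qed
  ultimately have "compact (PiE UNIV (\<lambda>i::nat. {-1..1::real}) \<inter> ?S)" by (intro compact_Int_closed K)
  then show ?thesis using \<open>?S \<subseteq> _\<close> by (simp add: Int_absorb1)
qed

definition mvec :: "nat \<Rightarrow> (nat \<Rightarrow> nat \<Rightarrow> real) \<Rightarrow> (nat \<Rightarrow> real) \<Rightarrow> nat \<Rightarrow> real" where
  "mvec n X v i = (if i < n then \<Sum>j<n. X i j * v j else 0)"

lemma mvec_self_adjoint:
  assumes "\<And>i j. i < n \<Longrightarrow> j < n \<Longrightarrow> X i j = X j i"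
  shows "ipr {..<n} (mvec n X v) w = ipr {..<n} v (mvec n X w)"
proof -
  have "ipr {..<n} (mvec n X v) w = (\<Sum>i<n. \<Sum>j<n. X i j * v j * w i)"
    by (simp add: ipr_def mvec_def sum_distrib_right)
  also have "\<dots> = (\<Sum>j<n. \<Sum>i<n. X j i * v j * w i)"
    by (subst sum.swap) (use assms in \<open>auto intro!: sum.cong\<close>)
  also have "\<dots> = ipr {..<n} v (mvec n X w)"
    by (simp add: ipr_def mvec_def sum_distrib_left mult_ac)
  finally show ?thesis .
qed

text \<open>A maximiser of the quadratic form on the unit sphere of the orthogonal complement.\<close>

lemma symmetric_eigenvector:
  assumes sym: "\<And>i j. i < n \<Longrightarrow> j < n \<Longrightarrow> X i j = X j i"
    and on: "orthonormal {..<n} m u"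
    and eig: "\<And>a i. a < m \<Longrightarrow> i < n \<Longrightarrow> mvec n X (u a) i = lam a * u a i"
    and "m < n"
  shows "\<exists>v \<mu>. ipr {..<n} v v = 1 \<and> (\<forall>l<m. ipr {..<n} (u l) v = 0) \<and> (\<forall>i<n. mvec n X v i = \<mu> * v i)"
proof -
  let ?ip = "ipr {..<n}" and ?M = "mvec n X"
  define S where "S = {v :: nat \<Rightarrow> real. (\<forall>i. i \<notin> {..<n} \<longrightarrow> v i = 0) \<and> ?ip v v = 1 \<and> (\<forall>l<m. ?ip (u l) v = 0)}"
  have "compact S" unfolding S_def by (rule compact_unit_vectors)
  moreover have "S \<noteq> {}"
    using orthonormal_extend[OF _ on] \<open>m < n\<close> unfolding S_def by auto
  moreover have "continuous_on S (\<lambda>v. ?ip v (?M v))"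
  proof -
    have "continuous_on UNIV (\<lambda>v::nat \<Rightarrow> real. v i)" for i
      by (rule continuous_on_product_coordinates)
    then have c: "continuous_on S (\<lambda>v::nat \<Rightarrow> real. v i)" for i
      by (rule continuous_on_subset) simp
    have "?ip v (?M v) = (\<Sum>i<n. v i * (\<Sum>j<n. X i j * v j))" for v
      by (simp add: ipr_def mvec_def)
    then show ?thesis by (simp only:) (intro continuous_intros c)
  qed
  ultimately obtain v where v: "v \<in> S" and max: "\<And>w. w \<in> S \<Longrightarrow> ?ip w (?M w) \<le> ?ip v (?M v)"
    using continuous_attains_sup[of S "\<lambda>v. ?ip v (?M v)"] by blast
  define \<mu> where "\<mu> = ?ip v (?M v)"
  have v1: "?ip v v = 1" and vu: "\<And>l. l < m \<Longrightarrow> ?ip (u l) v = 0" using v by (auto simp: S_def)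
  have Mlin: "?M (\<lambda>i. a i + t * c i) = (\<lambda>i. ?M a i + t * ?M c i)" for a c t
    by (auto simp: mvec_def fun_eq_iff distrib_left sum.distrib sum_distrib_left mult_ac)
  \<comment> \<open>By scaling, the maximum on the sphere bounds the form on the whole orthogonal
    complement.\<close>
  have bound: "?ip w (?M w) \<le> \<mu> * ?ip w w" if w: "\<And>l. l < m \<Longrightarrow> ?ip (u l) w = 0" for w
  proof (cases "?ip w w = 0")
    case True
    then have "\<forall>i<n. w i = 0" using ipr_self_eq_0[of "{..<n}" w] by auto
    then show ?thesis by (simp add: ipr_def)
  next
    case False
    define r where "r = sqrt (?ip w w)"
    have r: "r > 0" "r * r = ?ip w w" unfolding r_def using False ipr_self_nonneg[of "{..<n}" w] by auto
    define z where "z i = (if i < n then inverse r * w i else 0)" for i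
    have z: "?ip x z = inverse r * ?ip x w" for x
      unfolding ipr_scale_right[symmetric] by (rule ipr_cong) (auto simp: z_def)
    have Mz: "?M z = (\<lambda>i. inverse r * ?M w i)"
      by (auto simp: mvec_def fun_eq_iff z_def sum_distrib_left mult_ac)
    have z': "?ip z x = inverse r * ?ip w x" for x
      using z[of x] by (simp add: ipr_commute)
    have "?ip z z = inverse r * inverse r * (r * r)" unfolding z z' r(2) by simp
    then have "?ip z z = 1" using r(1) by (simp add: field_simps)
    moreover have "?ip (u l) z = 0" if "l < m" for l using z w[OF that] by simp
    ultimately have "z \<in> S" unfolding S_def by (auto simp: z_def)
    from max[OF this] have "inverse r * (inverse r * ?ip w (?M w)) \<le> \<mu>"
      unfolding Mz \<mu>_def ipr_scale_right z' .
    then show ?thesis using r(1) unfolding r(2)[symmetric] by (simp add: field_simps)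
  qed
  \<comment> \<open>The first variation vanishes: \<open>v + t w\<close> obeys the bound for every
    real \<open>t\<close>, so the term linear in \<open>t\<close> has to be zero.\<close>
  have bil: "?ip w (?M v) = 0" if w: "\<And>l. l < m \<Longrightarrow> ?ip (u l) w = 0" and wv: "?ip v w = 0" for w
  proof -
    define b D where "b = ?ip w (?M v)" and "D = \<mu> * ?ip w w - ?ip w (?M w)"
    have D: "D \<ge> 0" using bound[OF w] by (simp add: D_def)
    have vw: "?ip v (?M w) = b"
      using mvec_self_adjoint[of n X v w] sym by (simp add: b_def ipr_commute)
    have key: "2 * t * b \<le> t\<^sup>2 * D" for t
    proof -
      have "?ip (\<lambda>i. v i + t * w i) (?M (\<lambda>i. v i + t * w i)) \<le> \<mu> * ?ip (\<lambda>i. v i + t * w i) (\<lambda>i. v i + t * w i)"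
        by (rule bound) (simp add: ipr_add_right ipr_scale_right vu w)
      then show ?thesis
        unfolding Mlin ipr_add_right ipr_add_left ipr_scale_right ipr_scale_left vw b_def[symmetric]
          \<mu>_def[symmetric] v1 wv ipr_commute[of _ w v]
        by (simp add: D_def power2_eq_square algebra_simps)
    qed
    \<comment> \<open>At this \<open>t\<close> the linear term exceeds the quadratic one unless
      \<open>b = 0\<close>; \<open>D + 1\<close> instead of \<open>D\<close> avoids a zero
      denominator.\<close>
    have "2 * (b / (D + 1)) * b \<le> (b / (D + 1))\<^sup>2 * D" by (rule key)
    then have "2 * b\<^sup>2 * (D + 1) \<le> b\<^sup>2 * D"
      using D by (simp add: power2_eq_square divide_simps)
    moreover have "b\<^sup>2 * D \<ge> 0" using D by simp
    moreover have "2 * b\<^sup>2 * (D + 1) = 2 * (b\<^sup>2 * D) + 2 * b\<^sup>2" by (simp add: algebra_simps)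
    ultimately have "b\<^sup>2 \<le> 0" by linarith
    then show ?thesis by (simp add: b_def)
  qed
  \<comment> \<open>The defect of the eigenvalue equation is itself orthogonal to \<open>v\<close>
    and to the earlier eigenvectors, so the variation may be taken along it.\<close>
  define w where "w i = ?M v i - \<mu> * v i" for i
  have w1: "?ip v w = 0"
    unfolding w_def[abs_def] ipr_diff_right ipr_scale_right v1 by (simp add: \<mu>_def)
  have w2: "?ip (u l) w = 0" if l: "l < m" for l
  proof -
    have "?ip (u l) (?M v) = ?ip (?M (u l)) v"
      using mvec_self_adjoint[of n X "u l" v] sym by simp
    also have "\<dots> = ?ip (\<lambda>i. lam l * u l i) v"
      by (rule ipr_cong) (use eig l in auto)
    finally show ?thesis
      unfolding w_def[abs_def] ipr_diff_right ipr_scale_right ipr_scale_left using vu[OF l] by simp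
  qed
  have "?ip w w = ?ip w (?M v) - \<mu> * ?ip w v"
    by (subst (2) w_def[abs_def]) (simp add: ipr_diff_right ipr_scale_right)
  then have "?ip w w = 0" using bil[OF w2 w1] w1 by (simp add: ipr_commute)
  then have "\<forall>i<n. ?M v i = \<mu> * v i"
    using ipr_self_eq_0[of "{..<n}" w] by (auto simp: w_def)
  then show ?thesis using v1 vu by blast
qed

theorem symmetric_eigenbasis:
  assumes sym: "\<And>i j. i < n \<Longrightarrow> j < n \<Longrightarrow> X i j = X j i"
  shows "\<exists>u lam. orthonormal {..<n} n u \<and> (\<forall>a<n. \<forall>i<n. (\<Sum>j<n. X i j * u a j) = lam a * u a i)"
proof -
  have "\<exists>u lam. orthonormal {..<n} m u \<and> (\<forall>a<m. \<forall>i<n. mvec n X (u a) i = lam a * u a i)" if "m \<le> n" for m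
    using that
  proof (induction m)
    case 0
    then show ?case by (simp add: orthonormal_def)
  next
    case (Suc m)
    then obtain u lam where ul: "orthonormal {..<n} m u" "\<forall>a<m. \<forall>i<n. mvec n X (u a) i = lam a * u a i" by auto
    from symmetric_eigenvector[where X = X and lam = lam, OF sym ul(1)] ul(2) Suc.prems
    obtain v \<mu> where v: "ipr {..<n} v v = 1" "\<forall>l<m. ipr {..<n} (u l) v = 0" "\<forall>i<n. mvec n X v i = \<mu> * v i"
      by auto
    have "orthonormal {..<n} (Suc m) (u(m := v))" using v by (intro orthonormal_update ul) auto
    moreover have "\<forall>a<Suc m. \<forall>i<n. mvec n X ((u(m := v)) a) i = (lam(m := \<mu>)) a * (u(m := v)) a i"
      using v ul(2) by (auto simp: less_Suc_eq)
    ultimately show ?case by blast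
  qed
  from this[of n] obtain u lam where "orthonormal {..<n} n u" "\<forall>a<n. \<forall>i<n. mvec n X (u a) i = lam a * u a i"
    by auto
  then show ?thesis by (intro exI[of _ u] exI[of _ lam]) (auto simp: mvec_def)
qed

section \<open>Coordinates on symmetric matrices\<close>

definition upper :: "nat \<Rightarrow> (nat \<times> nat) set" where
  "upper n = {(i, j). i \<le> j \<and> j < n}"

definition diag_idx :: "nat \<Rightarrow> (nat \<times> nat) set" where
  "diag_idx n = (\<lambda>i. (i, i)) ` {..<n}"

definition fip :: "nat \<Rightarrow> (nat \<Rightarrow> nat \<Rightarrow> real) \<Rightarrow> (nat \<Rightarrow> nat \<Rightarrow> real) \<Rightarrow> real" where
  "fip n X Y = (\<Sum>i<n. \<Sum>j<n. X i j * Y i j)"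

definition sym_on :: "nat \<Rightarrow> (nat \<Rightarrow> nat \<Rightarrow> real) \<Rightarrow> bool" where
  "sym_on n X \<longleftrightarrow> (\<forall>i<n. \<forall>j<n. X i j = X j i)"

text \<open>Frobenius-orthonormal coordinates: an off-diagonal entry occurs twice in the matrix,
  whence \<open>sqrt 2\<close>. Its inverse is \<open>symmat\<close>.\<close>

definition coords :: "(nat \<Rightarrow> nat \<Rightarrow> real) \<Rightarrow> nat \<times> nat \<Rightarrow> real" where
  "coords X p = (if fst p = snd p then 1 else sqrt 2) * X (fst p) (snd p)"

definition symmat :: "(nat \<times> nat \<Rightarrow> real) \<Rightarrow> nat \<Rightarrow> nat \<Rightarrow> real" where
  "symmat z = symx (\<lambda>i. z (i, i)) z"

lemma upper_Un: "upper n = diag_idx n \<union> strict_upper n" and diag_idx_strict_upper: "diag_idx n \<inter> strict_upper n = {}"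
  by (auto simp: upper_def diag_idx_def strict_upper_def)

lemma finite_diag_idx [simp]: "finite (diag_idx n)" and finite_upper [simp]: "finite (upper n)"
  by (auto simp: upper_Un diag_idx_def)

lemma sum_diag_idx: "(\<Sum>p\<in>diag_idx n. f p) = (\<Sum>i<n. f (i, i))"
  unfolding diag_idx_def by (subst sum.reindex) (auto simp: inj_on_def)

lemma prod_diag_idx: "(\<Prod>p\<in>diag_idx n. f p) = (\<Prod>i<n. f (i, i))"
  unfolding diag_idx_def by (subst prod.reindex) (auto simp: inj_on_def)

lemma card_upper: "real (card (upper n)) = real n * (real n + 1) / 2"
proof -
  have e: "upper n = (\<lambda>(j, i). (i, j)) ` (SIGMA j:{..<n}. {..j})" by (auto simp: upper_def image_iff)
  have "card (upper n) = card (SIGMA j:{..<n}. {..j})"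
    unfolding e by (rule card_image) (auto simp: inj_on_def)
  also have "\<dots> = (\<Sum>j<n. Suc j)" by simp
  finally have "real (card (upper n)) = (\<Sum>j<n. real j + 1)" by (simp add: add.commute)
  also have "\<dots> = real n * (real n + 1) / 2" by (induction n) (auto simp: field_simps)
  finally show ?thesis .
qed

lemma fip_commute: "fip n X Y = fip n Y X"
  by (simp add: fip_def mult.commute)

lemma fip_add_left: "fip n (\<lambda>i j. X i j + Y i j) Z = fip n X Z + fip n Y Z"
  and fip_diff_left: "fip n (\<lambda>i j. X i j - Y i j) Z = fip n X Z - fip n Y Z"
  and fip_scale_left: "fip n (\<lambda>i j. c * X i j) Z = c * fip n X Z"
  by (simp_all add: fip_def distrib_right left_diff_distrib sum.distrib sum_subtractf sum_distrib_left mult.assoc)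

lemmas fip_lin = fip_add_left fip_diff_left fip_scale_left

lemma fip_scale_right: "fip n Y (\<lambda>i j. c * X i j) = c * fip n Y X"
  by (simp add: fip_commute[of n Y] fip_scale_left)

lemma fip_cong: "(\<And>i j. i < n \<Longrightarrow> j < n \<Longrightarrow> X i j = X' i j) \<Longrightarrow> (\<And>i j. i < n \<Longrightarrow> j < n \<Longrightarrow> Y i j = Y' i j) \<Longrightarrow> fip n X Y = fip n X' Y'"
  by (simp add: fip_def)

lemma fip_coords:
  assumes "sym_on n X" "sym_on n Y"
  shows "fip n X Y = ipr (upper n) (coords X) (coords Y)"
proof -
  let ?f = "\<lambda>p. X (fst p) (snd p) * Y (fst p) (snd p)"
  have swap: "strict_upper n \<inter> prod.swap ` strict_upper n = {}" "diag_idx n \<inter> (strict_upper n \<union> prod.swap ` strict_upper n) = {}"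
    by (auto simp: strict_upper_def diag_idx_def)
  have un: "{..<n} \<times> {..<n} = diag_idx n \<union> (strict_upper n \<union> prod.swap ` strict_upper n)"
    by (auto simp: diag_idx_def strict_upper_def image_iff)
  have "fip n X Y = (\<Sum>p\<in>{..<n} \<times> {..<n}. ?f p)"
    unfolding fip_def by (simp add: sum.cartesian_product case_prod_beta)
  also have "\<dots> = (\<Sum>p\<in>diag_idx n. ?f p) + ((\<Sum>p\<in>strict_upper n. ?f p) + (\<Sum>p\<in>prod.swap ` strict_upper n. ?f p))"
    unfolding un using swap by (subst sum.union_disjoint; simp)+
  also have "(\<Sum>p\<in>prod.swap ` strict_upper n. ?f p) = (\<Sum>p\<in>strict_upper n. ?f p)"
    using assms by (subst sum.reindex) (auto simp: sym_on_def strict_upper_def intro!: sum.cong)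
  also have "(\<Sum>p\<in>diag_idx n. ?f p) + ((\<Sum>p\<in>strict_upper n. ?f p) + (\<Sum>p\<in>strict_upper n. ?f p))
     = (\<Sum>p\<in>diag_idx n. coords X p * coords Y p) + (\<Sum>p\<in>strict_upper n. coords X p * coords Y p)"
  proof -
    have "(\<Sum>p\<in>diag_idx n. ?f p) = (\<Sum>p\<in>diag_idx n. coords X p * coords Y p)"
      by (intro sum.cong) (auto simp: coords_def diag_idx_def)
    moreover have "(\<Sum>p\<in>strict_upper n. coords X p * coords Y p) = (\<Sum>p\<in>strict_upper n. 2 * ?f p)"
      by (intro sum.cong) (auto simp: coords_def strict_upper_def)
    ultimately show ?thesis by (simp add: sum_distrib_left[symmetric])
  qed
  also have "\<dots> = ipr (upper n) (coords X) (coords Y)"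
    unfolding ipr_def upper_Un using diag_idx_strict_upper by (subst sum.union_disjoint) auto
  finally show ?thesis .
qed

lemma sym_on_symmat [simp]: "sym_on n (symmat z)"
  by (simp add: sym_on_def symmat_def symx_sym)

lemma symmat_coords:
  assumes "sym_on n X" "i < n" "j < n"
  shows "symmat (coords X) i j = X i j"
  using assms by (cases "i < j") (auto simp: symmat_def symx_def coords_def sym_on_def min_def max_def)

lemma coords_symmat: "p \<in> upper n \<Longrightarrow> coords (symmat z) p = z p"
  by (cases p) (auto simp: symmat_def symx_def coords_def upper_def min_def max_def)

lemma symmat_cong: "(\<And>p. p \<in> upper n \<Longrightarrow> z p = z' p) \<Longrightarrow> i < n \<Longrightarrow> j < n \<Longrightarrow> symmat z i j = symmat z' i j"
  by (cases "i < j") (auto simp: symmat_def symx_def upper_def min_def max_def)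

lemma symmat_sum: "symmat (\<lambda>p. \<Sum>l\<in>A. x l * b l p) i j = (\<Sum>l\<in>A. x l * symmat (b l) i j)"
  by (simp add: symmat_def symx_def sum_divide_distrib)

lemma fip_symmat: "fip n (symmat y) (symmat z) = ipr (upper n) y z"
  by (subst fip_coords) (auto intro!: ipr_cong simp: coords_symmat)

text \<open>Serves both as the coordinate vector \<open>delta p\<close> and, as a function of two
  indices, as the identity matrix.\<close>

definition delta :: "'a \<Rightarrow> 'a \<Rightarrow> real" where "delta p q = (if p = q then 1 else 0)"

lemma sum_delta: "finite A \<Longrightarrow> p \<in> A \<Longrightarrow> (\<Sum>q\<in>A. f q * delta q p) = f p"
  unfolding delta_def by (simp add: if_distrib[of "\<lambda>t. _ * t"] cong: if_cong)

lemma ipr_delta_delta: "finite A \<Longrightarrow> p \<in> A \<Longrightarrow> ipr A (delta p) (delta q) = delta p q"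
  unfolding ipr_def delta_def by (simp add: if_distrib[of "\<lambda>t. t * _"] cong: if_cong)

text \<open>\<open>U^T Y U\<close> for the matrix \<open>U\<close> with rows \<open>u c\<close>. For
  orthonormal \<open>u\<close> it takes the matrix of a form in the basis \<open>u\<close> to
  standard coordinates, and the transposed family \<open>\<lambda>i a. u a i\<close> takes it
  back.\<close>

definition conj_by :: "nat \<Rightarrow> (nat \<Rightarrow> nat \<Rightarrow> real) \<Rightarrow> (nat \<Rightarrow> nat \<Rightarrow> real) \<Rightarrow> nat \<Rightarrow> nat \<Rightarrow> real" where
  "conj_by n u Y i j = (\<Sum>c<n. \<Sum>d<n. Y c d * (u c i * u d j))"

lemma conj_by_cong: "(\<And>i j. i < n \<Longrightarrow> j < n \<Longrightarrow> Y i j = Y' i j) \<Longrightarrow> conj_by n u Y i j = conj_by n u Y' i j"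
  by (simp add: conj_by_def)

lemma conj_by_sum: "conj_by n u (\<lambda>c d. \<Sum>l\<in>A. x l * b l c d) i j = (\<Sum>l\<in>A. x l * conj_by n u (b l) i j)"
proof -
  have "conj_by n u (\<lambda>c d. \<Sum>l\<in>A. x l * b l c d) i j = (\<Sum>c<n. \<Sum>d<n. \<Sum>l\<in>A. x l * (b l c d * (u c i * u d j)))"
    unfolding conj_by_def by (simp add: sum_distrib_right mult.assoc)
  also have "\<dots> = (\<Sum>c<n. \<Sum>l\<in>A. \<Sum>d<n. x l * (b l c d * (u c i * u d j)))"
    by (intro sum.cong refl sum.swap)
  also have "\<dots> = (\<Sum>l\<in>A. \<Sum>c<n. \<Sum>d<n. x l * (b l c d * (u c i * u d j)))"
    by (rule sum.swap)
  finally show ?thesis unfolding conj_by_def by (simp add: sum_distrib_left)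
qed

lemma sym_on_conj_by: "sym_on n Y \<Longrightarrow> sym_on m (conj_by n u Y)"
  unfolding sym_on_def conj_by_def
  by (intro allI impI, subst sum.swap) (auto intro!: sum.cong simp: mult_ac)

lemma sum_swap_pairs:
  "(\<Sum>i\<in>A. \<Sum>j\<in>B. \<Sum>c\<in>C. \<Sum>d\<in>D. f i j c d) = (\<Sum>c\<in>C. \<Sum>d\<in>D. \<Sum>i\<in>A. \<Sum>j\<in>B. f i j c d)"
proof -
  have "(\<Sum>i\<in>A. \<Sum>j\<in>B. \<Sum>c\<in>C. \<Sum>d\<in>D. f i j c d) = (\<Sum>i\<in>A. \<Sum>c\<in>C. \<Sum>j\<in>B. \<Sum>d\<in>D. f i j c d)"
    by (rule sum.cong[OF refl], rule sum.swap)
  also have "\<dots> = (\<Sum>c\<in>C. \<Sum>i\<in>A. \<Sum>j\<in>B. \<Sum>d\<in>D. f i j c d)" by (rule sum.swap)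
  also have "\<dots> = (\<Sum>c\<in>C. \<Sum>i\<in>A. \<Sum>d\<in>D. \<Sum>j\<in>B. f i j c d)"
    by (rule sum.cong[OF refl], rule sum.cong[OF refl], rule sum.swap)
  also have "\<dots> = (\<Sum>c\<in>C. \<Sum>d\<in>D. \<Sum>i\<in>A. \<Sum>j\<in>B. f i j c d)"
    by (rule sum.cong[OF refl], rule sum.swap)
  finally show ?thesis .
qed

lemma fip_conj_by: "fip n (conj_by n u Y) X = fip n Y (conj_by n (\<lambda>i a. u a i) X)"
proof -
  have "fip n (conj_by n u Y) X = (\<Sum>i<n. \<Sum>j<n. \<Sum>c<n. \<Sum>d<n. Y c d * (u c i * u d j) * X i j)"
    by (simp add: fip_def conj_by_def sum_distrib_right)
  also have "\<dots> = (\<Sum>c<n. \<Sum>d<n. \<Sum>i<n. \<Sum>j<n. Y c d * (u c i * u d j) * X i j)"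
    by (rule sum_swap_pairs)
  also have "\<dots> = fip n Y (conj_by n (\<lambda>i a. u a i) X)"
    by (simp add: fip_def conj_by_def sum_distrib_left mult_ac)
  finally show ?thesis .
qed

lemma conj_by_inverse:
  assumes "orthonormal {..<n} n u" "a < n" "b < n"
  shows "conj_by n (\<lambda>i a. u a i) (conj_by n u Y) a b = Y a b"
proof -
  have "conj_by n (\<lambda>i a. u a i) (conj_by n u Y) a b = (\<Sum>i<n. \<Sum>j<n. \<Sum>c<n. \<Sum>d<n. Y c d * (u c i * u d j) * (u a i * u b j))"
    by (simp add: conj_by_def sum_distrib_right)
  also have "\<dots> = (\<Sum>i<n. \<Sum>j<n. \<Sum>c<n. \<Sum>d<n. Y c d * ((u c i * u a i) * (u d j * u b j)))"
    by (simp add: mult_ac)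
  also have "\<dots> = (\<Sum>c<n. \<Sum>d<n. \<Sum>i<n. \<Sum>j<n. Y c d * ((u c i * u a i) * (u d j * u b j)))"
    by (rule sum_swap_pairs)
  also have "\<dots> = (\<Sum>c<n. \<Sum>d<n. Y c d * (ipr {..<n} (u c) (u a) * ipr {..<n} (u d) (u b)))"
    unfolding ipr_def sum_product by (simp only: sum_distrib_left)
  also have "\<dots> = (\<Sum>c<n. \<Sum>d<n. if d = b then (if c = a then Y c d else 0) else 0)"
    using assms by (intro sum.cong refl) (auto simp: orthonormal_def)
  also have "\<dots> = Y a b" using assms by simp
  finally show ?thesis .
qed

lemma orthonormal_transpose:
  assumes "orthonormal {..<n} n u"
  shows "orthonormal {..<n} n (\<lambda>i a. u a i)"
  using orthonormal_complete[OF _ assms] by (simp add: orthonormal_def ipr_def)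

lemma conj_by_inverse':
  assumes "orthonormal {..<n} n u" "i < n" "j < n"
  shows "conj_by n u (conj_by n (\<lambda>i a. u a i) Y) i j = Y i j"
  using conj_by_inverse[OF orthonormal_transpose[OF assms(1)] assms(2,3)] by simp

text \<open>Orthonormal columns of a square matrix force orthonormal rows: enumerating
  \<open>J\<close> turns the columns into a full orthonormal family, whose completeness relation is
  the claim.\<close>

lemma square_rows:
  assumes J: "finite J" and cols: "\<And>p p'. p \<in> J \<Longrightarrow> p' \<in> J \<Longrightarrow> (\<Sum>q\<in>J. A q p * A q p') = (if p = p' then 1 else 0)"
    and q: "q \<in> J" "q' \<in> J"
  shows "(\<Sum>p\<in>J. A q p * A q' p) = (if q = q' then 1 else (0::real))"
proof -
  from ex_bij_betw_nat_finite[OF J] obtain h where h: "bij_betw h {..<card J} J"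
    by (auto simp: atLeast0LessThan)
  have "orthonormal J (card J) (\<lambda>l q. A q (h l))"
    unfolding orthonormal_def ipr_def
  proof (intro allI impI)
    fix k l assume "k < card J" "l < card J"
    then show "(\<Sum>p\<in>J. A p (h k) * A p (h l)) = (if k = l then 1 else 0)"
      using h by (subst cols) (auto simp: bij_betw_def inj_on_def)
  qed
  from orthonormal_complete[OF J this refl q] show ?thesis
    using sum.reindex_bij_betw[OF h, of "\<lambda>p. A q p * A q' p"] by simp
qed

lemma fip_conj_by_conj_by:
  assumes "orthonormal {..<n} n u"
  shows "fip n (conj_by n u X) (conj_by n u Y) = fip n X Y"
  unfolding fip_conj_by using conj_by_inverse[OF assms] by (intro fip_cong) auto

text \<open>Conjugation preserves the Frobenius inner product, so its matrix in orthonormal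
  coordinates, with the images of the coordinate vectors as columns, is orthogonal.\<close>

lemma nn_integral_conj_by:
  assumes on: "orthonormal {..<n} n u" and f: "f \<in> borel_measurable (lborelP (upper n))"
  shows "(\<integral>\<^sup>+y. f (\<lambda>q\<in>upper n. coords (conj_by n u (symmat y)) q) \<partial>lborelP (upper n)) = (\<integral>\<^sup>+y. f y \<partial>lborelP (upper n))"
proof -
  define A where "A q p = coords (conj_by n u (symmat (delta p))) q" for q p
  have cols: "(\<Sum>q\<in>upper n. A q p * A q p') = (if p = p' then 1 else 0)" if "p \<in> upper n" "p' \<in> upper n" for p p'
  proof -
    have "(\<Sum>q\<in>upper n. A q p * A q p') = fip n (conj_by n u (symmat (delta p))) (conj_by n u (symmat (delta p')))"
      by (subst fip_coords) (auto simp: sym_on_conj_by ipr_def A_def)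
    also have "\<dots> = ipr (upper n) (delta p) (delta p')" by (simp add: fip_conj_by_conj_by[OF on] fip_symmat)
    finally show ?thesis using that by (simp add: ipr_delta_delta) (simp add: delta_def)
  qed
  interpret orthogonal_matrix "upper n" "upper n" A
    by standard (use cols square_rows[of "upper n" A] in auto)
  have "lin_map (upper n) (upper n) A y = (\<lambda>q\<in>upper n. coords (conj_by n u (symmat y)) q)" for y
  proof -
    have "coords (conj_by n u (symmat y)) q = (\<Sum>p\<in>upper n. A q p * y p)" for q
    proof -
      have 1: "symmat y c d = (\<Sum>p\<in>upper n. y p * symmat (delta p) c d)" if "c < n" "d < n" for c d
        unfolding symmat_sum[symmetric] using that
        by (intro symmat_cong[of n]) (auto simp: sum_delta)
      have "conj_by n u (symmat y) i j = (\<Sum>p\<in>upper n. y p * conj_by n u (symmat (delta p)) i j)" for i j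
        unfolding conj_by_sum[symmetric] by (rule conj_by_cong) (rule 1)
      then show ?thesis
        by (simp add: coords_def A_def sum_distrib_left mult_ac)
    qed
    then show ?thesis by (auto simp: lin_map_def fun_eq_iff)
  qed
  then show ?thesis using nn_integral_lin_map[OF f] by simp
qed

section \<open>Semidefiniteness and eigenvalues under conjugation\<close>

lemma quad_fip: "quad n X v = fip n X (\<lambda>i j. v i * v j)"
  by (simp add: quad_def fip_def mult_ac)

lemma psd_conj_by:
  assumes "psd n Y"
  shows "psd n (conj_by n u Y)"
  unfolding psd_def
proof
  fix v
  have "conj_by n (\<lambda>i a. u a i) (\<lambda>i j. v i * v j) = (\<lambda>a b. (\<Sum>i<n. u a i * v i) * (\<Sum>i<n. u b i * v i))"
    by (intro ext) (simp add: conj_by_def sum_product mult_ac)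
  then have "quad n (conj_by n u Y) v = quad n Y (\<lambda>a. \<Sum>i<n. u a i * v i)"
    unfolding quad_fip fip_conj_by by simp
  then show "0 \<le> quad n (conj_by n u Y) v" using assms by (simp add: psd_def)
qed

lemma psd_conj_by_iff:
  assumes "orthonormal {..<n} n u"
  shows "psd n (conj_by n u Y) \<longleftrightarrow> psd n Y"
proof
  assume "psd n (conj_by n u Y)"
  then have "psd n (conj_by n (\<lambda>i a. u a i) (conj_by n u Y))" by (rule psd_conj_by)
  then show "psd n Y" by (subst (asm) psd_cong[where Y = Y]) (use conj_by_inverse[OF assms] in auto)
qed (rule psd_conj_by)

lemma eigen_pairing:
  assumes on: "orthonormal {..<n} n u" and eig: "\<And>a i. a < n \<Longrightarrow> i < n \<Longrightarrow> (\<Sum>j<n. X i j * u a j) = lam a * u a i"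
    and "a < n" "b < n"
  shows "conj_by n (\<lambda>i a. u a i) X a b = lam b * delta a b"
proof -
  have "conj_by n (\<lambda>i a. u a i) X a b = (\<Sum>i<n. u a i * (\<Sum>j<n. X i j * u b j))"
    by (simp add: conj_by_def sum_distrib_left mult_ac)
  also have "\<dots> = (\<Sum>i<n. u a i * (lam b * u b i))" using eig assms(4) by (intro sum.cong refl) auto
  also have "\<dots> = lam b * ipr {..<n} (u a) (u b)" by (simp add: ipr_def sum_distrib_left mult_ac)
  finally show ?thesis using on assms(3,4) by (simp add: orthonormal_def delta_def)
qed

lemma fip_diag: "fip n Y (\<lambda>a b. f b * delta a b) = (\<Sum>a<n. f a * Y a a)"
proof -
  have "fip n Y (\<lambda>a b. f b * delta a b) = (\<Sum>a<n. \<Sum>b<n. if b = a then f a * Y a a else 0)"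
    unfolding fip_def by (intro sum.cong refl) (auto simp: delta_def)
  then show ?thesis by simp
qed

lemma eigen_fip:
  assumes on: "orthonormal {..<n} n u" and eig: "\<And>a i. a < n \<Longrightarrow> i < n \<Longrightarrow> (\<Sum>j<n. X i j * u a j) = lam a * u a i"
  shows "fip n (conj_by n u Y) X = (\<Sum>a<n. lam a * Y a a)"
  unfolding fip_conj_by fip_diag[symmetric] by (intro fip_cong refl eigen_pairing[OF on eig])

lemma fip_delta: "fip n Y delta = (\<Sum>a<n. Y a a)"
  using fip_diag[of n Y "\<lambda>_. 1"] by simp

lemma fip_delta_delta: "fip n delta delta = real n"
  by (simp add: fip_delta) (simp add: delta_def)

lemma delta_eigen: "orthonormal {..<n} n u \<Longrightarrow> i < n \<Longrightarrow> (\<Sum>j<n. delta i j * u a j) = 1 * u a i"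
  using sum_delta[of "{..<n}" i "u a"] by (simp add: delta_def mult.commute eq_commute)

text \<open>In the eigenbasis \<open>X\<close> is diagonal with entries \<open>lam\<close>; pairing
  it with the identity and with itself gives the two sums. The asymptotics use nothing else about
  the spectrum.\<close>

lemma eigen_sums:
  assumes on: "orthonormal {..<n} n u" and eig: "\<And>a i. a < n \<Longrightarrow> i < n \<Longrightarrow> (\<Sum>j<n. X i j * u a j) = lam a * u a i"
  shows "(\<Sum>a<n. lam a) = fip n X delta" "(\<Sum>a<n. (lam a)\<^sup>2) = fip n X X"
proof -
  define Y where "Y = conj_by n (\<lambda>i a. u a i) X"
  have XY: "fip n X G = fip n (conj_by n u Y) G" for G
    unfolding Y_def using conj_by_inverse'[OF on] by (intro fip_cong) auto
  have Yd: "Y a a = lam a" if "a < n" for a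
    unfolding Y_def using eigen_pairing[OF on eig that that] by (simp add: delta_def)
  have "fip n X delta = (\<Sum>a<n. 1 * Y a a)"
    unfolding XY by (rule eigen_fip[OF on]) (rule delta_eigen[OF on])
  then show "(\<Sum>a<n. lam a) = fip n X delta" using Yd by simp
  have "fip n X X = (\<Sum>a<n. lam a * Y a a)"
    by (subst XY) (rule eigen_fip[OF on eig])
  then show "(\<Sum>a<n. (lam a)\<^sup>2) = fip n X X" using Yd by (simp add: power2_eq_square)
qed

section \<open>Asymptotics of the inversion integral\<close>

text \<open>The principal branch of \<open>1 - \<i> x\<close> to the power \<open>-s\<close>; the
  base has real part 1, so the principal logarithm is smooth along it.\<close>

definition cpow :: "real \<Rightarrow> real \<Rightarrow> complex" where
  "cpow s x = exp (- (of_real s * Ln (1 - \<i> * of_real x)))"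

definition cprod :: "nat \<Rightarrow> (nat \<Rightarrow> real) \<Rightarrow> real \<Rightarrow> complex" where
  "cprod n lam \<theta> = (\<Prod>j<n. cpow ((real n + 1) / 2) (lam j * \<theta>))"

lemma norm_cpow: "cmod (cpow s x) = (1 + x\<^sup>2) powr (- s / 2)"
proof -
  have z: "1 - \<i> * of_real x \<noteq> 0" by (auto simp: complex_eq_iff)
  have "cmod (1 - \<i> * of_real x) = sqrt (1 + x\<^sup>2)" by (simp add: cmod_def)
  then have "ln (cmod (1 - \<i> * of_real x)) = ln (1 + x\<^sup>2) / 2" by (simp add: ln_sqrt add_pos_nonneg)
  moreover have "1 + x\<^sup>2 > 0" by (simp add: add_pos_nonneg)
  ultimately show ?thesis
    unfolding cpow_def norm_exp_eq_Re using z by (simp add: powr_def)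
qed

lemma continuous_cpow: "continuous_on UNIV (\<lambda>x. cpow s (c * x))"
proof -
  have "1 - \<i> * of_real (c * x) \<notin> \<real>\<^sub>\<le>\<^sub>0" for x
    by (simp add: complex_nonpos_Reals_iff)
  then show ?thesis unfolding cpow_def by (intro continuous_intros) auto
qed

lemma borel_measurable_cprod [measurable]: "cprod n lam \<in> borel_measurable borel"
  unfolding cprod_def[abs_def]
  by (intro borel_measurable_continuous_onI continuous_on_prod continuous_cpow)

lemma prod_one_plus_ge_sum:
  fixes a :: "'a \<Rightarrow> real"
  assumes "finite A" "\<And>i. i \<in> A \<Longrightarrow> 0 \<le> a i"
  shows "1 + (\<Sum>i\<in>A. a i) \<le> (\<Prod>i\<in>A. 1 + a i)"
  using assms
proof (induction A rule: finite_induct)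
  case (insert i A)
  have "1 + (\<Sum>j\<in>insert i A. a j) \<le> (1 + a i) * (1 + (\<Sum>j\<in>A. a j))"
    using insert by (simp add: algebra_simps sum_nonneg)
  also have "\<dots> \<le> (1 + a i) * (\<Prod>j\<in>A. 1 + a j)"
    using insert by (intro mult_left_mono) auto
  finally show ?case using insert by simp
qed simp

lemma prod_powr:
  fixes a :: "'a \<Rightarrow> real"
  assumes "\<And>i. i \<in> A \<Longrightarrow> 0 \<le> a i"
  shows "(\<Prod>i\<in>A. a i powr s) = (\<Prod>i\<in>A. a i) powr s"
  using assms by (induction A rule: infinite_finite_induct) (auto simp: powr_mult prod_nonneg)

text \<open>Dropping all cross terms in the product of the \<open>1 + (lam j \<theta>)^2\<close>
  leaves \<open>1 + \<theta>^2\<close>, a bound that does not see how the norm is spread over the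
  eigenvalues.\<close>

lemma norm_cprod_le:
  assumes "(\<Sum>j<n. (lam j)\<^sup>2) = 1"
  shows "cmod (cprod n lam \<theta>) \<le> (1 + \<theta>\<^sup>2) powr (- (real n + 1) / 4)"
proof -
  have "cmod (cprod n lam \<theta>) = (\<Prod>j<n. (1 + (lam j * \<theta>)\<^sup>2) powr (- (real n + 1) / 4))"
  proof -
    have e: "- ((real n + 1) / 2) / 2 = - (real n + 1) / 4" by linarith
    show ?thesis unfolding cprod_def prod_norm[symmetric] norm_cpow e ..
  qed
  also have "\<dots> = (\<Prod>j<n. 1 + (lam j * \<theta>)\<^sup>2) powr (- (real n + 1) / 4)"
    by (rule prod_powr) (simp add: add_nonneg_nonneg)
  also have "\<dots> \<le> (1 + \<theta>\<^sup>2) powr (- (real n + 1) / 4)"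
  proof (rule powr_mono2')
    have "1 + (\<Sum>j<n. (lam j * \<theta>)\<^sup>2) \<le> (\<Prod>j<n. 1 + (lam j * \<theta>)\<^sup>2)"
      by (rule prod_one_plus_ge_sum) auto
    also have "(\<Sum>j<n. (lam j * \<theta>)\<^sup>2) = \<theta>\<^sup>2"
      unfolding power_mult_distrib sum_distrib_right[symmetric] assms by simp
    finally show "1 + \<theta>\<^sup>2 \<le> (\<Prod>j<n. 1 + (lam j * \<theta>)\<^sup>2)" .
  qed (auto simp: add_pos_nonneg)
  finally show ?thesis .
qed

lemma integrable_inverse_one_plus_square: "c \<noteq> 0 \<Longrightarrow> integrable lborel (\<lambda>x::real. inverse (1 + (c * x)\<^sup>2))"
  using integrable_inverse_1_plus_square
    lborel_integrable_real_affine[of "\<lambda>x. inverse (1 + x\<^sup>2)" c 0]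
  by (simp add: set_integrable_def)

lemma integrable_cprod:
  assumes "(\<Sum>j<n. (lam j)\<^sup>2) = 1" "n \<ge> 3"
  shows "integrable lborel (cprod n lam)"
proof (rule Bochner_Integration.integrable_bound)
  show "integrable lborel (\<lambda>x. inverse (1 + (1 * x)\<^sup>2) :: real)"
    by (rule integrable_inverse_one_plus_square) simp
  show "AE x in lborel. norm (cprod n lam x) \<le> norm (inverse (1 + (1 * x)\<^sup>2))"
  proof (rule AE_I2)
    fix x
    have "cmod (cprod n lam x) \<le> (1 + x\<^sup>2) powr (- (real n + 1) / 4)" by (rule norm_cprod_le) fact
    \<comment> \<open>From size 3 on the exponent is at most -1, which makes the bound
      integrable.\<close>
    also have "\<dots> \<le> (1 + x\<^sup>2) powr (- 1)" using assms(2) by (intro powr_mono) auto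
    also have "\<dots> = inverse (1 + x\<^sup>2)" by (simp add: powr_minus add_nonneg_nonneg)
    finally show "norm (cprod n lam x) \<le> norm (inverse (1 + (1 * x)\<^sup>2))"
      by (simp add: abs_of_nonneg add_nonneg_nonneg)
  qed
qed measurable

text \<open>The remainder has derivative \<open>w^2 / (1 + w)\<close>, and the denominator has
  modulus at least 1/2 on the disc of radius \<open>cmod z\<close>; the mean value inequality gives
  the cubic bound.\<close>

lemma Ln_second_order:
  fixes z :: complex
  assumes "cmod z \<le> 1 / 2"
  shows "cmod (Ln (1 + z) - z + z\<^sup>2 / 2) \<le> 2 * cmod z ^ 3"
proof -
  let ?h = "\<lambda>z. Ln (1 + z) - z + z\<^sup>2 / 2 :: complex"
  have "cmod (?h z - ?h 0) \<le> (2 * (cmod z)\<^sup>2) * cmod (z - 0)"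
  proof (rule field_differentiable_bound[where S = "cball 0 (cmod z)" and f' = "\<lambda>w. w\<^sup>2 / (1 + w)"])
    fix w :: complex assume "w \<in> cball 0 (cmod z)"
    then have w: "cmod w \<le> cmod z" by simp
    then have "cmod w \<le> 1 / 2" using assms by simp
    then have re: "Re (1 + w) \<ge> 1 / 2" using abs_Re_le_cmod[of w] by simp
    then have nz: "1 + w \<noteq> 0" and np: "1 + w \<notin> \<real>\<^sub>\<le>\<^sub>0"
      by (auto simp: complex_nonpos_Reals_iff complex_eq_iff)
    have "(?h has_field_derivative (1 / (1 + w) - 1 + w)) (at w)"
      using np by (auto intro!: derivative_eq_intros simp: inverse_eq_divide)
    moreover have "1 / (1 + w) - 1 + w = w\<^sup>2 / (1 + w)"
      using nz by (simp add: field_simps power2_eq_square)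
    ultimately show "(?h has_field_derivative w\<^sup>2 / (1 + w)) (at w within cball 0 (cmod z))"
      by (simp add: has_field_derivative_at_within)
    have "1 / 2 \<le> cmod (1 + w)" using re complex_Re_le_cmod order_trans by blast
    then have "cmod w ^ 2 / cmod (1 + w) \<le> cmod w ^ 2 / (1 / 2)"
      by (intro divide_left_mono) (auto intro: mult_pos_pos)
    also have "\<dots> \<le> 2 * (cmod z)\<^sup>2" using w by (simp add: power_mono)
    finally show "cmod (w\<^sup>2 / (1 + w)) \<le> 2 * (cmod z)\<^sup>2" by (simp add: norm_divide norm_power)
  qed auto
  then show ?thesis by (simp add: power3_eq_cube power2_eq_square)
qed

text \<open>Expanding each logarithm to second order, trace zero removes the linear terms, and unit
  norm makes the quadratic ones add up to exactly \<open>u^2 / 4\<close>. In the cubic remainder one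
  factor is at most \<open>\<bar>u\<bar> / sqrt (n + 1)\<close>, since every eigenvalue has modulus
  at most 1, and the other two sum to \<open>u^2 / (n + 1)\<close>. Working with an exponent
  \<open>w\<close> avoids any choice of branch for the logarithm of the product.\<close>

lemma cprod_exponent:
  assumes s0: "(\<Sum>j<n. lam j) = 0" and s2: "(\<Sum>j<n. (lam j)\<^sup>2) = 1"
    and u: "\<bar>u\<bar> / sqrt (real n + 1) \<le> 1 / 2"
  shows "\<exists>w. cprod n lam (u / sqrt (real n + 1)) = exp w \<and> cmod (w + of_real (u\<^sup>2 / 4)) \<le> \<bar>u\<bar> ^ 3 / sqrt (real n + 1)"
proof -
  let ?m = "real n + 1"
  define x where "x j = lam j * (u / sqrt ?m)" for j
  let ?E = "\<lambda>j. Ln (1 - \<i> * of_real (x j)) + \<i> * of_real (x j) - of_real ((x j)\<^sup>2) / 2"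
  define w where "w = (\<Sum>j<n. - (of_real (?m / 2) * Ln (1 - \<i> * of_real (x j))))"
  have sx: "(\<Sum>j<n. x j) = 0" unfolding x_def sum_distrib_right[symmetric] s0 by simp
  have sxx: "(\<Sum>j<n. (x j)\<^sup>2) = u\<^sup>2 / ?m"
    unfolding x_def power_mult_distrib sum_distrib_right[symmetric] s2 by (simp add: power_divide)
  have lam1: "\<bar>lam j\<bar> \<le> 1" if "j < n" for j
  proof -
    have "(lam j)\<^sup>2 \<le> (\<Sum>j<n. (lam j)\<^sup>2)" using that by (intro member_le_sum) auto
    then show ?thesis using s2 by (simp add: abs_square_le_1)
  qed
  have xb: "\<bar>x j\<bar> \<le> \<bar>u\<bar> / sqrt ?m" if "j < n" for j
    unfolding x_def abs_mult using mult_right_mono[OF lam1[OF that], of "\<bar>u / sqrt ?m\<bar>"] by simp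
  have E: "cmod (?E j) \<le> 2 * (\<bar>u\<bar> / sqrt ?m) * (x j)\<^sup>2" if "j < n" for j
  proof -
    have "cmod (Ln (1 + (- \<i> * of_real (x j))) - (- \<i> * of_real (x j)) + (- \<i> * of_real (x j))\<^sup>2 / 2)
       \<le> 2 * cmod (- \<i> * of_real (x j)) ^ 3"
      using order.trans[OF xb[OF that] u] by (intro Ln_second_order) (simp add: norm_mult)
    then have "cmod (?E j) \<le> 2 * \<bar>x j\<bar> ^ 3" by (simp add: norm_mult power_mult_distrib)
    also have "\<dots> = 2 * \<bar>x j\<bar> * (x j)\<^sup>2" by (simp add: power3_eq_cube power2_eq_square)
    also have "\<dots> \<le> 2 * (\<bar>u\<bar> / sqrt ?m) * (x j)\<^sup>2" using xb[OF that] by (intro mult_right_mono) auto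
    finally show ?thesis .
  qed
  have "w + of_real (u\<^sup>2 / 4) = - of_real (?m / 2) * (\<Sum>j<n. ?E j)"
  proof -
    have "(\<Sum>j<n. ?E j) = (\<Sum>j<n. Ln (1 - \<i> * of_real (x j))) + \<i> * of_real (\<Sum>j<n. x j) - of_real (\<Sum>j<n. (x j)\<^sup>2) / 2"
      by (simp add: sum.distrib sum_subtractf sum_distrib_left sum_divide_distrib)
    also have "\<dots> = (\<Sum>j<n. Ln (1 - \<i> * of_real (x j))) - of_real (u\<^sup>2 / ?m / 2)"
      unfolding sx sxx by simp
    finally have *: "(\<Sum>j<n. ?E j) = (\<Sum>j<n. Ln (1 - \<i> * of_real (x j))) - of_real (u\<^sup>2 / ?m / 2)" .
    have "complex_of_real (u\<^sup>2 / 4) = of_real (?m / 2) * of_real (u\<^sup>2 / ?m / 2)"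
      unfolding of_real_mult[symmetric] by (rule arg_cong[where f = of_real]) (simp add: field_simps)
    then show ?thesis unfolding * w_def sum_negf sum_distrib_left[symmetric] by (simp add: algebra_simps)
  qed
  then have "cmod (w + of_real (u\<^sup>2 / 4)) = ?m / 2 * cmod (\<Sum>j<n. ?E j)"
    by (simp only: norm_mult norm_minus_cancel norm_of_real) simp
  also have "\<dots> \<le> ?m / 2 * (\<Sum>j<n. 2 * (\<bar>u\<bar> / sqrt ?m) * (x j)\<^sup>2)"
    by (intro mult_left_mono order.trans[OF norm_sum] sum_mono E) auto
  also have "\<dots> = \<bar>u\<bar> ^ 3 / sqrt ?m"
  proof -
    have "?m / 2 * (2 * (\<bar>u\<bar> / sqrt ?m) * (u\<^sup>2 / ?m)) = \<bar>u\<bar> * u\<^sup>2 / sqrt ?m" by simp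
    also have "\<bar>u\<bar> * u\<^sup>2 = \<bar>u\<bar> ^ 3" by (simp add: power3_eq_cube power2_eq_square)
    finally show ?thesis unfolding sum_distrib_left[symmetric] sxx .
  qed
  finally show ?thesis
    by (intro exI[of _ w]) (simp add: cprod_def cpow_def w_def x_def exp_sum add_ac)
qed

text \<open>A majorant independent of \<open>n\<close>, by Bernoulli's inequality. That needs a
  natural exponent, so \<open>(n + 1) / 4\<close> is rounded down to \<open>?k\<close>; for
  \<open>n \<ge> 3\<close> one still has \<open>n + 1 \<le> 16 * ?k\<close>, which is where the 4 in
  \<open>u / 4\<close> comes from.\<close>

lemma cprod_scaled_bound:
  assumes "(\<Sum>j<n. (lam j)\<^sup>2) = 1" "n \<ge> 3"
  shows "cmod (cprod n lam (u / sqrt (real n + 1))) \<le> inverse (1 + (u / 4)\<^sup>2)"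
proof -
  let ?m = "Suc n" and ?k = "Suc n div 4"
  let ?x = "u\<^sup>2 / real ?m"
  have x: "?x \<ge> 0" by simp
  have "1 + (u / 4)\<^sup>2 \<le> 1 + real ?k * ?x"
  proof -
    have "?m \<le> 16 * ?k" using assms(2) by linarith
    then have "real ?m \<le> 16 * real ?k" by linarith
    then have "u\<^sup>2 * real ?m \<le> u\<^sup>2 * (16 * real ?k)" by (intro mult_left_mono) auto
    then show ?thesis by (simp add: power_divide field_simps)
  qed
  also have "\<dots> \<le> (1 + ?x) ^ ?k" using x by (intro Bernoulli_inequality) linarith
  also have "\<dots> = (1 + ?x) powr real ?k" using x by (subst powr_realpow) (auto intro: add_pos_nonneg)
  also have "\<dots> \<le> (1 + ?x) powr (real ?m / 4)"
  proof (rule powr_mono)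
    have "4 * ?k \<le> ?m" by simp
    then have "real (4 * ?k) \<le> real ?m" by (rule of_nat_mono)
    then show "real ?k \<le> real ?m / 4" by simp
    show "1 \<le> 1 + ?x" using x by linarith
  qed
  finally have le: "1 + (u / 4)\<^sup>2 \<le> (1 + ?x) powr (real ?m / 4)" .
  have "cmod (cprod n lam (u / sqrt (real n + 1))) \<le> (1 + (u / sqrt (real n + 1))\<^sup>2) powr (- (real n + 1) / 4)"
    by (rule norm_cprod_le) fact
  also have "\<dots> = inverse ((1 + ?x) powr (real ?m / 4))"
  proof -
    have "1 + (u / sqrt (real n + 1))\<^sup>2 = 1 + ?x" by (simp add: power_divide add.commute)
    moreover have "- (real n + 1) / 4 = - (real ?m / 4)"
      by (simp only: of_nat_Suc minus_divide_left add.commute)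
    ultimately show ?thesis by (simp only: powr_minus)
  qed
  also have "\<dots> \<le> inverse (1 + (u / 4)\<^sup>2)"
    using le by (intro le_imp_inverse_le) (auto simp: add_pos_nonneg)
  finally show ?thesis .
qed

lemma gauss_integral_quarter: "(\<integral>u. exp (- (u::real)\<^sup>2 / 4) \<partial>lborel) = 2 * sqrt pi"
proof -
  have g: "has_bochner_integral lborel (\<lambda>x::real. exp (- x\<^sup>2)) (sqrt pi)"
    using has_bochner_integral_even_function[OF gaussian_moment_0] by simp
  have "(\<integral>u. exp (- (u::real)\<^sup>2 / 4) \<partial>lborel) = 2 * (\<integral>u. exp (- (2 * (u::real))\<^sup>2 / 4) \<partial>lborel)"
    using lborel_integral_real_affine[of 2 "\<lambda>u::real. exp (- u\<^sup>2 / 4)" 0] by simp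
  also have "\<dots> = 2 * sqrt pi" using has_bochner_integral_integral_eq[OF g] by (simp add: power_mult_distrib)
  finally show ?thesis .
qed

text \<open>Stated for arbitrary sequences of spectra, so that uniformity in the matrix follows
  later by contradiction. After rescaling it is dominated convergence to a Gaussian.\<close>

theorem cprod_integral_tendsto:
  assumes N: "filterlim N at_top sequentially"
    and s0: "\<And>k. (\<Sum>j<N k. lam k j) = 0" and s2: "\<And>k. (\<Sum>j<N k. (lam k j)\<^sup>2) = 1"
    and N3: "\<And>k. N k \<ge> 3"
  shows "(\<lambda>k. of_real (sqrt (real (N k) + 1)) * (\<integral>\<theta>. cprod (N k) (lam k) \<theta> \<partial>lborel)) \<longlonglongrightarrow> of_real (2 * sqrt pi)"
proof -
  define r where "r k = sqrt (real (N k) + 1)" for k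
  have r: "r k > 0" for k by (simp add: r_def)
  have rlim: "filterlim r at_top sequentially"
  proof -
    have "filterlim (\<lambda>n::nat. sqrt (real n + 1)) at_top at_top" by real_asymp
    from filterlim_compose[OF this N] show ?thesis unfolding r_def .
  qed
  have eq: "(\<integral>u. cprod (N k) (lam k) (u / r k) \<partial>lborel) = of_real (r k) * (\<integral>\<theta>. cprod (N k) (lam k) \<theta> \<partial>lborel)" for k
    using lborel_integral_real_affine[of "1 / r k" "cprod (N k) (lam k)" 0] r[of k]
    by (simp add: scaleR_conv_of_real field_simps)
  have "(\<lambda>k. \<integral>u. cprod (N k) (lam k) (u / r k) \<partial>lborel) \<longlonglongrightarrow> (\<integral>u. complex_of_real (exp (- u\<^sup>2 / 4)) \<partial>lborel)"
  proof (rule integral_dominated_convergence)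
    show "integrable lborel (\<lambda>u. inverse (1 + (1 / 4 * u)\<^sup>2) :: real)"
      by (rule integrable_inverse_one_plus_square) simp
    show "AE u in lborel. cmod (cprod (N k) (lam k) (u / r k)) \<le> inverse (1 + (1 / 4 * u)\<^sup>2)" for k
      unfolding r_def using cprod_scaled_bound[OF s2 N3, of k] by simp
    show "AE u in lborel. (\<lambda>k. cprod (N k) (lam k) (u / r k)) \<longlonglongrightarrow> complex_of_real (exp (- u\<^sup>2 / 4))"
    proof (rule AE_I2)
      fix u :: real
      have lim0: "(\<lambda>k. c / r k) \<longlonglongrightarrow> 0" for c
        by (rule real_tendsto_divide_at_top[OF tendsto_const rlim])
      have "eventually (\<lambda>k. \<bar>u\<bar> / r k < 1 / 2) sequentially"
        using lim0 by (rule order_tendstoD) simp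
      then have ev: "eventually (\<lambda>k. \<bar>u\<bar> / r k \<le> 1 / 2) sequentially" by (rule eventually_mono) simp
      \<comment> \<open>An exponent is available only once
        \<open>\<bar>u\<bar> / r k \<le> 1 / 2\<close>; the finitely many earlier values of
        \<open>w\<close> are arbitrary.\<close>
      define w where "w k = (SOME w. cprod (N k) (lam k) (u / r k) = exp w \<and> cmod (w + of_real (u\<^sup>2 / 4)) \<le> \<bar>u\<bar> ^ 3 / r k)" for k
      have w: "cprod (N k) (lam k) (u / r k) = exp (w k) \<and> cmod (w k + of_real (u\<^sup>2 / 4)) \<le> \<bar>u\<bar> ^ 3 / r k"
        if "\<bar>u\<bar> / r k \<le> 1 / 2" for k
        unfolding w_def by (rule someI_ex) (use cprod_exponent[OF s0 s2, of u k] that in \<open>simp add: r_def\<close>)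
      have "(\<lambda>k. w k + of_real (u\<^sup>2 / 4)) \<longlonglongrightarrow> 0"
        by (rule Lim_null_comparison[OF _ lim0[of "\<bar>u\<bar> ^ 3"]]) (use ev w in \<open>auto elim: eventually_mono\<close>)
      then have "(\<lambda>k. (w k + of_real (u\<^sup>2 / 4)) - of_real (u\<^sup>2 / 4)) \<longlonglongrightarrow> 0 - of_real (u\<^sup>2 / 4)"
        by (intro tendsto_intros)
      then have "(\<lambda>k. exp (w k)) \<longlonglongrightarrow> exp (- of_real (u\<^sup>2 / 4))"
        by (intro tendsto_exp) simp
      moreover have "eventually (\<lambda>k. exp (w k) = cprod (N k) (lam k) (u / r k)) sequentially"
        using ev by (rule eventually_mono) (use w in auto)
      ultimately have "(\<lambda>k. cprod (N k) (lam k) (u / r k)) \<longlonglongrightarrow> exp (- of_real (u\<^sup>2 / 4))"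
        using tendsto_cong by fast
      then show "(\<lambda>k. cprod (N k) (lam k) (u / r k)) \<longlonglongrightarrow> complex_of_real (exp (- u\<^sup>2 / 4))"
        by (simp add: exp_of_real[symmetric])
    qed
  qed measurable
  moreover have "(\<integral>u. complex_of_real (exp (- u\<^sup>2 / 4)) \<partial>lborel) = of_real (2 * sqrt pi)"
    using gauss_integral_quarter by (simp add: integral_complex_of_real)
  ultimately show ?thesis unfolding eq unfolding r_def by simp
qed

section \<open>Stirling's formula\<close>

text \<open>Wallis's product with its partial products in factorials, so that the ratios of
  Stirling's formula can be inserted.\<close>

lemma wallis_factorial: "(\<lambda>n. fact n ^ 4 * 2 ^ (4 * n) / ((fact (2 * n))\<^sup>2 * (2 * real n + 1))) \<longlonglongrightarrow> pi / 2"
proof -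
  have "(\<Prod>k=1..n. (4 * real k ^ 2) / (4 * real k ^ 2 - 1)) = fact n ^ 4 * 2 ^ (4 * n) / ((fact (2 * n))\<^sup>2 * (2 * real n + 1))" for n
  proof (induction n)
    case (Suc n)
    have f: "fact (2 * Suc n) = (2 * real n + 2) * ((2 * real n + 1) * fact (2 * n))"
      by (simp add: algebra_simps)
    have g: "4 * real (Suc n) ^ 2 - 1 = (2 * real n + 1) * (2 * real n + 3)"
      by (simp add: power2_eq_square algebra_simps)
    have pos: "2 * real n + 1 \<noteq> 0" "2 * real n + 3 \<noteq> 0" "(fact (2 * n) :: real) \<noteq> 0" "real n + 1 \<noteq> 0" by auto
    have "(\<Prod>k=1..Suc n. (4 * real k ^ 2) / (4 * real k ^ 2 - 1)) =
      (fact n ^ 4 * 2 ^ (4 * n) / ((fact (2 * n))\<^sup>2 * (2 * real n + 1))) * ((4 * real (Suc n) ^ 2) / ((2 * real n + 1) * (2 * real n + 3)))"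
      using Suc g by simp
    also have "\<dots> = fact (Suc n) ^ 4 * 2 ^ (4 * Suc n) / ((fact (2 * Suc n))\<^sup>2 * (2 * real (Suc n) + 1))"
    proof -
      have "2 * real n + 2 = 2 * (real n + 1)" "2 * real (Suc n) + 1 = 2 * real n + 3" "real (Suc n) = real n + 1"
        "fact (Suc n) = (real n + 1) * fact n" "(2::real) ^ (4 * Suc n) = 16 * 2 ^ (4 * n)"
        by (auto simp: algebra_simps power_add)
      note e = this
      show ?thesis unfolding f unfolding e
        using pos by (simp add: divide_simps power_mult_distrib) (simp add: power2_eq_square power4_eq_xxxx algebra_simps)
    qed
    finally show ?case .
  qed simp
  then show ?thesis using wallis by simp
qed

lemma summable_stirling_diff:
  "summable (\<lambda>n. (real (Suc n) + 1 / 2) * ln (1 + 1 / real (Suc n)) - 1)"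
proof (rule summable_comparison_test_bigo)
  show "summable (\<lambda>n. norm (1 / real (Suc n) ^ 2))"
    using inverse_power_summable[of 2] by (subst summable_Suc_iff) (simp add: inverse_eq_divide)
  show "(\<lambda>n. (real (Suc n) + 1 / 2) * ln (1 + 1 / real (Suc n)) - 1) \<in> O(\<lambda>n. 1 / real (Suc n) ^ 2)"
    by real_asymp
qed

text \<open>The logarithms of the ratios \<open>a n\<close> have increments of order
  \<open>1 / n^2\<close>, so the ratios converge to a positive limit; Wallis's product identifies
  it.\<close>

theorem stirling: "(\<lambda>n. fact n / (sqrt (2 * pi * real n) * (real n / exp 1) ^ n)) \<longlonglongrightarrow> 1"
proof -
  define a where "a n = fact n * exp (real n) / (sqrt (real n) * real n ^ n)" for n
  \<comment> \<open>The index is shifted because \<open>a 0\<close> is 0 by the convention for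
    division by zero.\<close>
  define d where "d n = ln (a (Suc n))" for n
  have apos: "a (Suc n) > 0" for n by (simp add: a_def)
  have diff: "d n - d (Suc n) = (real (Suc n) + 1 / 2) * ln (1 + 1 / real (Suc n)) - 1" for n
  proof -
    have l: "d n = ln (fact (Suc n)) + real (Suc n) - (ln (real (Suc n)) / 2 + real (Suc n) * ln (real (Suc n)))" for n
      unfolding d_def a_def
      by (simp add: ln_div ln_mult ln_sqrt ln_realpow del: fact_Suc of_nat_Suc power_Suc)
    have f: "ln (fact (Suc (Suc n)) :: real) = ln (real (Suc (Suc n))) + ln (fact (Suc n))"
      by (subst fact_Suc) (simp add: ln_mult del: fact_Suc of_nat_Suc)
    have q: "ln (1 + 1 / real (Suc n)) = ln (real (Suc (Suc n))) - ln (real (Suc n))"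
    proof -
      have "1 + 1 / real (Suc n) = real (Suc (Suc n)) / real (Suc n)" by (simp add: field_simps)
      then show ?thesis by (simp add: ln_div del: of_nat_Suc)
    qed
    show ?thesis unfolding l f q by (simp add: algebra_simps)
  qed
  have "convergent d"
  proof -
    have "summable (\<lambda>n. d n - d (Suc n))" unfolding diff by (rule summable_stirling_diff)
    then have "convergent (\<lambda>n. \<Sum>k<n. d k - d (Suc k))" by (simp add: summable_iff_convergent)
    moreover have "(\<Sum>k<n. d k - d (Suc k)) = d 0 - d n" for n by (induction n) auto
    ultimately have "convergent (\<lambda>n. d 0 - d n)" by simp
    then obtain L where "(\<lambda>n. d 0 - d n) \<longlonglongrightarrow> L" by (auto simp: convergent_def)
    then have "(\<lambda>n. d 0 - (d 0 - d n)) \<longlonglongrightarrow> d 0 - L" by (intro tendsto_intros)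
    then show ?thesis by (simp add: convergentI)
  qed
  then obtain c where "d \<longlonglongrightarrow> c" by (auto simp: convergent_def)
  then have "(\<lambda>n. exp (d n)) \<longlonglongrightarrow> exp c" by (rule tendsto_exp)
  then have "(\<lambda>n. a (Suc n)) \<longlonglongrightarrow> exp c" using apos by (simp add: d_def)
  then have lim: "a \<longlonglongrightarrow> exp c" by (rule LIMSEQ_imp_Suc)
  have lim2: "(\<lambda>n. a (2 * n)) \<longlonglongrightarrow> exp c"
    using filterlim_compose[OF lim, of "\<lambda>n. 2 * n"] mult_nat_left_at_top[of 2] by simp
  \<comment> \<open>In this combination all exponentials and powers of \<open>n\<close> cancel up to
    the factors of Wallis's product, while two powers of the unknown limit survive.\<close>
  have "(\<lambda>n. a n ^ 4 / (a (2 * n))\<^sup>2) \<longlonglongrightarrow> exp c ^ 4 / (exp c)\<^sup>2"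
    by (intro tendsto_intros lim lim2) simp
  moreover have "(\<lambda>n. a n ^ 4 / (a (2 * n))\<^sup>2) \<longlonglongrightarrow> 2 * pi"
  proof -
    have "(\<lambda>n. (fact n ^ 4 * 2 ^ (4 * n) / ((fact (2 * n))\<^sup>2 * (2 * real n + 1))) * (2 * (2 * real n + 1) / real n)) \<longlonglongrightarrow> pi / 2 * 4"
      by (intro tendsto_mult wallis_factorial) real_asymp
    moreover have "eventually (\<lambda>n. (fact n ^ 4 * 2 ^ (4 * n) / ((fact (2 * n))\<^sup>2 * (2 * real n + 1))) * (2 * (2 * real n + 1) / real n)
      = a n ^ 4 / (a (2 * n))\<^sup>2) sequentially"
      using eventually_gt_at_top[of 0]
    proof eventually_elim
      case (elim n)
      define E P where "E = exp (real n)" and "P = real n ^ n"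
      have e2: "exp (real (2 * n)) = E * E" 
      proof -
        have "real (2 * n) = real n + real n" by simp
        then show ?thesis unfolding E_def by (simp only: exp_add)
      qed
      have p2: "real (2 * n) ^ (2 * n) = 2 ^ (2 * n) * (P * P)"
      proof -
        have "real n ^ (2 * n) = P * P" unfolding P_def mult_2 by (rule power_add)
        then show ?thesis by (simp only: of_nat_mult of_nat_numeral power_mult_distrib)
      qed
      have s: "sqrt (real n) ^ 4 = real n * real n" "sqrt (real (2 * n)) ^ 2 = 2 * real n"
        by (simp_all add: power4_eq_xxxx power2_eq_square)
      have t: "(2::real) ^ (4 * n) = 2 ^ (2 * n) * 2 ^ (2 * n)"
      proof -
        have "4 * n = 2 * n + 2 * n" by simp
        then show ?thesis by (simp only: power_add)
      qed
      have nz: "E \<noteq> 0" "P \<noteq> 0" "real n \<noteq> 0" "(fact (2 * n) :: real) \<noteq> 0" "2 * real n + 1 \<noteq> 0" "(2::real) ^ (2 * n) \<noteq> 0"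
        using elim by (auto simp: E_def P_def)
      have "a n ^ 4 = fact n ^ 4 * E ^ 4 / (real n * real n * P ^ 4)"
        unfolding a_def E_def[symmetric] P_def[symmetric] by (simp add: power_divide power_mult_distrib s)
      moreover have "(a (2 * n))\<^sup>2 = (fact (2 * n))\<^sup>2 * (E * E)\<^sup>2 / (2 * real n * (2 ^ (2 * n) * (P * P))\<^sup>2)"
        unfolding a_def e2 p2 power_divide power_mult_distrib s by simp
      ultimately show ?case unfolding t using nz
        by (simp only:) (simp add: divide_simps power2_eq_square power4_eq_xxxx)
    qed
    ultimately show ?thesis by (auto dest: Lim_transform_eventually)
  qed
  ultimately have "exp c ^ 4 / (exp c)\<^sup>2 = 2 * pi" by (rule LIMSEQ_unique)
  then have "(exp c)\<^sup>2 = 2 * pi" by (simp add: power4_eq_xxxx power2_eq_square)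
  then have ec: "exp c = sqrt (2 * pi)" by (metis exp_ge_zero real_sqrt_unique)
  have "(\<lambda>n. a n / sqrt (2 * pi)) \<longlonglongrightarrow> exp c / sqrt (2 * pi)" by (intro tendsto_intros lim) simp
  moreover have "a n / sqrt (2 * pi) = fact n / (sqrt (2 * pi * real n) * (real n / exp 1) ^ n)" for n
  proof -
    have "(real n / exp 1) ^ n = real n ^ n / exp (real n)"
      using exp_of_nat_mult[of n "1::real"] by (simp add: power_divide)
    moreover have "sqrt (2 * pi * real n) = sqrt (2 * pi) * sqrt (real n)" by (simp add: real_sqrt_mult)
    ultimately show ?thesis by (simp only: a_def) simp
  qed
  ultimately show ?thesis unfolding ec by simp
qed

section \<open>Fourier transform of the Gamma density and Fourier inversion\<close>

lemma gamma_wt_Suc: "x * gamma_wt s x = gamma_wt (s + 1) x"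
proof (cases "0 < x")
  case True
  have "x powr s = x * x powr (s - 1)" using powr_add[of x 1 "s - 1"] True by simp
  then show ?thesis using True by (simp add: gamma_wt_def)
qed (simp add: gamma_wt_def)

lemma has_bochner_integral_gamma_wt: "s > 0 \<Longrightarrow> has_bochner_integral lborel (gamma_wt s) (Gamma s)"
  by (rule has_bochner_integral_nn_integral)
     (auto simp: nn_integral_gamma_wt gamma_wt_nonneg Gamma_real_pos less_imp_le)

definition gchar :: "real \<Rightarrow> real \<Rightarrow> complex" where
  "gchar s \<theta> = (\<integral>x. of_real (gamma_wt s x) * iexp (\<theta> * x) \<partial>lborel)"

lemma integrable_gchar:
  assumes "s > 0"
  shows "integrable lborel (\<lambda>x. of_real (gamma_wt s x) * iexp (\<theta> * x))"
proof (rule Bochner_Integration.integrable_bound)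
  show "integrable lborel (gamma_wt s)" using has_bochner_integral_gamma_wt[OF assms] by (simp add: has_bochner_integral_iff)
  show "AE x in lborel. norm (of_real (gamma_wt s x) * iexp (\<theta> * x)) \<le> norm (gamma_wt s x)"
    by (simp add: norm_mult)
qed measurable

text \<open>Integration by parts: \<open>f\<close> is the derivative of \<open>F\<close>, which
  vanishes at both ends of the half-line because \<open>s > 0\<close>.\<close>

lemma gchar_parts:
  assumes "s > 0"
  shows "(1 - \<i> * of_real \<theta>) * gchar (s + 1) \<theta> = of_real s * gchar s \<theta>"
proof -
  let ?c = "1 - \<i> * of_real \<theta>"
  define F where "F x = of_real (x powr s) * exp (- (?c * of_real x))" for x
  define f where "f x = of_real s * (of_real (gamma_wt s x) * iexp (\<theta> * x)) - ?c * (of_real (gamma_wt (s + 1) x) * iexp (\<theta> * x))" for x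
  have e: "exp (- (?c * of_real x)) = of_real (exp (- x)) * iexp (\<theta> * x)" for x
    by (simp add: exp_of_real[symmetric] exp_add[symmetric] algebra_simps)
  have norm_F: "cmod (F x) = x powr s * exp (- x)" for x
    unfolding F_def e by (simp add: norm_mult)
  have int: "integrable lborel f" unfolding f_def
    using assms by (intro Bochner_Integration.integrable_diff integrable_mult_right integrable_gchar) auto
  have der: "(F has_vector_derivative f x) (at x)" if "0 < x" for x
  proof -
    have "((\<lambda>x. x powr s) has_real_derivative s * x powr (s - 1)) (at x)"
      using that by (auto intro!: derivative_eq_intros)
    then have 1: "((\<lambda>x. complex_of_real (x powr s)) has_vector_derivative of_real (s * x powr (s - 1))) (at x)"
      by (intro has_vector_derivative_of_real) (simp add: has_real_derivative_iff_has_vector_derivative)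
    have 2: "((\<lambda>x. exp (- (?c * of_real x))) has_vector_derivative - ?c * exp (- (?c * of_real x))) (at x)"
    proof -
      have "((\<lambda>z. exp (- (?c * z))) has_field_derivative - ?c * exp (- (?c * of_real x))) (at (of_real x))"
        by (auto intro!: derivative_eq_intros)
      then show ?thesis by (rule has_vector_derivative_real_field)
    qed
    have "(F has_vector_derivative (of_real (x powr s) * (- ?c * exp (- (?c * of_real x))) + of_real (s * x powr (s - 1)) * exp (- (?c * of_real x)))) (at x)"
      unfolding F_def by (rule has_vector_derivative_mult[OF 1 2])
    moreover have "of_real (x powr s) * (- ?c * exp (- (?c * of_real x))) + of_real (s * x powr (s - 1)) * exp (- (?c * of_real x)) = f x"
      unfolding f_def e using that by (simp add: gamma_wt_def algebra_simps)
    ultimately show ?thesis by simp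
  qed
  have "(LBINT x=0..\<infinity>. f x) = 0 - 0"
  proof (rule interval_integral_FTC_integrable)
    show "(F has_vector_derivative f x) (at x)" if "0 < ereal x" for x using der that by simp
    show "isCont f x" if "0 < ereal x" for x
    proof -
      have x: "0 < x" using that by simp
      have "isCont (\<lambda>x. of_real s * (of_real (x powr (s - 1) * exp (- x)) * iexp (\<theta> * x)) -
         ?c * (of_real (x powr (s + 1 - 1) * exp (- x)) * iexp (\<theta> * x))) x"
        using x by (intro continuous_intros) auto
      moreover have "eventually (\<lambda>y. f y = of_real s * (of_real (y powr (s - 1) * exp (- y)) * iexp (\<theta> * y)) -
         ?c * (of_real (y powr (s + 1 - 1) * exp (- y)) * iexp (\<theta> * y))) (nhds x)"
        using eventually_nhds_in_open[of "{0<..}" x] x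
        by (auto elim!: eventually_mono simp: f_def gamma_wt_def)
      ultimately show ?thesis by (subst isCont_cong)
    qed
    show "set_integrable lborel (einterval 0 \<infinity>) f"
      unfolding set_integrable_def by (intro integrable_mult_indicator int) auto
    show "((F \<circ> real_of_ereal) \<longlongrightarrow> 0) (at_right 0)"
    proof -
      have "((\<lambda>x. x powr s * exp (- x)) \<longlongrightarrow> 0) (at_right 0)"
        using assms by real_asymp
      then have "(F \<longlongrightarrow> 0) (at_right 0)"
        by (rule Lim_null_comparison[rotated]) (simp add: norm_F)
      then show ?thesis by (simp add: zero_ereal_def ereal_tendsto_simps1)
    qed
    show "((F \<circ> real_of_ereal) \<longlongrightarrow> 0) (at_left \<infinity>)"
    proof -
      have "((\<lambda>x. x powr s * exp (- x)) \<longlongrightarrow> 0) at_top"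
        using assms by real_asymp
      then have "(F \<longlongrightarrow> 0) at_top"
        by (rule Lim_null_comparison[rotated]) (simp add: norm_F)
      then show ?thesis by (simp add: ereal_tendsto_simps1)
    qed
  qed auto
  moreover have "(LBINT x=0..\<infinity>. f x) = (\<integral>x. f x \<partial>lborel)"
  proof -
    have "indicator (einterval 0 \<infinity>) x *\<^sub>R f x = f x" for x
      by (auto simp: indicator_def einterval_def f_def gamma_wt_def)
    then show ?thesis by (simp add: interval_lebesgue_integral_def set_lebesgue_integral_def)
  qed
  moreover have "(\<integral>x. f x \<partial>lborel) = of_real s * gchar s \<theta> - ?c * gchar (s + 1) \<theta>"
    using assms integrable_gchar[OF assms, of \<theta>] integrable_gchar[of "s + 1" \<theta>]
    unfolding f_def gchar_def by simp
  ultimately show ?thesis by simp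
qed

text \<open>Differentiation under the integral by an explicit remainder: \<open>iexp y\<close>
  differs from \<open>1 + \<i> y\<close> by at most \<open>y^2 / 2\<close>, and the factor
  \<open>x^2\<close> raises the parameter of the weight by 2.\<close>

lemma gchar_derivative:
  assumes "s > 0"
  shows "(gchar s has_vector_derivative \<i> * gchar (s + 1) \<theta>) (at \<theta>)"
proof -
  have bound: "cmod (gchar s (\<theta> + h) - gchar s \<theta> - h *\<^sub>R (\<i> * gchar (s + 1) \<theta>)) \<le> h\<^sup>2 / 2 * Gamma (s + 2)" for h
  proof -
    let ?d = "\<lambda>x. of_real (gamma_wt s x) * iexp ((\<theta> + h) * x) - of_real (gamma_wt s x) * iexp (\<theta> * x)
        - \<i> * of_real h * (of_real (gamma_wt (s + 1) x) * iexp (\<theta> * x))"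
    have G: "has_bochner_integral lborel (gamma_wt (s + 2)) (Gamma (s + 2))"
      using assms by (intro has_bochner_integral_gamma_wt) auto
    have eq: "gchar s (\<theta> + h) - gchar s \<theta> - h *\<^sub>R (\<i> * gchar (s + 1) \<theta>) = (\<integral>x. ?d x \<partial>lborel)"
      using assms integrable_gchar[OF assms, of "\<theta> + h"] integrable_gchar[OF assms, of \<theta>] integrable_gchar[of "s + 1" \<theta>]
      unfolding gchar_def by (simp add: scaleR_conv_of_real mult_ac)
    have "cmod (\<integral>x. ?d x \<partial>lborel) \<le> (\<integral>x. h\<^sup>2 / 2 * gamma_wt (s + 2) x \<partial>lborel)"
    proof (rule Bochner_Integration.integral_norm_bound_integral)
      show "integrable lborel ?d" using assms
        by (intro Bochner_Integration.integrable_diff integrable_mult_right integrable_gchar) auto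
      show "integrable lborel (\<lambda>x. h\<^sup>2 / 2 * gamma_wt (s + 2) x)"
        using G by (intro integrable_mult_right) (simp add: has_bochner_integral_iff)
      show "cmod (?d x) \<le> h\<^sup>2 / 2 * gamma_wt (s + 2) x" for x
      proof -
        have "?d x = of_real (gamma_wt s x) * iexp (\<theta> * x) * (iexp (h * x) - (1 + \<i> * of_real (h * x)))"
          unfolding gamma_wt_Suc[symmetric] by (simp add: exp_add[symmetric] algebra_simps)
        then have "cmod (?d x) = gamma_wt s x * cmod (iexp (h * x) - (1 + \<i> * of_real (h * x)))"
          by (simp add: norm_mult gamma_wt_nonneg)
        also have "\<dots> \<le> gamma_wt s x * (\<bar>h * x\<bar>\<^sup>2 / 2)"
          using iexp_approx1[of "h * x" 1] by (intro mult_left_mono gamma_wt_nonneg) (simp add: numeral_2_eq_2)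
        also have "gamma_wt s x * (\<bar>h * x\<bar>\<^sup>2 / 2) = h\<^sup>2 / 2 * gamma_wt (s + 2) x"
        proof -
          have "gamma_wt (s + 2) x = x * (x * gamma_wt s x)" unfolding gamma_wt_Suc by (simp add: add.assoc)
          then show ?thesis by (simp add: power2_eq_square)
        qed
        finally show ?thesis .
      qed
    qed
    also have "\<dots> = h\<^sup>2 / 2 * Gamma (s + 2)"
      using has_bochner_integral_integral_eq[OF G] by simp
    finally show ?thesis unfolding eq .
  qed
  show ?thesis
    unfolding has_vector_derivative_def has_derivative_iff_norm
  proof (intro conjI bounded_linear_scaleR_left)
    have "((\<lambda>y. \<bar>y - \<theta>\<bar> / 2 * Gamma (s + 2)) \<longlongrightarrow> \<bar>\<theta> - \<theta>\<bar> / 2 * Gamma (s + 2)) (at \<theta>)"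
      by (intro tendsto_intros) simp
    then have "((\<lambda>y. \<bar>y - \<theta>\<bar> / 2 * Gamma (s + 2)) \<longlongrightarrow> 0) (at \<theta>)" by simp
    then show "((\<lambda>y. cmod (gchar s y - gchar s \<theta> - (y - \<theta>) *\<^sub>R (\<i> * gchar (s + 1) \<theta>)) / norm (y - \<theta>)) \<longlongrightarrow> 0) (at \<theta>)"
    proof (rule Lim_null_comparison[rotated])
      show "\<forall>\<^sub>F y in at \<theta>. norm (cmod (gchar s y - gchar s \<theta> - (y - \<theta>) *\<^sub>R (\<i> * gchar (s + 1) \<theta>)) / norm (y - \<theta>)) \<le> \<bar>y - \<theta>\<bar> / 2 * Gamma (s + 2)"
      proof (intro always_eventually allI)
        fix y
        let ?c = "cmod (gchar s y - gchar s \<theta> - (y - \<theta>) *\<^sub>R (\<i> * gchar (s + 1) \<theta>))"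
        have "?c \<le> (y - \<theta>)\<^sup>2 / 2 * Gamma (s + 2)" using bound[of "y - \<theta>"] by simp
        then have "?c / \<bar>y - \<theta>\<bar> \<le> ((y - \<theta>)\<^sup>2 / 2 * Gamma (s + 2)) / \<bar>y - \<theta>\<bar>"
          by (rule divide_right_mono) simp
        also have "\<dots> = \<bar>y - \<theta>\<bar> / 2 * Gamma (s + 2)"
        proof -
          have "(d * d / 2 * c) / d = d / 2 * c" for c d :: real by simp
          moreover have "(y - \<theta>)\<^sup>2 = \<bar>y - \<theta>\<bar> * \<bar>y - \<theta>\<bar>" by (simp add: power2_eq_square)
          ultimately show ?thesis by (simp only:)
        qed
        finally show "norm (?c / norm (y - \<theta>)) \<le> \<bar>y - \<theta>\<bar> / 2 * Gamma (s + 2)" by simp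
      qed
    qed
  qed
qed

text \<open>The derivative formula and integration by parts combine to the linear equation with
  coefficient \<open>\<i> s / (1 - \<i> \<theta>)\<close>. Multiplying by \<open>E\<close>, the
  reciprocal of the expected solution, gives a function with zero derivative.\<close>

theorem gchar_eq:
  assumes "s > 0"
  shows "gchar s \<theta> = of_real (Gamma s) * cpow s \<theta>"
proof -
  have np: "1 - \<i> * of_real x \<notin> \<real>\<^sub>\<le>\<^sub>0" and nz: "1 - \<i> * of_real x \<noteq> 0" for x
    by (auto simp: complex_nonpos_Reals_iff complex_eq_iff)
  define E where "E x = exp (of_real s * Ln (1 - \<i> * of_real x))" for x
  have E: "(E has_vector_derivative (- (of_real s * \<i> / (1 - \<i> * of_real x)) * E x)) (at x)" for x
  proof -
    have "((\<lambda>z. exp (of_real s * Ln (1 - \<i> * z))) has_field_derivative - (of_real s * \<i> / (1 - \<i> * of_real x)) * E x) (at (of_real x))"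
      unfolding E_def using np[of x] nz[of x] by (auto intro!: derivative_eq_intros simp: field_simps)
    then show ?thesis unfolding E_def[abs_def] by (rule has_vector_derivative_real_field)
  qed
  have "((\<lambda>x. gchar s x * E x) has_vector_derivative 0) (at x)" for x
  proof -
    have "((\<lambda>x. gchar s x * E x) has_vector_derivative
      (gchar s x * (- (of_real s * \<i> / (1 - \<i> * of_real x)) * E x) + \<i> * gchar (s + 1) x * E x)) (at x)"
      by (rule has_vector_derivative_mult[OF gchar_derivative[OF assms] E])
    moreover have "gchar (s + 1) x = of_real s * gchar s x / (1 - \<i> * of_real x)"
      using gchar_parts[OF assms, of x] nz[of x] by (simp add: field_simps)
    ultimately show ?thesis by (simp add: mult_ac)
  qed
  then have "gchar s \<theta> * E \<theta> = gchar s 0 * E 0"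
    using has_vector_derivative_zero_constant[of UNIV "\<lambda>x. gchar s x * E x"]
    by (metis UNIV_I convex_UNIV)
  moreover have "E 0 = 1" by (simp add: E_def)
  moreover have "gchar s 0 = of_real (Gamma s)"
    using has_bochner_integral_integral_eq[OF has_bochner_integral_gamma_wt[OF assms]] by (simp add: gchar_def)
  moreover have "cpow s \<theta> * E \<theta> = 1"
    by (simp add: cpow_def E_def exp_add[symmetric])
  moreover have "E \<theta> \<noteq> 0" by (simp add: E_def)
  ultimately show ?thesis by (metis mult.assoc mult_cancel_right mult.right_neutral)
qed

section \<open>Fourier inversion at a point\<close>

lemma gauss_smoothing:
  assumes "\<sigma> > 0"
  shows "(\<integral>\<theta>. of_real (exp (- (\<sigma> * \<theta>)\<^sup>2 / 2)) * iexp (\<theta> * x) \<partial>lborel) = of_real (sqrt (2 * pi) / \<sigma> * exp (- (x / \<sigma>)\<^sup>2 / 2))"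
proof -
  have "char std_normal_distribution (x / \<sigma>) = (\<integral>y. std_normal_density y *\<^sub>R iexp (x / \<sigma> * y) \<partial>lborel)"
    unfolding char_def by (subst integral_density) (auto simp: normal_density_nonneg)
  then have *: "(\<integral>y. std_normal_density y *\<^sub>R iexp (x / \<sigma> * y) \<partial>lborel) = of_real (exp (- (x / \<sigma>)\<^sup>2 / 2))"
    using char_std_normal_distribution by metis
  have "(\<integral>\<theta>. of_real (exp (- (\<sigma> * \<theta>)\<^sup>2 / 2)) * iexp (\<theta> * x) \<partial>lborel)
     = (1 / \<sigma>) *\<^sub>R (\<integral>y. of_real (exp (- (\<sigma> * (y / \<sigma>))\<^sup>2 / 2)) * iexp (y / \<sigma> * x) \<partial>lborel)"
    using lborel_integral_real_affine[of "1 / \<sigma>" "\<lambda>\<theta>. of_real (exp (- (\<sigma> * \<theta>)\<^sup>2 / 2)) * iexp (\<theta> * x)" 0] assms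
    by simp
  also have "(\<lambda>y. of_real (exp (- (\<sigma> * (y / \<sigma>))\<^sup>2 / 2)) * iexp (y / \<sigma> * x)) =
     (\<lambda>y. of_real (sqrt (2 * pi)) * (std_normal_density y *\<^sub>R iexp (x / \<sigma> * y)))"
  proof
    fix y
    have "exp (- (\<sigma> * (y / \<sigma>))\<^sup>2 / 2) = sqrt (2 * pi) * std_normal_density y"
      using assms by (simp add: normal_density_def)
    then show "of_real (exp (- (\<sigma> * (y / \<sigma>))\<^sup>2 / 2)) * iexp (y / \<sigma> * x) =
      of_real (sqrt (2 * pi)) * (std_normal_density y *\<^sub>R iexp (x / \<sigma> * y))"
      by (simp add: scaleR_conv_of_real mult_ac)
  qed
  also have "(1 / \<sigma>) *\<^sub>R (\<integral>y. of_real (sqrt (2 * pi)) * (std_normal_density y *\<^sub>R iexp (x / \<sigma> * y)) \<partial>lborel)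
    = (1 / \<sigma>) *\<^sub>R (of_real (sqrt (2 * pi)) * of_real (exp (- (x / \<sigma>)\<^sup>2 / 2)))"
    by (subst integral_mult_right_zero) (simp only: *)
  finally show ?thesis by (simp add: scaleR_conv_of_real)
qed

lemma integrable_gauss: "\<sigma> > 0 \<Longrightarrow> integrable lborel (\<lambda>\<theta>::real. exp (- (\<sigma> * \<theta>)\<^sup>2 / 2))"
proof -
  assume s: "\<sigma> > 0"
  have "integrable lborel (\<lambda>y. sqrt (2 * pi) * std_normal_density y)" by simp
  moreover have "(\<lambda>y. sqrt (2 * pi) * std_normal_density y) = (\<lambda>y. exp (- y\<^sup>2 / 2))"
    by (auto simp: fun_eq_iff normal_density_def)
  ultimately have "integrable lborel (\<lambda>y::real. exp (- y\<^sup>2 / 2))" by metis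
  from lborel_integrable_real_affine[OF this, of \<sigma> 0] s show ?thesis by simp
qed

text \<open>Smoothing by a Gaussian of width \<open>\<sigma>\<close> turns inversion into Fubini's theorem; the two growth
  bounds on \<open>g\<close> make \<open>g\<close> continuous at \<open>0\<close>, which identifies the limit \<open>\<sigma> \<rightarrow> 0\<close>.\<close>

theorem density_inversion:
  fixes g :: "real \<Rightarrow> ennreal" and M :: "real measure"
  assumes finM: "finite_measure M" and M: "M = density lborel g" and [measurable]: "g \<in> borel_measurable borel"
    and int: "integrable lborel (\<lambda>\<theta>. \<integral>x. iexp (\<theta> * x) \<partial>M)"
    and B: "B \<ge> 0"
    and up: "\<And>x. g x \<le> ennreal (exp (B * \<bar>x\<bar>)) * g 0" and lo: "\<And>x. g 0 \<le> ennreal (exp (B * \<bar>x\<bar>)) * g x"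
  shows "g 0 < \<infinity>" "complex_of_real (enn2real (g 0)) = (\<integral>\<theta>. (\<integral>x. iexp (\<theta> * x) \<partial>M) \<partial>lborel) / (2 * pi)"
proof -
  interpret finite_measure M by fact
  have [measurable_cong]: "sets M = sets borel" by (simp add: M)
  show g0: "g 0 < \<infinity>"
  proof (rule ccontr)
    assume "\<not> g 0 < \<infinity>"
    then have "g 0 = \<infinity>" by (metis infinity_ennreal_def less_top)
    \<comment> \<open>The growth bound \<open>lo\<close> propagates an infinite value at 0 to the
      whole line, against finiteness of \<open>M\<close>.\<close>
    then have "g x = \<infinity>" for x using lo[of x] by (auto simp: top_unique ennreal_mult_eq_top_iff)
    then have "emeasure M UNIV = \<infinity>"
      unfolding M by (simp add: emeasure_density)
    then show False using emeasure_finite[of UNIV] by simp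
  qed
  define G where "G x = enn2real (g x)" for x
  have gG: "g x = ennreal (G x)" for x
    using g0 up[of x] unfolding G_def
    by (metis ennreal_enn2real_if ennreal_less_top ennreal_mult_less_top infinity_ennreal_def le_less_trans top.not_eq_extremum less_irrefl)
  have [measurable]: "G \<in> borel_measurable borel" unfolding G_def by measurable
  have G_nonneg: "0 \<le> G x" for x by (simp add: G_def)
  have upG: "G x \<le> exp (B * \<bar>x\<bar>) * G 0" and loG: "G 0 \<le> exp (B * \<bar>x\<bar>) * G x" for x
    using up[of x] lo[of x] G_nonneg unfolding gG by (simp_all add: ennreal_mult[symmetric])
  have MG: "M = density lborel (\<lambda>x. ennreal (G x))" unfolding M gG ..
  define \<Phi> where "\<Phi> \<theta> = (\<integral>x. iexp (\<theta> * x) \<partial>M)" for \<theta>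
  have \<Phi>int: "integrable lborel \<Phi>" using int unfolding \<Phi>_def .
  \<comment> \<open>Widths tending to 0 but never above 1, so that one majorant serves all
    \<open>k\<close>.\<close>
  define \<sigma> where "\<sigma> k = 1 / real (Suc k)" for k
  have s: "0 < \<sigma> k" "\<sigma> k \<le> 1" for k by (auto simp: \<sigma>_def)
  have slim: "\<sigma> \<longlonglongrightarrow> 0" unfolding \<sigma>_def by (rule LIMSEQ_Suc[OF lim_inverse_n'])
  \<comment> \<open>Integrate
    \<open>exp (- (\<sigma> k * \<theta>)^2 / 2) * iexp (\<theta> * x)\<close> in both orders: over
    \<open>\<theta>\<close> first it yields a Gaussian of width \<open>\<sigma> k\<close> in
    \<open>x\<close>, over \<open>x\<close> first the transform \<open>\<Phi>\<close>.\<close>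
  have key: "of_real (sqrt (2 * pi) * (\<integral>u. exp (- u\<^sup>2 / 2) * G (\<sigma> k * u) \<partial>lborel)) =
      (\<integral>\<theta>. of_real (exp (- (\<sigma> k * \<theta>)\<^sup>2 / 2)) * \<Phi> \<theta> \<partial>lborel)" for k
  proof -
    interpret pair_sigma_finite lborel M
      by (intro pair_sigma_finite.intro lborel.sigma_finite_measure_axioms sigma_finite_measure_axioms)
    have *: "integrable (lborel \<Otimes>\<^sub>M M) (\<lambda>(\<theta>, x). of_real (exp (- (\<sigma> k * \<theta>)\<^sup>2 / 2)) * iexp (\<theta> * x))"
    proof (rule Fubini_integrable)
      show "integrable lborel (\<lambda>\<theta>. \<integral>x. norm (case (\<theta>, x) of (\<theta>, x) \<Rightarrow> of_real (exp (- (\<sigma> k * \<theta>)\<^sup>2 / 2)) * iexp (\<theta> * x)) \<partial>M)"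
        using integrable_gauss[OF s(1), of k] by (simp add: norm_mult)
      show "AE \<theta> in lborel. integrable M (\<lambda>x. case (\<theta>, x) of (\<theta>, x) \<Rightarrow> of_real (exp (- (\<sigma> k * \<theta>)\<^sup>2 / 2)) * iexp (\<theta> * x))"
        by (intro AE_I2 integrable_const_bound[where B = 1]) (auto simp: norm_mult)
    qed measurable
    have "(\<integral>\<theta>. of_real (exp (- (\<sigma> k * \<theta>)\<^sup>2 / 2)) * \<Phi> \<theta> \<partial>lborel)
      = (\<integral>\<theta>. (\<integral>x. of_real (exp (- (\<sigma> k * \<theta>)\<^sup>2 / 2)) * iexp (\<theta> * x) \<partial>M) \<partial>lborel)"
      unfolding \<Phi>_def by simp
    also have "\<dots> = (\<integral>x. (\<integral>\<theta>. of_real (exp (- (\<sigma> k * \<theta>)\<^sup>2 / 2)) * iexp (\<theta> * x) \<partial>lborel) \<partial>M)"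
      using Fubini_integral[OF *] by simp
    also have "\<dots> = (\<integral>x. of_real (sqrt (2 * pi) / \<sigma> k * exp (- (x / \<sigma> k)\<^sup>2 / 2)) \<partial>M)"
      unfolding gauss_smoothing[OF s(1)] ..
    also have "\<dots> = of_real (\<integral>x. sqrt (2 * pi) / \<sigma> k * exp (- (x / \<sigma> k)\<^sup>2 / 2) \<partial>M)"
      by (rule integral_complex_of_real)
    also have "(\<integral>x. sqrt (2 * pi) / \<sigma> k * exp (- (x / \<sigma> k)\<^sup>2 / 2) \<partial>M)
      = (\<integral>x. G x *\<^sub>R (sqrt (2 * pi) / \<sigma> k * exp (- (x / \<sigma> k)\<^sup>2 / 2)) \<partial>lborel)"
      unfolding MG by (rule integral_density) (auto simp: G_nonneg)
    also have "\<dots> = \<bar>\<sigma> k\<bar> *\<^sub>R (\<integral>u. G (0 + \<sigma> k * u) *\<^sub>R (sqrt (2 * pi) / \<sigma> k * exp (- ((0 + \<sigma> k * u) / \<sigma> k)\<^sup>2 / 2)) \<partial>lborel)"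
      by (rule lborel_integral_real_affine) (use s(1)[of k] in simp)
    also have "\<dots> = sqrt (2 * pi) * (\<integral>u. exp (- u\<^sup>2 / 2) * G (\<sigma> k * u) \<partial>lborel)"
    proof -
      have "(\<lambda>u. G (0 + \<sigma> k * u) *\<^sub>R (sqrt (2 * pi) / \<sigma> k * exp (- ((0 + \<sigma> k * u) / \<sigma> k)\<^sup>2 / 2))) =
        (\<lambda>u. (sqrt (2 * pi) / \<sigma> k) * (exp (- u\<^sup>2 / 2) * G (\<sigma> k * u)))"
        using s(1)[of k] by (auto simp: fun_eq_iff)
      then show ?thesis using s(1)[of k] by simp
    qed
    finally show ?thesis ..
  qed
  have gi: "(\<integral>u. exp (- u\<^sup>2 / 2) \<partial>lborel) = sqrt (2 * pi)"
  proof -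
    have "(\<integral>u. std_normal_density u \<partial>lborel) = 1" by simp
    moreover have "(\<lambda>u. exp (- u\<^sup>2 / 2)) = (\<lambda>u. sqrt (2 * pi) * std_normal_density u)"
      by (auto simp: fun_eq_iff normal_density_def)
    ultimately show ?thesis by simp
  qed
  have L: "(\<lambda>k. \<integral>u. exp (- u\<^sup>2 / 2) * G (\<sigma> k * u) \<partial>lborel) \<longlonglongrightarrow> (\<integral>u. exp (- u\<^sup>2 / 2) * G 0 \<partial>lborel)"
  proof (rule integral_dominated_convergence)
    have "integrable lborel (\<lambda>u::real. exp (- (1 / sqrt 2 * u)\<^sup>2 / 2) * (exp (B\<^sup>2) * G 0))"
      by (intro integrable_mult_left integrable_gauss) simp
    then show "integrable lborel (\<lambda>u::real. exp (- u\<^sup>2 / 4) * (exp (B\<^sup>2) * G 0))"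
      by (simp add: power_divide)
    show "AE u in lborel. norm (exp (- u\<^sup>2 / 2) * G (\<sigma> k * u)) \<le> exp (- u\<^sup>2 / 4) * (exp (B\<^sup>2) * G 0)" for k
    proof (rule AE_I2)
      fix u :: real
      \<comment> \<open>This square absorbs the growth \<open>exp (B \<bar>u\<bar>)\<close> into
        half of the Gaussian exponent.\<close>
      have "0 \<le> (\<bar>u\<bar> / 2 - B)\<^sup>2" by simp
      then have "B * \<bar>u\<bar> \<le> u\<^sup>2 / 4 + B\<^sup>2" by (simp add: power2_eq_square algebra_simps)
      moreover have "B * \<bar>\<sigma> k * u\<bar> \<le> B * \<bar>u\<bar>"
        using s[of k] B by (intro mult_left_mono) (auto simp: abs_mult mult_left_le_one_le)
      ultimately have "B * \<bar>\<sigma> k * u\<bar> \<le> u\<^sup>2 / 4 + B\<^sup>2" by linarith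
      then have "exp (B * \<bar>\<sigma> k * u\<bar>) * G 0 \<le> exp (u\<^sup>2 / 4 + B\<^sup>2) * G 0"
        by (intro mult_right_mono) (auto simp: G_nonneg)
      then have "G (\<sigma> k * u) \<le> exp (u\<^sup>2 / 4 + B\<^sup>2) * G 0" using upG[of "\<sigma> k * u"] by linarith
      then have "exp (- u\<^sup>2 / 2) * G (\<sigma> k * u) \<le> exp (- u\<^sup>2 / 2) * (exp (u\<^sup>2 / 4 + B\<^sup>2) * G 0)"
        by (intro mult_left_mono) auto
      also have "\<dots> = exp (- u\<^sup>2 / 4) * (exp (B\<^sup>2) * G 0)"
        unfolding mult.assoc[symmetric] exp_add[symmetric] by simp
      finally show "norm (exp (- u\<^sup>2 / 2) * G (\<sigma> k * u)) \<le> exp (- u\<^sup>2 / 4) * (exp (B\<^sup>2) * G 0)"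
        by (simp add: G_nonneg)
    qed
    show "AE u in lborel. (\<lambda>k. exp (- u\<^sup>2 / 2) * G (\<sigma> k * u)) \<longlonglongrightarrow> exp (- u\<^sup>2 / 2) * G 0"
    proof (rule AE_I2, rule tendsto_mult_left)
      fix u :: real
      let ?e = "\<lambda>k. B * \<bar>\<sigma> k * u\<bar>"
      have e: "?e \<longlonglongrightarrow> 0"
      proof -
        have "?e \<longlonglongrightarrow> B * \<bar>0 * u\<bar>" by (intro tendsto_intros slim)
        then show ?thesis by simp
      qed
      have 1: "(\<lambda>k. exp (- ?e k) * G 0) \<longlonglongrightarrow> G 0"
        using tendsto_mult_right[OF tendsto_exp[OF tendsto_minus[OF e]], of "G 0"] by simp
      have 2: "(\<lambda>k. exp (?e k) * G 0) \<longlonglongrightarrow> G 0"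
        using tendsto_mult_right[OF tendsto_exp[OF e], of "G 0"] by simp
      have 3: "exp (- ?e k) * G 0 \<le> G (\<sigma> k * u)" for k
      proof -
        have "exp (- ?e k) * G 0 \<le> exp (- ?e k) * (exp (?e k) * G (\<sigma> k * u))"
          by (rule mult_left_mono[OF loG]) simp
        also have "\<dots> = (exp (- ?e k) * exp (?e k)) * G (\<sigma> k * u)" by (simp only: mult.assoc)
        also have "exp (- ?e k) * exp (?e k) = 1" by (simp only: mult_exp_exp) simp
        finally show ?thesis by simp
      qed
      have 4: "G (\<sigma> k * u) \<le> exp (?e k) * G 0" for k by (rule upG)
      show "(\<lambda>k. G (\<sigma> k * u)) \<longlonglongrightarrow> G 0"
        using 3 4 by (intro tendsto_sandwich[OF _ _ 1 2] always_eventually allI)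
    qed
  qed measurable
  have R: "(\<lambda>k. \<integral>\<theta>. of_real (exp (- (\<sigma> k * \<theta>)\<^sup>2 / 2)) * \<Phi> \<theta> \<partial>lborel) \<longlonglongrightarrow> (\<integral>\<theta>. \<Phi> \<theta> \<partial>lborel)"
  proof (rule integral_dominated_convergence)
    show "integrable lborel (\<lambda>\<theta>. cmod (\<Phi> \<theta>))" using \<Phi>int by simp
    show "AE \<theta> in lborel. norm (of_real (exp (- (\<sigma> k * \<theta>)\<^sup>2 / 2)) * \<Phi> \<theta>) \<le> cmod (\<Phi> \<theta>)" for k
    proof (rule AE_I2)
      fix \<theta>
      have "exp (- (\<sigma> k * \<theta>)\<^sup>2 / 2) \<le> 1" by simp
      then have "exp (- (\<sigma> k * \<theta>)\<^sup>2 / 2) * cmod (\<Phi> \<theta>) \<le> 1 * cmod (\<Phi> \<theta>)"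
        by (rule mult_right_mono) simp
      then show "norm (of_real (exp (- (\<sigma> k * \<theta>)\<^sup>2 / 2)) * \<Phi> \<theta>) \<le> cmod (\<Phi> \<theta>)"
        by (simp add: norm_mult)
    qed
    show "AE \<theta> in lborel. (\<lambda>k. of_real (exp (- (\<sigma> k * \<theta>)\<^sup>2 / 2)) * \<Phi> \<theta>) \<longlonglongrightarrow> \<Phi> \<theta>"
    proof (rule AE_I2)
      fix \<theta>
      have "(\<lambda>k. of_real (exp (- (\<sigma> k * \<theta>)\<^sup>2 / 2)) * \<Phi> \<theta>) \<longlonglongrightarrow> of_real (exp (- (0 * \<theta>)\<^sup>2 / 2)) * \<Phi> \<theta>"
        by (intro tendsto_intros slim) auto
      then show "(\<lambda>k. of_real (exp (- (\<sigma> k * \<theta>)\<^sup>2 / 2)) * \<Phi> \<theta>) \<longlonglongrightarrow> \<Phi> \<theta>" by simp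
    qed
  qed (use \<Phi>int in measurable)
  have "(\<lambda>k. complex_of_real (sqrt (2 * pi) * (\<integral>u. exp (- u\<^sup>2 / 2) * G (\<sigma> k * u) \<partial>lborel))) \<longlonglongrightarrow> of_real (sqrt (2 * pi) * (\<integral>u. exp (- u\<^sup>2 / 2) * G 0 \<partial>lborel))"
    by (intro tendsto_of_real tendsto_mult_left L)
  then have "of_real (sqrt (2 * pi) * (\<integral>u. exp (- u\<^sup>2 / 2) * G 0 \<partial>lborel)) = (\<integral>\<theta>. \<Phi> \<theta> \<partial>lborel)"
    using R unfolding key by (rule LIMSEQ_unique)
  moreover have "sqrt (2 * pi) * (\<integral>u. exp (- u\<^sup>2 / 2) * G 0 \<partial>lborel) = 2 * pi * G 0"
    using gi by simp
  ultimately have "complex_of_real (2 * pi * G 0) = (\<integral>\<theta>. \<Phi> \<theta> \<partial>lborel)" by (simp only:)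
  then show "complex_of_real (enn2real (g 0)) = (\<integral>\<theta>. (\<integral>x. iexp (\<theta> * x) \<partial>M) \<partial>lborel) / (2 * pi)"
    unfolding \<Phi>_def G_def by (simp add: field_simps)
qed

section \<open>Slices of the positive semidefinite cone\<close>

lemma psd_add: "psd n X \<Longrightarrow> psd n Y \<Longrightarrow> psd n (\<lambda>i j. X i j + Y i j)"
  by (simp add: psd_def quad_def distrib_left distrib_right sum.distrib)

lemma psd_scale: "r > 0 \<Longrightarrow> psd n (\<lambda>i j. r * X i j) \<longleftrightarrow> psd n X"
proof -
  assume "r > 0"
  moreover have "quad n (\<lambda>i j. r * X i j) v = r * quad n X v" for v
    by (simp add: quad_def sum_distrib_left mult_ac)
  ultimately show ?thesis by (simp add: psd_def zero_le_mult_iff)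
qed

lemma psd_ind_mono: "(psd n X \<Longrightarrow> psd n Y) \<Longrightarrow> psd_ind n X \<le> psd_ind n Y"
  by (simp add: psd_ind_def)

text \<open>Cauchy-Schwarz for the Frobenius pairing of \<open>X\<close> with the rank one matrix of
  \<open>v\<close>.\<close>

lemma quad_bound: "\<bar>quad n X v\<bar> \<le> sqrt (fip n X X) * (\<Sum>i<n. (v i)\<^sup>2)"
proof -
  have "(fip n X (\<lambda>i j. v i * v j))\<^sup>2 \<le> fip n X X * (\<Sum>i<n. (v i)\<^sup>2)\<^sup>2"
  proof -
    have "(\<Sum>p\<in>{..<n} \<times> {..<n}. X (fst p) (snd p) * (v (fst p) * v (snd p)))\<^sup>2 \<le>
      (\<Sum>p\<in>{..<n} \<times> {..<n}. (X (fst p) (snd p))\<^sup>2) * (\<Sum>p\<in>{..<n} \<times> {..<n}. (v (fst p) * v (snd p))\<^sup>2)"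
      by (rule Cauchy_Schwarz_ineq_sum)
    moreover have "(\<Sum>i<n. (v i)\<^sup>2)\<^sup>2 = (\<Sum>p\<in>{..<n} \<times> {..<n}. (v (fst p) * v (snd p))\<^sup>2)"
      unfolding power2_eq_square[of "\<Sum>i<n. (v i)\<^sup>2"] sum_product
      by (simp add: sum.cartesian_product case_prod_beta power_mult_distrib)
    ultimately show ?thesis
      by (simp add: fip_def sum.cartesian_product case_prod_beta power2_eq_square)
  qed
  then have "sqrt ((quad n X v)\<^sup>2) \<le> sqrt (fip n X X * (\<Sum>i<n. (v i)\<^sup>2)\<^sup>2)"
    unfolding quad_fip by (rule real_sqrt_le_mono)
  then show ?thesis by (simp add: real_sqrt_mult sum_nonneg)
qed

lemma quad_delta: "quad n delta v = (\<Sum>i<n. (v i)\<^sup>2)"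
proof -
  have "quad n delta v = (\<Sum>i<n. \<Sum>j<n. if j = i then (v i)\<^sup>2 else 0)"
    unfolding quad_def by (intro sum.cong refl) (auto simp: delta_def power2_eq_square)
  then show ?thesis by simp
qed

text \<open>The Frobenius norm dominates the operator norm, so the ball of radius \<open>r\<close>
  around \<open>r\<close> times the identity lies in the cone. This yields both the inclusion
  between slices and the interiority of the centre.\<close>

lemma psd_shift_identity:
  assumes "fip n X X \<le> r\<^sup>2" "r \<ge> 0"
  shows "psd n (\<lambda>i j. r * delta i j + X i j)"
  unfolding psd_def
proof
  fix v
  have "quad n (\<lambda>i j. r * delta i j + X i j) v = r * quad n delta v + quad n X v"
    by (simp add: quad_def distrib_left distrib_right sum.distrib sum_distrib_left mult_ac)
  moreover have "sqrt (fip n X X) \<le> r" using assms by (simp add: real_le_lsqrt)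
  then have "sqrt (fip n X X) * (\<Sum>i<n. (v i)\<^sup>2) \<le> r * (\<Sum>i<n. (v i)\<^sup>2)"
    by (intro mult_right_mono sum_nonneg) auto
  then have "\<bar>quad n X v\<bar> \<le> r * quad n delta v" unfolding quad_delta using quad_bound[of n X v] by linarith
  ultimately show "0 \<le> quad n (\<lambda>i j. r * delta i j + X i j) v" by linarith
qed

text \<open>\<open>B\<close> spans directions inside a section, and the identity and
  \<open>M\<close> are normal to it. The number \<open>k\<close> is not tied to \<open>n\<close>
  yet, because for a given frame the count has to be derived from these properties.\<close>

locale orthonormal_frame =
  fixes n k :: nat and B :: "nat \<Rightarrow> nat \<Rightarrow> nat \<Rightarrow> real" and M :: "nat \<Rightarrow> nat \<Rightarrow> real"
  assumes n3: "n \<ge> 3"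
    and symB: "\<And>l. l < k \<Longrightarrow> sym_on n (B l)" and symM: "sym_on n M"
    and onB: "\<And>l l'. l < k \<Longrightarrow> l' < k \<Longrightarrow> fip n (B l) (B l') = (if l = l' then 1 else 0)"
    and BI: "\<And>l. l < k \<Longrightarrow> fip n (B l) delta = 0"
    and BM: "\<And>l. l < k \<Longrightarrow> fip n (B l) M = 0"
    and MI: "fip n M delta = 0" and MM: "fip n M M = 1"
begin

definition rn :: real where "rn = 1 / sqrt n"

lemma rn_sqrt: "sqrt n * rn = 1" and rn_n: "rn * real n = sqrt n"
  using n3 by (simp_all add: rn_def real_div_sqrt)

definition frame_vec :: "nat \<Rightarrow> nat \<Rightarrow> nat \<Rightarrow> real" where
  "frame_vec l = (if l < k then B l else if l = k then (\<lambda>i j. rn * delta i j) else M)"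

lemma sym_on_frame_vec: "sym_on n (frame_vec l)"
  using symB symM by (auto simp: frame_vec_def sym_on_def delta_def)

lemma fip_frame_vec:
  assumes "l < k + 2" "l' < k + 2"
  shows "fip n (frame_vec l) (frame_vec l') = (if l = l' then 1 else 0)"
proof -
  have c: "l < k \<or> l = k \<or> l = Suc k" "l' < k \<or> l' = k \<or> l' = Suc k" using assms by auto
  have "rn * (rn * real n) = 1" unfolding rn_n using rn_sqrt by (simp add: mult.commute)
  then show ?thesis
    using c by (elim disjE)
     (simp_all add: frame_vec_def onB BI BM MI MM fip_scale_left fip_scale_right fip_delta_delta fip_commute[of n delta "B _"]
        fip_commute[of n delta M] fip_commute[of n M "B _"])
qed

lemma orthonormal_frame_vec: "orthonormal (upper n) (k + 2) (\<lambda>l. coords (frame_vec l))"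
  unfolding orthonormal_def using fip_frame_vec by (simp add: fip_coords[OF sym_on_frame_vec sym_on_frame_vec, symmetric])

end

locale section_frame = orthonormal_frame +
  assumes card_frame: "k + 2 = card (upper n)"
begin

sublocale frame: orthogonal_matrix "upper n" "{..<k + 2}" "\<lambda>p l. coords (frame_vec l) p"
proof
  show "(\<Sum>p\<in>upper n. coords (frame_vec l) p * coords (frame_vec l') p) = (if l = l' then 1 else 0)"
    if "l \<in> {..<k + 2}" "l' \<in> {..<k + 2}" for l l'
    using orthonormal_frame_vec that by (simp add: orthonormal_def ipr_def)
  show "(\<Sum>l\<in>{..<k + 2}. coords (frame_vec l) p * coords (frame_vec l) p') = (if p = p' then 1 else 0)"
    if "p \<in> upper n" "p' \<in> upper n" for p p'
    using orthonormal_complete[OF finite_upper orthonormal_frame_vec card_frame that] .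
qed auto

text \<open>\<open>t\<close> and \<open>s\<close> are the coordinates along the normalised identity
  and along \<open>M\<close>. The trace is \<open>sqrt n * t\<close>, so \<open>t = rn\<close> is
  the slice of trace one.\<close>

definition slice_pt :: "(nat \<Rightarrow> real) \<Rightarrow> real \<Rightarrow> real \<Rightarrow> nat \<Rightarrow> nat \<Rightarrow> real" where
  "slice_pt x t s i j = (\<Sum>l<k. x l * B l i j) + t * (rn * delta i j) + s * M i j"

lemma slice_pt_cong: "(\<And>l. l < k \<Longrightarrow> x l = x' l) \<Longrightarrow> slice_pt x t s = slice_pt x' t s"
  by (simp add: slice_pt_def fun_eq_iff)

lemma symmat_frame:
  assumes "i < n" "j < n"
  shows "symmat (lin_map (upper n) {..<k + 2} (\<lambda>p l. coords (frame_vec l) p) x) i j = slice_pt x (x k) (x (Suc k)) i j"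
proof -
  have "symmat (lin_map (upper n) {..<k + 2} (\<lambda>p l. coords (frame_vec l) p) x) i j = symmat (\<lambda>p. \<Sum>l<k + 2. x l * coords (frame_vec l) p) i j"
    using assms by (intro symmat_cong[of n]) (auto simp: lin_map_def mult.commute)
  also have "\<dots> = (\<Sum>l<k + 2. x l * frame_vec l i j)"
    unfolding symmat_sum using symmat_coords[OF sym_on_frame_vec assms] by simp
  also have "\<dots> = slice_pt x (x k) (x (Suc k)) i j"
    by (simp add: slice_pt_def frame_vec_def add_ac)
  finally show ?thesis .
qed

lemma fip_slice_pt: "fip n (slice_pt x t s) Y = (\<Sum>l<k. x l * fip n (B l) Y) + t * (rn * fip n delta Y) + s * fip n M Y"
proof -
  have "(\<Sum>i<n. \<Sum>j<n. (\<Sum>l<k. x l * B l i j) * Y i j) = (\<Sum>l<k. x l * fip n (B l) Y)"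
  proof -
    have "(\<Sum>i<n. \<Sum>j<n. (\<Sum>l<k. x l * B l i j) * Y i j) = (\<Sum>i<n. \<Sum>j<n. \<Sum>l<k. x l * (B l i j * Y i j))"
      by (simp only: sum_distrib_right mult.assoc)
    also have "\<dots> = (\<Sum>i<n. \<Sum>l<k. \<Sum>j<n. x l * (B l i j * Y i j))"
      by (rule sum.cong[OF refl], rule sum.swap)
    also have "\<dots> = (\<Sum>l<k. \<Sum>i<n. \<Sum>j<n. x l * (B l i j * Y i j))" by (rule sum.swap)
    finally show ?thesis by (simp add: fip_def sum_distrib_left)
  qed
  moreover have "fip n (slice_pt x t s) Y = (\<Sum>i<n. \<Sum>j<n. (\<Sum>l<k. x l * B l i j) * Y i j)
      + fip n (\<lambda>i j. t * (rn * delta i j)) Y + fip n (\<lambda>i j. s * M i j) Y"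
    unfolding fip_def slice_pt_def by (simp add: distrib_right sum.distrib)
  ultimately show ?thesis by (simp add: fip_scale_left)
qed

lemma fip_slice_pt_delta: "fip n (slice_pt x t s) delta = sqrt n * t"
  unfolding fip_slice_pt using BI MI by (simp add: fip_delta_delta rn_n)

lemma fip_slice_pt_M: "fip n (slice_pt x t s) M = s"
  unfolding fip_slice_pt using BM MM MI by (simp add: fip_commute[of n delta M])

definition F :: "real \<Rightarrow> real \<Rightarrow> ennreal" where
  "F t s = (\<integral>\<^sup>+x. psd_ind n (slice_pt x t s) \<partial>lborelP {..<k})"

definition g :: "real \<Rightarrow> ennreal" where
  "g s = (\<integral>\<^sup>+t. F t s * ennreal (exp (- (sqrt n * t))) \<partial>lborel)"

lemma measurable_slice_pt:
  assumes [measurable]: "a \<in> measurable W (lborelP {..<k})" "b \<in> borel_measurable W" "c \<in> borel_measurable W"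
  shows "(\<lambda>w. psd_ind n (slice_pt (a w) (b w) (c w))) \<in> borel_measurable W"
proof (rule measurable_psd_ind)
  fix i j
  have [measurable]: "(\<lambda>w. a w l) \<in> borel_measurable W" if "l \<in> {..<k}" for l
    by (rule measurable_compose[OF assms(1) measurable_lborelP_component[OF that]])
  have "(\<lambda>w. \<Sum>l<k. a w l * B l i j) \<in> borel_measurable W"
    by (intro borel_measurable_sum borel_measurable_times) auto
  then show "(\<lambda>w. slice_pt (a w) (b w) (c w) i j) \<in> borel_measurable W"
    unfolding slice_pt_def by measurable
qed

lemma measurable_F [measurable]: "(\<lambda>(t, s). F t s) \<in> borel_measurable (borel \<Otimes>\<^sub>M borel)"
proof -
  interpret sigma_finite_measure "lborelP {..<k}" by (rule sigma_finite_lborelP) simp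
  have "(\<lambda>w. psd_ind n (slice_pt (snd w) (fst (fst w)) (snd (fst w)))) \<in> borel_measurable ((borel \<Otimes>\<^sub>M borel) \<Otimes>\<^sub>M lborelP {..<k})"
    by (rule measurable_slice_pt) measurable
  from borel_measurable_nn_integral[of "\<lambda>p x. psd_ind n (slice_pt x (fst p) (snd p))" "borel \<Otimes>\<^sub>M borel"] this
  show ?thesis unfolding F_def by (simp add: case_prod_beta)
qed

lemma measurable_g [measurable]: "g \<in> borel_measurable borel"
  unfolding g_def by measurable

text \<open>Adding \<open>\<bar>h\<bar>I + hM\<close>, which is positive semidefinite because \<open>M\<close> has norm 1, maps one slice into
  another. This elementary inclusion yields the continuity of \<open>g\<close> at \<open>0\<close>.\<close>

lemma F_mono: "F t s \<le> F (t + sqrt n * \<bar>h\<bar>) (s + h)"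
  unfolding F_def
proof (intro nn_integral_mono psd_ind_mono)
  fix x assume *: "psd n (slice_pt x t s)"
  have "fip n (\<lambda>i j. h * M i j) (\<lambda>i j. h * M i j) = h\<^sup>2"
    by (simp add: fip_scale_left fip_scale_right MM power2_eq_square)
  then have "psd n (\<lambda>i j. \<bar>h\<bar> * delta i j + h * M i j)"
    by (intro psd_shift_identity) auto
  from psd_add[OF * this]
  have "psd n (\<lambda>i j. slice_pt x t s i j + (\<bar>h\<bar> * delta i j + h * M i j))" .
  also have "(\<lambda>i j. slice_pt x t s i j + (\<bar>h\<bar> * delta i j + h * M i j)) = slice_pt x (t + sqrt n * \<bar>h\<bar>) (s + h)"
  proof (intro ext)
    fix i j :: nat
    have "(t + sqrt n * \<bar>h\<bar>) * (rn * delta i j) = t * (rn * delta i j) + (sqrt n * rn) * \<bar>h\<bar> * delta i j"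
      by (simp add: algebra_simps)
    then show "slice_pt x t s i j + (\<bar>h\<bar> * delta i j + h * M i j) = slice_pt x (t + sqrt n * \<bar>h\<bar>) (s + h) i j"
      unfolding slice_pt_def rn_sqrt by (simp add: distrib_right)
  qed
  finally show "psd n (slice_pt x (t + sqrt n * \<bar>h\<bar>) (s + h))" .
qed

text \<open>Moving along the cone costs a shift of \<open>t\<close> by
  \<open>sqrt n * \<bar>h\<bar>\<close>, which changes the trace by \<open>n * \<bar>h\<bar>\<close>
  and so the weight by the exponential of that. With \<open>h\<close> of either sign it gives both
  growth bounds of \<open>density_inversion\<close>.\<close>

lemma g_le:
  fixes h :: real
  shows "g s \<le> ennreal (exp (n * \<bar>h\<bar>)) * g (s + h)"
proof -
  have "g s \<le> (\<integral>\<^sup>+t. F (t + sqrt n * \<bar>h\<bar>) (s + h) * ennreal (exp (- (sqrt n * t))) \<partial>lborel)"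
    unfolding g_def by (intro nn_integral_mono mult_right_mono F_mono) auto
  also have "\<dots> = (\<integral>\<^sup>+t. ennreal (exp (n * \<bar>h\<bar>)) * (F (sqrt n * \<bar>h\<bar> + 1 * t) (s + h) * ennreal (exp (- (sqrt n * (sqrt n * \<bar>h\<bar> + 1 * t))))) \<partial>lborel)"
  proof (rule nn_integral_cong)
    fix t
    have "exp (- (sqrt n * t)) = exp (n * \<bar>h\<bar>) * exp (- (sqrt n * (sqrt n * \<bar>h\<bar> + 1 * t)))"
      unfolding exp_add[symmetric] by (simp add: algebra_simps)
    then show "F (t + sqrt n * \<bar>h\<bar>) (s + h) * ennreal (exp (- (sqrt n * t))) =
      ennreal (exp (n * \<bar>h\<bar>)) * (F (sqrt n * \<bar>h\<bar> + 1 * t) (s + h) * ennreal (exp (- (sqrt n * (sqrt n * \<bar>h\<bar> + 1 * t)))))"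
      by (simp only: ennreal_mult exp_ge_zero) (simp add: mult_ac add.commute)
  qed
  also have "\<dots> = ennreal (exp (n * \<bar>h\<bar>)) * (\<integral>\<^sup>+t. F (sqrt n * \<bar>h\<bar> + 1 * t) (s + h) * ennreal (exp (- (sqrt n * (sqrt n * \<bar>h\<bar> + 1 * t)))) \<partial>lborel)"
    by (rule nn_integral_cmult) measurable
  also have "(\<integral>\<^sup>+t. F (sqrt n * \<bar>h\<bar> + 1 * t) (s + h) * ennreal (exp (- (sqrt n * (sqrt n * \<bar>h\<bar> + 1 * t)))) \<partial>lborel) = g (s + h)"
    unfolding g_def
    using nn_integral_real_affine[of "\<lambda>t. F t (s + h) * ennreal (exp (- (sqrt n * t)))" 1 "sqrt n * \<bar>h\<bar>"] by simp
  finally show ?thesis .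
qed

text \<open>The test function \<open>\<phi>\<close> is arbitrary so that computing one integral in
  two coordinate systems identifies two measures.\<close>

definition weight :: "(real \<Rightarrow> ennreal) \<Rightarrow> (nat \<Rightarrow> nat \<Rightarrow> real) \<Rightarrow> ennreal" where
  "weight \<phi> X = psd_ind n X * ennreal (exp (- fip n X delta)) * \<phi> (fip n X M)"

lemma weight_cong: "(\<And>i j. i < n \<Longrightarrow> j < n \<Longrightarrow> X i j = Y i j) \<Longrightarrow> weight \<phi> X = weight \<phi> Y"
  unfolding weight_def using psd_cong[of n X Y] fip_cong[of n X Y] by (simp add: psd_ind_def)

lemma measurable_symmat:
  assumes "i < n" "j < n"
  shows "(\<lambda>z. symmat z i j) \<in> borel_measurable (lborelP (upper n))"
proof (cases "i = j")
  case True
  then have "(i, i) \<in> upper n" using assms by (simp add: upper_def)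
  from measurable_lborelP_component[OF this] show ?thesis using True by (simp add: symmat_def symx_def)
next
  case False
  then have "(min i j, max i j) \<in> upper n" using assms by (auto simp: upper_def)
  from measurable_lborelP_component[OF this] show ?thesis using False by (simp add: symmat_def symx_def)
qed

lemma measurable_fip_symmat: "(\<lambda>z. fip n (symmat z) Y) \<in> borel_measurable (lborelP (upper n))"
  unfolding fip_def by (intro borel_measurable_sum borel_measurable_times measurable_symmat) auto

lemma measurable_weight:
  assumes [measurable]: "\<phi> \<in> borel_measurable borel"
  shows "(\<lambda>z. weight \<phi> (symmat z)) \<in> borel_measurable (lborelP (upper n))"
proof -
  note measurable_fip_symmat[measurable] 
  have [measurable]: "(\<lambda>z. psd_ind n (symmat z)) \<in> borel_measurable (lborelP (upper n))"
    by (intro measurable_psd_ind measurable_symmat)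
  show ?thesis unfolding weight_def by measurable
qed

text \<open>Tonelli in the frame: the directions in \<open>B\<close> integrate to \<open>F\<close>,
  then \<open>t\<close> gives \<open>g\<close>, and \<open>s\<close> remains.\<close>

lemma frame_side:
  assumes [measurable]: "\<phi> \<in> borel_measurable borel"
  shows "(\<integral>\<^sup>+z. weight \<phi> (symmat z) \<partial>lborelP (upper n)) = (\<integral>\<^sup>+s. g s * \<phi> s \<partial>lborel)"
proof -
  define f where "f x = psd_ind n (slice_pt x (x k) (x (Suc k))) * ennreal (exp (- (sqrt n * x k))) * \<phi> (x (Suc k))" for x
  have un: "{..<k + 2} = insert (Suc k) (insert k {..<k})" by auto
  have comp: "(\<lambda>x. x l) \<in> borel_measurable (lborelP (insert (Suc k) (insert k {..<k})))" if "l \<le> Suc k" for l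
    by (rule measurable_lborelP_component) (use that in auto)
  have f: "f \<in> borel_measurable (lborelP (insert (Suc k) (insert k {..<k})))"
  proof -
    have [measurable]: "(\<lambda>x. x k) \<in> borel_measurable (lborelP (insert (Suc k) (insert k {..<k})))"
      "(\<lambda>x. x (Suc k)) \<in> borel_measurable (lborelP (insert (Suc k) (insert k {..<k})))"
      by (rule comp, simp)+
    have "(\<lambda>x. psd_ind n (slice_pt (\<lambda>l\<in>{..<k}. x l) (x k) (x (Suc k)))) \<in> borel_measurable (lborelP (insert (Suc k) (insert k {..<k})))"
      by (intro measurable_slice_pt measurable_lborelP_restrict comp) auto
    also have "(\<lambda>x. psd_ind n (slice_pt (\<lambda>l\<in>{..<k}. x l) (x k) (x (Suc k)))) = (\<lambda>x. psd_ind n (slice_pt x (x k) (x (Suc k))))"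
      by (intro ext arg_cong[where f = "psd_ind n"] slice_pt_cong) simp
    finally have [measurable]: "(\<lambda>x. psd_ind n (slice_pt x (x k) (x (Suc k)))) \<in> borel_measurable (lborelP (insert (Suc k) (insert k {..<k})))" .
    show ?thesis unfolding f_def by measurable
  qed
  have upd: "f ((x(k := t))(Suc k := s)) = psd_ind n (slice_pt x t s) * (ennreal (exp (- (sqrt n * t))) * \<phi> s)" for x t s
  proof -
    have "slice_pt ((x(k := t))(Suc k := s)) t s = slice_pt x t s" by (rule slice_pt_cong) auto
    then show ?thesis by (simp add: f_def mult.assoc)
  qed
  have "(\<integral>\<^sup>+z. weight \<phi> (symmat z) \<partial>lborelP (upper n)) =
    (\<integral>\<^sup>+x. weight \<phi> (symmat (lin_map (upper n) {..<k + 2} (\<lambda>p l. coords (frame_vec l) p) x)) \<partial>lborelP {..<k + 2})"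
    by (rule frame.nn_integral_lin_map[symmetric]) (rule measurable_weight[OF assms])
  also have "\<dots> = (\<integral>\<^sup>+x. f x \<partial>lborelP {..<k + 2})"
  proof (rule nn_integral_cong)
    fix x
    have "weight \<phi> (symmat (lin_map (upper n) {..<k + 2} (\<lambda>p l. coords (frame_vec l) p) x)) = weight \<phi> (slice_pt x (x k) (x (Suc k)))"
      by (rule weight_cong) (rule symmat_frame)
    then show "weight \<phi> (symmat (lin_map (upper n) {..<k + 2} (\<lambda>p l. coords (frame_vec l) p) x)) = f x"
      by (simp add: weight_def f_def fip_slice_pt_delta fip_slice_pt_M)
  qed
  also have "\<dots> = (\<integral>\<^sup>+s. \<integral>\<^sup>+x. f (x(Suc k := s)) \<partial>lborelP (insert k {..<k}) \<partial>lborel)"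
    unfolding un by (rule lborel_prod.product_nn_integral_insert_rev) (use f in auto)
  also have "\<dots> = (\<integral>\<^sup>+s. \<integral>\<^sup>+t. \<integral>\<^sup>+x. f ((x(k := t))(Suc k := s)) \<partial>lborelP {..<k} \<partial>lborel \<partial>lborel)"
  proof (rule nn_integral_cong)
    fix s :: real
    have "(\<lambda>x. x(Suc k := s)) \<in> measurable (lborelP (insert k {..<k})) (lborelP (insert (Suc k) (insert k {..<k})))"
      by (rule measurable_fun_upd[where J = "insert k {..<k}"]) auto
    from measurable_compose[OF this f]
    show "(\<integral>\<^sup>+x. f (x(Suc k := s)) \<partial>lborelP (insert k {..<k})) = (\<integral>\<^sup>+t. \<integral>\<^sup>+x. f ((x(k := t))(Suc k := s)) \<partial>lborelP {..<k} \<partial>lborel)"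
      by (intro lborel_prod.product_nn_integral_insert_rev) auto
  qed
  also have "\<dots> = (\<integral>\<^sup>+s. \<integral>\<^sup>+t. F t s * (ennreal (exp (- (sqrt n * t))) * \<phi> s) \<partial>lborel \<partial>lborel)"
  proof -
    have "(\<lambda>x. psd_ind n (slice_pt x t s)) \<in> borel_measurable (lborelP {..<k})" for t s
      by (rule measurable_slice_pt) auto
    then show ?thesis unfolding upd F_def by (simp add: nn_integral_multc)
  qed
  also have "\<dots> = (\<integral>\<^sup>+s. g s * \<phi> s \<partial>lborel)"
    unfolding g_def by (subst nn_integral_multc[symmetric]) (auto simp: mult.assoc)
  finally show ?thesis .
qed

text \<open>Conjugation preserves the integral and makes the weight depend on the diagonal only, so
  the off-diagonal coordinates integrate to \<open>ellvol\<close>. Its power of the diagonal times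
  the exponential of the trace is a product of Gamma weights.\<close>

lemma eigen_side:
  assumes on: "orthonormal {..<n} n u" and eig: "\<And>a i. a < n \<Longrightarrow> i < n \<Longrightarrow> (\<Sum>j<n. M i j * u a j) = lam a * u a i"
    and phi[measurable]: "\<phi> \<in> borel_measurable borel"
  shows "(\<integral>\<^sup>+z. weight \<phi> (symmat z) \<partial>lborelP (upper n)) =
    (\<integral>\<^sup>+x. ennreal (ellconst n * (\<Prod>p\<in>diag_idx n. gamma_wt ((real n + 1) / 2) (x p))) * \<phi> (\<Sum>p\<in>diag_idx n. lam (fst p) * x p) \<partial>lborelP (diag_idx n))"
proof -
  define c where "c x = ennreal (exp (- (\<Sum>p\<in>diag_idx n. x p))) * \<phi> (\<Sum>p\<in>diag_idx n. lam (fst p) * x p)" for x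
  define f where "f y = psd_ind n (symmat y) * c y" for y
  have diag_comp: "(\<lambda>x. x p) \<in> borel_measurable (lborelP A)" if "p \<in> diag_idx n" "diag_idx n \<subseteq> A" for p A
    by (rule measurable_lborelP_component) (use that in auto)
  have c_meas: "c \<in> borel_measurable (lborelP A)" if "diag_idx n \<subseteq> A" for A
  proof -
    have [measurable]: "(\<lambda>x. \<Sum>p\<in>diag_idx n. x p) \<in> borel_measurable (lborelP A)"
      "(\<lambda>x. \<Sum>p\<in>diag_idx n. lam (fst p) * x p) \<in> borel_measurable (lborelP A)"
      using that diag_comp by (auto intro!: borel_measurable_sum borel_measurable_times)
    show ?thesis unfolding c_def by measurable
  qed
  have psd_meas[measurable]: "(\<lambda>y. psd_ind n (symmat y)) \<in> borel_measurable (lborelP (upper n))"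
    by (intro measurable_psd_ind measurable_symmat)
  have f_meas: "f \<in> borel_measurable (lborelP (diag_idx n \<union> strict_upper n))"
    unfolding f_def upper_Un[symmetric] using c_meas[of "upper n"] psd_meas by (auto simp: upper_Un)
  have "(\<integral>\<^sup>+z. weight \<phi> (symmat z) \<partial>lborelP (upper n)) =
    (\<integral>\<^sup>+y. weight \<phi> (symmat (\<lambda>q\<in>upper n. coords (conj_by n u (symmat y)) q)) \<partial>lborelP (upper n))"
    by (rule nn_integral_conj_by[OF on, symmetric]) (rule measurable_weight[OF phi])
  also have "\<dots> = (\<integral>\<^sup>+y. f y \<partial>lborelP (upper n))"
  proof (rule nn_integral_cong)
    fix y
    have "weight \<phi> (symmat (\<lambda>q\<in>upper n. coords (conj_by n u (symmat y)) q)) = weight \<phi> (conj_by n u (symmat y))"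
    proof (rule weight_cong)
      fix i j assume ij: "i < n" "j < n"
      have "symmat (\<lambda>q\<in>upper n. coords (conj_by n u (symmat y)) q) i j = symmat (coords (conj_by n u (symmat y))) i j"
        using ij by (intro symmat_cong[of n]) auto
      also have "\<dots> = conj_by n u (symmat y) i j" using ij by (intro symmat_coords sym_on_conj_by) auto
      finally show "symmat (\<lambda>q\<in>upper n. coords (conj_by n u (symmat y)) q) i j = conj_by n u (symmat y) i j" .
    qed
    moreover have "symmat y a a = y (a, a)" for a by (simp add: symmat_def symx_def)
    moreover have "fip n (conj_by n u (symmat y)) delta = (\<Sum>a<n. 1 * symmat y a a)"
      by (rule eigen_fip[OF on]) (rule delta_eigen[OF on])
    moreover have "fip n (conj_by n u (symmat y)) M = (\<Sum>a<n. lam a * symmat y a a)"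
      by (rule eigen_fip[OF on eig])
    moreover have "psd_ind n (conj_by n u (symmat y)) = psd_ind n (symmat y)"
      using psd_conj_by_iff[OF on] by (simp add: psd_ind_def)
    ultimately show "weight \<phi> (symmat (\<lambda>q\<in>upper n. coords (conj_by n u (symmat y)) q)) = f y"
      by (simp add: weight_def f_def c_def sum_diag_idx mult.assoc)
  qed
  also have "\<dots> = (\<integral>\<^sup>+x. \<integral>\<^sup>+z. f (merge (diag_idx n) (strict_upper n) (x, z)) \<partial>lborelP (strict_upper n) \<partial>lborelP (diag_idx n))"
    unfolding upper_Un by (rule lborel_prod.product_nn_integral_fold[OF diag_idx_strict_upper]) (use f_meas in auto)
  also have "\<dots> = (\<integral>\<^sup>+x. ellvol n (\<lambda>i. x (i, i)) * c x \<partial>lborelP (diag_idx n))"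
  proof (rule nn_integral_cong)
    fix x :: "nat \<times> nat \<Rightarrow> real"
    have "f (merge (diag_idx n) (strict_upper n) (x, z)) = psd_ind n (symx (\<lambda>i. x (i, i)) z) * c x" for z
    proof -
      have "psd n (symmat (merge (diag_idx n) (strict_upper n) (x, z))) \<longleftrightarrow> psd n (symx (\<lambda>i. x (i, i)) z)"
      proof (rule psd_cong)
        fix i j assume ij: "i < n" "j < n"
        show "symmat (merge (diag_idx n) (strict_upper n) (x, z)) i j = symx (\<lambda>i. x (i, i)) z i j"
        proof (cases "i = j")
          case True
          then show ?thesis using ij by (auto simp: symmat_def symx_def merge_def diag_idx_def)
        next
          case False
          moreover have "(min i j, max i j) \<in> strict_upper n" by (rule min_max_strict_upper[OF ij False])
          moreover then have "(min i j, max i j) \<notin> diag_idx n" using diag_idx_strict_upper by blast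
          ultimately show ?thesis by (simp add: symmat_def symx_def merge_def)
        qed
      qed
      moreover have "c (merge (diag_idx n) (strict_upper n) (x, z)) = c x"
        unfolding c_def by (simp add: merge_def)
      ultimately show ?thesis by (simp add: f_def psd_ind_def)
    qed
    moreover have "(\<lambda>z. psd_ind n (symx (\<lambda>i. x (i, i)) z)) \<in> borel_measurable (lborelP (strict_upper n))"
      by (intro measurable_psd_ind measurable_symx[of _ n]) auto
    ultimately show "(\<integral>\<^sup>+z. f (merge (diag_idx n) (strict_upper n) (x, z)) \<partial>lborelP (strict_upper n)) = ellvol n (\<lambda>i. x (i, i)) * c x"
      by (simp add: ellvol_def nn_integral_multc)
  qed
  also have "\<dots> = (\<integral>\<^sup>+x. ennreal (ellconst n * (\<Prod>p\<in>diag_idx n. gamma_wt ((real n + 1) / 2) (x p))) * \<phi> (\<Sum>p\<in>diag_idx n. lam (fst p) * x p) \<partial>lborelP (diag_idx n))"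
  proof (rule nn_integral_cong_AE)
    have "AE x in lborelP (diag_idx n). \<forall>p\<in>diag_idx n. (x p)\<^sup>2 \<noteq> 0"
      using AE_lborelP_neq[of "diag_idx n" "\<lambda>_. 0"] by simp
    then show "AE x in lborelP (diag_idx n). ellvol n (\<lambda>i. x (i, i)) * c x =
      ennreal (ellconst n * (\<Prod>p\<in>diag_idx n. gamma_wt ((real n + 1) / 2) (x p))) * \<phi> (\<Sum>p\<in>diag_idx n. lam (fst p) * x p)"
    proof eventually_elim
      case (elim x)
      show ?case
      proof (cases "\<forall>i<n. 0 < x (i, i)")
        case True
        have "ellvol n (\<lambda>i. x (i, i)) = ennreal (ellconst n * (\<Prod>i<n. x (i, i) powr ((real n - 1) / 2)))"
          using True by (intro ellvol_pos) auto
        moreover have "(\<Prod>p\<in>diag_idx n. gamma_wt ((real n + 1) / 2) (x p)) =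
          (\<Prod>i<n. x (i, i) powr ((real n - 1) / 2)) * exp (- (\<Sum>p\<in>diag_idx n. x p))"
        proof -
          have "(real n + 1) / 2 - 1 = (real n - 1) / 2" by (simp add: field_simps)
          then have "gamma_wt ((real n + 1) / 2) (x (i, i)) = x (i, i) powr ((real n - 1) / 2) * exp (- x (i, i))" if "i < n" for i
            using True that by (simp add: gamma_wt_def)
          then show ?thesis by (simp add: prod_diag_idx sum_diag_idx prod.distrib exp_sum sum_negf[symmetric])
        qed
        ultimately show ?thesis
          using ellconst_pos[of n] by (simp add: c_def mult.assoc[symmetric] ennreal_mult[symmetric] prod_nonneg)
      next
        case False
        then obtain i where i: "i < n" "\<not> 0 < x (i, i)" by blast
        then have pd: "(i, i) \<in> diag_idx n" by (simp add: diag_idx_def)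
        with elim i have "x (i, i) < 0" by force
        then have "ellvol n (\<lambda>i. x (i, i)) = 0" using i by (intro ellvol_neg[of i]) auto
        moreover have "(\<Prod>p\<in>diag_idx n. gamma_wt ((real n + 1) / 2) (x p)) = 0"
          using pd i by (intro prod_zero bexI[of _ "(i, i)"]) (auto simp: gamma_wt_def)
        ultimately show ?thesis by (simp only: mult_zero_left mult_zero_right ennreal_0)
      qed
    qed
  qed
  finally show ?thesis .
qed

text \<open>\<open>\<rho>\<close> is the law of the combination of the diagonal entries with
  coefficients \<open>lam\<close> under independent unnormalised Gamma weights. It has density
  \<open>g\<close> because both sides integrate every test function alike, and independence
  factorises its transform.\<close>

lemma section_fourier:
  assumes on: "orthonormal {..<n} n u" and eig: "\<And>a i. a < n \<Longrightarrow> i < n \<Longrightarrow> (\<Sum>j<n. M i j * u a j) = lam a * u a i"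
  shows "g 0 < \<infinity>"
    "complex_of_real (enn2real (g 0)) =
      of_real (ellconst n * Gamma ((real n + 1) / 2) ^ n) * (\<integral>\<theta>. cprod n lam \<theta> \<partial>lborel) / (2 * pi)"
proof -
  let ?s = "(real n + 1) / 2"
  let ?w = "\<lambda>x :: nat \<times> nat \<Rightarrow> real. ellconst n * (\<Prod>p\<in>diag_idx n. gamma_wt ?s (x p))"
  let ?S = "\<lambda>x :: nat \<times> nat \<Rightarrow> real. \<Sum>p\<in>diag_idx n. lam (fst p) * x p"
  define \<mu> where "\<mu> = density (lborelP (diag_idx n)) (\<lambda>x. ennreal (?w x))"
  define \<rho> where "\<rho> = distr \<mu> borel ?S"
  have s: "?s > 0" by simp
  have comp[measurable]: "(\<lambda>x. x p) \<in> borel_measurable (lborelP (diag_idx n))" if "p \<in> diag_idx n" for p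
    by (rule measurable_lborelP_component[OF that])
  have w_meas[measurable]: "?w \<in> borel_measurable (lborelP (diag_idx n))"
    by (intro borel_measurable_times borel_measurable_prod borel_measurable_const measurable_compose[OF comp borel_measurable_gamma_wt])
  have S_meas[measurable]: "?S \<in> borel_measurable (lborelP (diag_idx n))"
    by (intro borel_measurable_times borel_measurable_sum borel_measurable_const comp)
  have w_nonneg: "0 \<le> ?w x" for x
    using ellconst_pos[of n] by (intro mult_nonneg_nonneg prod_nonneg) (auto simp: gamma_wt_nonneg)
  have S_mu[measurable]: "?S \<in> measurable \<mu> borel" unfolding \<mu>_def by measurable
  have \<rho>_int: "(\<integral>\<^sup>+s. \<phi> s \<partial>\<rho>) = (\<integral>\<^sup>+s. g s * \<phi> s \<partial>lborel)" if [measurable]: "\<phi> \<in> borel_measurable borel" for \<phi>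
  proof -
    have "(\<integral>\<^sup>+s. \<phi> s \<partial>\<rho>) = (\<integral>\<^sup>+x. \<phi> (?S x) \<partial>\<mu>)"
      unfolding \<rho>_def by (rule nn_integral_distr) auto
    also have "\<dots> = (\<integral>\<^sup>+x. ennreal (?w x) * \<phi> (?S x) \<partial>lborelP (diag_idx n))"
      unfolding \<mu>_def by (rule nn_integral_density) measurable
    also have "\<dots> = (\<integral>\<^sup>+s. g s * \<phi> s \<partial>lborel)"
      using eigen_side[OF on eig that] frame_side[OF that] by simp
    finally show ?thesis .
  qed
  have \<rho>g: "\<rho> = density lborel g"
  proof (rule measure_eqI)
    fix A assume "A \<in> sets \<rho>"
    then have [measurable]: "A \<in> sets borel" by (simp add: \<rho>_def)
    have "emeasure \<rho> A = (\<integral>\<^sup>+s. indicator A s \<partial>\<rho>)" by (simp add: \<rho>_def)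
    also have "\<dots> = (\<integral>\<^sup>+s. g s * indicator A s \<partial>lborel)" by (rule \<rho>_int) measurable
    also have "\<dots> = emeasure (density lborel g) A" by (simp add: emeasure_density)
    finally show "emeasure \<rho> A = emeasure (density lborel g) A" .
  qed (simp add: \<rho>_def)
  have finM: "finite_measure \<rho>"
  proof
    have "emeasure \<rho> (space \<rho>) = (\<integral>\<^sup>+s. 1 \<partial>\<rho>)" by simp
    also have "\<dots> = (\<integral>\<^sup>+x. 1 \<partial>\<mu>)" unfolding \<rho>_def by (rule nn_integral_distr) auto
    also have "\<dots> = (\<integral>\<^sup>+x. ennreal (?w x) \<partial>lborelP (diag_idx n))"
      unfolding \<mu>_def by (subst nn_integral_density) auto
    also have "\<dots> = (\<integral>\<^sup>+x. ennreal (ellconst n) * (\<Prod>p\<in>diag_idx n. ennreal (gamma_wt ?s (x p))) \<partial>lborelP (diag_idx n))"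
      using ellconst_pos[of n] by (simp add: ennreal_mult prod_nonneg gamma_wt_nonneg prod_ennreal)
    also have "\<dots> = ennreal (ellconst n) * (\<Prod>p\<in>diag_idx n. ennreal (Gamma ?s))"
    proof -
      have "(\<lambda>x. \<Prod>p\<in>diag_idx n. ennreal (gamma_wt ?s (x p))) \<in> borel_measurable (lborelP (diag_idx n))"
        by (intro borel_measurable_prod_ennreal measurable_compose[OF comp]) auto
      moreover have "(\<integral>\<^sup>+x. (\<Prod>p\<in>diag_idx n. ennreal (gamma_wt ?s (x p))) \<partial>lborelP (diag_idx n)) = (\<Prod>p\<in>diag_idx n. ennreal (Gamma ?s))"
        by (subst lborel_prod.product_nn_integral_prod) (auto simp: nn_integral_gamma_wt[OF s])
      ultimately show ?thesis by (simp add: nn_integral_cmult)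
    qed
    also have "\<dots> < \<infinity>" by (simp add: ennreal_mult_less_top power_less_top_ennreal)
    finally show "emeasure \<rho> (space \<rho>) \<noteq> \<infinity>" by simp
  qed
  have char: "(\<integral>x. iexp (\<theta> * x) \<partial>\<rho>) = of_real (ellconst n * Gamma ?s ^ n) * cprod n lam \<theta>" for \<theta>
  proof -
    have "(\<integral>x. iexp (\<theta> * x) \<partial>\<rho>) = (\<integral>x. iexp (\<theta> * ?S x) \<partial>\<mu>)"
      unfolding \<rho>_def by (rule integral_distr) auto
    also have "\<dots> = (\<integral>x. ?w x *\<^sub>R iexp (\<theta> * ?S x) \<partial>lborelP (diag_idx n))"
      unfolding \<mu>_def by (rule integral_density) (auto simp: w_nonneg)
    also have "\<dots> = (\<integral>x. of_real (ellconst n) * (\<Prod>p\<in>diag_idx n. of_real (gamma_wt ?s (x p)) * iexp ((lam (fst p) * \<theta>) * x p)) \<partial>lborelP (diag_idx n))"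
    proof (rule Bochner_Integration.integral_cong)
      fix x :: "nat \<times> nat \<Rightarrow> real"
      have "iexp (\<theta> * ?S x) = (\<Prod>p\<in>diag_idx n. iexp ((lam (fst p) * \<theta>) * x p))"
        by (simp add: exp_sum[symmetric] sum_distrib_left mult_ac)
      then show "?w x *\<^sub>R iexp (\<theta> * ?S x) = of_real (ellconst n) * (\<Prod>p\<in>diag_idx n. of_real (gamma_wt ?s (x p)) * iexp ((lam (fst p) * \<theta>) * x p))"
        by (simp add: scaleR_conv_of_real prod.distrib)
    qed simp
    also have "\<dots> = of_real (ellconst n) * (\<Prod>p\<in>diag_idx n. gchar ?s (lam (fst p) * \<theta>))"
      unfolding gchar_def
      by (subst integral_mult_right_zero, subst lborel_prod.product_integral_prod)
         (rule finite_diag_idx, rule integrable_gchar[OF s], rule refl)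
    also have "\<dots> = of_real (ellconst n) * (\<Prod>a<n. of_real (Gamma ?s) * cpow ?s (lam a * \<theta>))"
      by (simp add: prod_diag_idx gchar_eq[OF s])
    also have "\<dots> = of_real (ellconst n * Gamma ?s ^ n) * cprod n lam \<theta>"
      by (simp add: prod.distrib cprod_def)
    finally show ?thesis .
  qed
  have lam2: "(\<Sum>a<n. (lam a)\<^sup>2) = 1" using eigen_sums(2)[OF on eig] MM by simp
  have int: "integrable lborel (\<lambda>\<theta>. \<integral>x. iexp (\<theta> * x) \<partial>\<rho>)"
    unfolding char by (intro integrable_mult_right integrable_cprod[OF lam2 n3])
  have up: "g x \<le> ennreal (exp (real n * \<bar>x\<bar>)) * g 0" for x using g_le[of x "- x"] by simp
  have lo: "g 0 \<le> ennreal (exp (real n * \<bar>x\<bar>)) * g x" for x using g_le[of 0 x] by simp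
  show "g 0 < \<infinity>" by (rule density_inversion(1)[OF finM \<rho>g measurable_g int _ up lo]) simp
  show "complex_of_real (enn2real (g 0)) =
      of_real (ellconst n * Gamma ((real n + 1) / 2) ^ n) * (\<integral>\<theta>. cprod n lam \<theta> \<partial>lborel) / (2 * pi)"
  proof -
    have "complex_of_real (enn2real (g 0)) = (\<integral>\<theta>. (\<integral>x. iexp (\<theta> * x) \<partial>\<rho>) \<partial>lborel) / (2 * pi)"
      by (rule density_inversion(2)[OF finM \<rho>g measurable_g int _ up lo]) simp
    then show ?thesis unfolding char by simp
  qed
qed

text \<open>Dilation by \<open>sqrt n * t\<close> carries the slice of trace one onto the slice at
  height \<open>t\<close>, with a \<open>k\<close>-dimensional Jacobian.\<close>

lemma F_scale:
  assumes "t > 0"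
  shows "F t 0 = ennreal ((sqrt n * t) ^ k) * F rn 0"
proof -
  let ?r = "sqrt n * t"
  have r: "?r > 0" using assms n3 by simp
  have "F t 0 = ennreal (?r ^ card {..<k}) * (\<integral>\<^sup>+x. psd_ind n (slice_pt (\<lambda>l\<in>{..<k}. 0 + ?r * x l) t 0) \<partial>lborelP {..<k})"
    unfolding F_def by (rule nn_integral_lborelP_affine[OF _ r]) (auto intro!: measurable_slice_pt)
  also have "(\<integral>\<^sup>+x. psd_ind n (slice_pt (\<lambda>l\<in>{..<k}. 0 + ?r * x l) t 0) \<partial>lborelP {..<k}) = F rn 0"
    unfolding F_def
  proof (rule nn_integral_cong)
    fix x
    have "slice_pt (\<lambda>l\<in>{..<k}. 0 + ?r * x l) t 0 = (\<lambda>i j. ?r * slice_pt x rn 0 i j)"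
    proof (intro ext)
      fix i j :: nat
      have "?r * (rn * (rn * delta i j)) = (sqrt n * rn) * (t * (rn * delta i j))" by (simp only: mult_ac)
      then show "slice_pt (\<lambda>l\<in>{..<k}. 0 + ?r * x l) t 0 i j = ?r * slice_pt x rn 0 i j"
        unfolding rn_sqrt by (simp add: slice_pt_def distrib_left sum_distrib_left mult.assoc)
    qed
    then show "psd_ind n (slice_pt (\<lambda>l\<in>{..<k}. 0 + ?r * x l) t 0) = psd_ind n (slice_pt x rn 0)"
      using psd_scale[OF r] by (simp add: psd_ind_def)
  qed
  finally show ?thesis by simp
qed

lemma F_neg: "t < 0 \<Longrightarrow> F t 0 = 0"
proof -
  assume t: "t < 0"
  have "psd_ind n (slice_pt x t 0) = 0" for x
  proof (rule ccontr)
    assume "psd_ind n (slice_pt x t 0) \<noteq> 0"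
    then have "psd n (slice_pt x t 0)" by (auto simp: psd_ind_def split: if_splits)
    then have "0 \<le> (\<Sum>a<n. slice_pt x t 0 a a)" by (intro sum_nonneg) (auto dest: psd_diag_nonneg)
    then have "0 \<le> sqrt n * t" using fip_slice_pt_delta[of x t 0] by (simp add: fip_delta)
    then show False using t n3 by (simp add: zero_le_mult_iff)
  qed
  then show ?thesis by (simp add: F_def)
qed

lemma g_zero: "g 0 = ennreal (Gamma (real k + 1) / sqrt n) * F rn 0"
proof -
  let ?F = "F rn 0"
  have n0: "sqrt n > 0" using n3 by simp
  have "g 0 = (\<integral>\<^sup>+t. ennreal (gamma_wt (real k + 1) (sqrt n * t)) * ?F \<partial>lborel)"
    unfolding g_def
  proof (rule nn_integral_cong_AE)
    show "AE t in lborel. F t 0 * ennreal (exp (- (sqrt n * t))) = ennreal (gamma_wt (real k + 1) (sqrt n * t)) * ?F"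
      using AE_lborel_singleton[of 0]
    proof eventually_elim
      case (elim t)
      show ?case
      proof (cases "t > 0")
        case True
        then have "0 < sqrt n * t" using n0 by simp
        then have "gamma_wt (real k + 1) (sqrt n * t) = (sqrt n * t) ^ k * exp (- (sqrt n * t))"
          by (simp only: gamma_wt_def add_diff_cancel_right' powr_realpow if_True)
        then show ?thesis using F_scale[OF True] True n0
          by (simp add: ennreal_mult mult_ac)
      next
        case False
        then have t: "t < 0" using elim by simp
        then have "sqrt n * t \<le> 0" using n0 by (simp add: mult_le_0_iff)
        then show ?thesis using F_neg[OF t] by (simp add: gamma_wt_def)
      qed
    qed
  qed
  also have "\<dots> = (\<integral>\<^sup>+t. ennreal (gamma_wt (real k + 1) (sqrt n * t)) \<partial>lborel) * ?F"
    by (rule nn_integral_multc) measurable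
  also have "(\<integral>\<^sup>+t. ennreal (gamma_wt (real k + 1) (sqrt n * t)) \<partial>lborel) = ennreal (Gamma (real k + 1) / sqrt n)"
  proof -
    have "(\<integral>\<^sup>+t. ennreal (gamma_wt (real k + 1) t) \<partial>lborel) = ennreal (Gamma (real k + 1))"
      by (rule nn_integral_gamma_wt) simp
    then have "ennreal (Gamma (real k + 1)) = ennreal (sqrt n) * (\<integral>\<^sup>+t. ennreal (gamma_wt (real k + 1) (sqrt n * t)) \<partial>lborel)"
      using nn_integral_real_affine[of "\<lambda>t. ennreal (gamma_wt (real k + 1) t)" "sqrt n" 0] n0 by simp
    then have "ennreal rn * ennreal (Gamma (real k + 1)) = ennreal rn * (ennreal (sqrt n) * (\<integral>\<^sup>+t. ennreal (gamma_wt (real k + 1) (sqrt n * t)) \<partial>lborel))"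
      by simp
    also have "\<dots> = (ennreal rn * ennreal (sqrt n)) * (\<integral>\<^sup>+t. ennreal (gamma_wt (real k + 1) (sqrt n * t)) \<partial>lborel)"
      by (simp only: mult.assoc)
    also have "ennreal rn * ennreal (sqrt n) = 1"
      using n0 rn_sqrt by (subst ennreal_mult[symmetric]) (auto simp: rn_def)
    finally show ?thesis using n0 by (simp add: rn_def ennreal_mult[symmetric] Gamma_real_pos less_imp_le)
  qed
  finally show ?thesis .
qed

text \<open>Of the matrix only an anonymous \<open>lam\<close> with its two constraints survives,
  which is what the limit theorem for sequences consumes.\<close>

theorem section_volume:
  "\<exists>lam. (\<Sum>a<n. lam a) = 0 \<and> (\<Sum>a<n. (lam a)\<^sup>2) = 1 \<and> F rn 0 < \<infinity> \<and>
    complex_of_real (enn2real (F rn 0)) =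
      of_real (sqrt n * ellconst n * Gamma ((real n + 1) / 2) ^ n / (2 * pi * Gamma (real k + 1))) * (\<integral>\<theta>. cprod n lam \<theta> \<partial>lborel)"
proof -
  have "\<exists>u lam. orthonormal {..<n} n u \<and> (\<forall>a<n. \<forall>i<n. (\<Sum>j<n. M i j * u a j) = lam a * u a i)"
    using symM by (intro symmetric_eigenbasis) (auto simp: sym_on_def)
  then obtain u lam where on: "orthonormal {..<n} n u"
    and eig: "\<And>a i. a < n \<Longrightarrow> i < n \<Longrightarrow> (\<Sum>j<n. M i j * u a j) = lam a * u a i" by blast
  let ?F = "F rn 0" and ?c = "Gamma (real k + 1) / sqrt n"
  have G: "Gamma (real k + 1) > 0" by (rule Gamma_real_pos) simp
  have c: "?c > 0" using n3 G by simp
  have fin: "?F < \<infinity>"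
    using section_fourier(1)[OF on eig] c unfolding g_zero
    by (auto simp: ennreal_mult_less_top)
  have "enn2real (g 0) = ?c * enn2real ?F"
    unfolding g_zero using c by (simp add: enn2real_mult)
  then have "complex_of_real (?c * enn2real ?F) =
     of_real (ellconst n * Gamma ((real n + 1) / 2) ^ n) * (\<integral>\<theta>. cprod n lam \<theta> \<partial>lborel) / (2 * pi)"
    using section_fourier(2)[OF on eig] by simp
  then have "complex_of_real (1 / ?c) * complex_of_real (?c * enn2real ?F) =
     complex_of_real (1 / ?c) * (of_real (ellconst n * Gamma ((real n + 1) / 2) ^ n) * (\<integral>\<theta>. cprod n lam \<theta> \<partial>lborel) / (2 * pi))"
    by (simp only:)
  also have "complex_of_real (1 / ?c) * complex_of_real (?c * enn2real ?F) = complex_of_real (enn2real ?F)"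
  proof -
    have "1 / c * (c * x) = x" if "c > 0" for c x :: real using that by simp
    from this[OF c] show ?thesis unfolding of_real_mult[symmetric] by simp
  qed
  also have "complex_of_real (1 / ?c) * (of_real (ellconst n * Gamma ((real n + 1) / 2) ^ n) * (\<integral>\<theta>. cprod n lam \<theta> \<partial>lborel) / (2 * pi))
    = of_real (sqrt n * ellconst n * Gamma ((real n + 1) / 2) ^ n / (2 * pi * Gamma (real k + 1))) * (\<integral>\<theta>. cprod n lam \<theta> \<partial>lborel)"
    by (simp add: field_simps)
  finally show ?thesis
    using eigen_sums[OF on eig] MI MM fin by (intro exI[of _ lam]) simp
qed

end

section \<open>Central sections\<close>

text \<open>Bessel's inequality for the coordinate vectors, summed over all of them.\<close>

lemma orthonormal_card_le:
  assumes "finite J" "orthonormal J m b"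
  shows "m \<le> card J"
proof -
  have "real m = (\<Sum>p\<in>J. \<Sum>l<m. (b l p)\<^sup>2)" using sum_norms[OF assms] by simp
  also have "\<dots> \<le> (\<Sum>p\<in>J. 1)"
  proof (rule sum_mono)
    fix p assume "p \<in> J"
    from resid_self[OF assms this] show "(\<Sum>l<m. (b l p)\<^sup>2) \<le> 1"
      using ipr_self_nonneg[of J "resid m b p"] by linarith
  qed
  finally show ?thesis by simp
qed

section \<open>From matrices to functions of two indices\<close>

definition entry :: "real Matrix.mat \<Rightarrow> nat \<Rightarrow> nat \<Rightarrow> real" where
  "entry X i j = X $$ (i, j)"

definition to_mat :: "nat \<Rightarrow> (nat \<Rightarrow> nat \<Rightarrow> real) \<Rightarrow> real Matrix.mat" where
  "to_mat n X = Matrix.mat n n (\<lambda>(i, j). X i j)"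

lemma entry_to_mat: "i < n \<Longrightarrow> j < n \<Longrightarrow> entry (to_mat n X) i j = X i j"
  by (simp add: entry_def to_mat_def)

lemma Sym_iff: "X \<in> Sym n \<longleftrightarrow> X \<in> carrier_mat n n \<and> sym_on n (entry X)"
proof
  assume X: "X \<in> Sym n"
  then have "entry X i j = entry X j i" if "i < n" "j < n" for i j
    using that unfolding Sym_def entry_def by (metis (mono_tags, lifting) carrier_matD index_transpose_mat(1) mem_Collect_eq)
  then show "X \<in> carrier_mat n n \<and> sym_on n (entry X)" using X by (simp add: Sym_def sym_on_def)
next
  assume "X \<in> carrier_mat n n \<and> sym_on n (entry X)"
  then show "X \<in> Sym n" unfolding Sym_def sym_on_def entry_def by (auto intro!: eq_matI)
qed

lemma to_mat_Sym: "sym_on n X \<Longrightarrow> to_mat n X \<in> Sym n"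
  unfolding Sym_iff sym_on_def using entry_to_mat[of _ n _ X] by (auto simp: to_mat_def)

lemma tr_fip: "X \<in> Sym n \<Longrightarrow> tr X = fip n (entry X) delta"
  by (auto simp: tr_def fip_delta entry_def Sym_def)

lemma frob_fip:
  assumes "X \<in> Sym n" "Y \<in> Sym n"
  shows "frob X Y = fip n (entry X) (entry Y)"
proof -
  have c: "X \<in> carrier_mat n n" "Y \<in> carrier_mat n n" using assms by (auto simp: Sym_iff)
  have "(X * Y) $$ (i, i) = (\<Sum>j<n. X $$ (i, j) * Y $$ (j, i))" if "i < n" for i
    using c that by (auto simp: scalar_prod_def atLeast0LessThan intro!: sum.cong)
  then have "frob X Y = (\<Sum>i<n. \<Sum>j<n. X $$ (i, j) * Y $$ (j, i))"
    using c by (simp add: frob_def tr_def)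
  also have "\<dots> = fip n (entry X) (entry Y)"
    using assms(2) unfolding fip_def entry_def Sym_iff sym_on_def by (auto intro!: sum.cong simp: entry_def)
  finally show ?thesis .
qed

lemma PSD_iff: "X \<in> PSD n \<longleftrightarrow> X \<in> Sym n \<and> psd n (entry X)"
proof -
  have *: "scalar_prod v (X *\<^sub>v v) = quad n (entry X) (\<lambda>i. v $ i)"
    if "X \<in> Sym n" "v \<in> carrier_vec n" for v
  proof -
    have c: "X \<in> carrier_mat n n" using that by (simp add: Sym_iff)
    have "(X *\<^sub>v v) $ i = (\<Sum>j<n. X $$ (i, j) * v $ j)" if "i < n" for i
      using c \<open>v \<in> carrier_vec n\<close> that by (auto simp: scalar_prod_def atLeast0LessThan intro!: sum.cong)
    then show ?thesis
      using c that by (auto simp: scalar_prod_def atLeast0LessThan quad_def entry_def sum_distrib_left mult.assoc intro!: sum.cong)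
  qed
  show ?thesis
  proof
    assume X: "X \<in> PSD n"
    then have XS: "X \<in> Sym n" by (simp add: PSD_def)
    have "0 \<le> quad n (entry X) w" for w
    proof -
      have "vec n w \<in> carrier_vec n" by simp
      then have "0 \<le> quad n (entry X) (\<lambda>i. vec n w $ i)"
        using X *[OF XS] unfolding PSD_def by auto
      also have "quad n (entry X) (\<lambda>i. vec n w $ i) = quad n (entry X) w" by (simp add: quad_def)
      finally show ?thesis .
    qed
    then show "X \<in> Sym n \<and> psd n (entry X)" using XS by (simp add: psd_def)
  next
    assume "X \<in> Sym n \<and> psd n (entry X)"
    then show "X \<in> PSD n" using * by (auto simp: PSD_def psd_def)
  qed
qed

lemma fip_sum: "fip n (\<lambda>i j. \<Sum>l\<in>A. x l * Y l i j) Z = (\<Sum>l\<in>A. x l * fip n (Y l) Z)"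
  by (induction A rule: infinite_finite_induct) (simp_all add: fip_lin, simp_all add: fip_def)

lemma fip_self_eq_0: "fip n X X = 0 \<Longrightarrow> i < n \<Longrightarrow> j < n \<Longrightarrow> X i j = 0"
proof -
  assume *: "fip n X X = 0" "i < n" "j < n"
  have "(\<Sum>j<n. X i j * X i j) = 0"
    using * unfolding fip_def by (subst (asm) sum_nonneg_eq_0_iff) (auto intro: sum_nonneg)
  then show ?thesis using * by (subst (asm) sum_nonneg_eq_0_iff) auto
qed

locale matrix_section =
  fixes N :: nat and M :: "real Matrix.mat"
  assumes N3: "N \<ge> 3" and M: "M \<in> Sym N" and indep: "lin_indep_of_id N M"
begin

definition D :: "nat \<Rightarrow> nat \<Rightarrow> real" where "D i j = entry M i j - tr M / N * delta i j"

definition M0 :: "nat \<Rightarrow> nat \<Rightarrow> real" where "M0 i j = (1 / sqrt (fip N D D)) * D i j"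

definition A :: "real Matrix.mat set" where
  "A = {X \<in> Sym N. fip N (entry X) delta = 1 \<and> fip N (entry X) M0 = 0}"

abbreviation S :: "real Matrix.mat set" where "S \<equiv> central_section N M"

text \<open>Linear independence enters here: a vanishing traceless part would make \<open>M\<close>
  a multiple of the identity.\<close>

lemma D_pos: "fip N D D > 0"
proof -
  have "fip N D D \<noteq> 0"
  proof
    assume 0: "fip N D D = 0"
    have "1 \<cdot>\<^sub>m M + (- (tr M / N)) \<cdot>\<^sub>m 1\<^sub>m N = 0\<^sub>m N N"
    proof (rule eq_matI)
      fix i j assume "i < dim_row (0\<^sub>m N N :: real Matrix.mat)" "j < dim_col (0\<^sub>m N N :: real Matrix.mat)"
      then have ij: "i < N" "j < N" by auto
      from fip_self_eq_0[OF 0 ij] show "(1 \<cdot>\<^sub>m M + (- (tr M / N)) \<cdot>\<^sub>m 1\<^sub>m N) $$ (i, j) = 0\<^sub>m N N $$ (i, j)"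
        using ij M by (auto simp: D_def entry_def delta_def Sym_def)
    qed (use M in \<open>auto simp: Sym_def\<close>)
    then have "(1::real) = 0" using indep unfolding lin_indep_of_id_def by blast
    then show False by simp
  qed
  moreover have "fip N D D \<ge> 0" by (auto simp: fip_def intro!: sum_nonneg)
  ultimately show ?thesis by simp
qed

lemma sym_M0: "sym_on N M0"
  using M by (auto simp: D_def M0_def sym_on_def delta_def Sym_iff)

lemma M0_delta: "fip N M0 delta = 0"
proof -
  have "fip N D delta = fip N (entry M) delta - tr M / N * fip N delta delta"
    unfolding D_def[abs_def] by (simp only: fip_lin)
  then have "fip N D delta = 0" using N3 by (simp add: fip_delta_delta tr_fip[OF M])
  then show ?thesis unfolding M0_def[abs_def] fip_lin by simp
qed

lemma M0_M0: "fip N M0 M0 = 1"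
proof -
  have "fip N M0 M0 = (1 / sqrt (fip N D D)) * ((1 / sqrt (fip N D D)) * fip N D D)"
    unfolding M0_def[abs_def] fip_lin by (subst fip_commute) (simp only: fip_lin)
  then show ?thesis using D_pos by (simp add: field_simps)
qed

text \<open>On matrices of trace one, subtracting \<open>tr M / N\<close> times the identity from
  \<open>M\<close> turns the affine condition into a homogeneous one.\<close>

lemma S_eq: "S = {X \<in> A. psd N (entry X)}"
proof -
  have "tr (M * X) = tr M / real N \<longleftrightarrow> fip N (entry X) M0 = 0" if X: "X \<in> Sym N" "tr X = 1" for X
  proof -
    have "tr (M * X) = fip N (entry M) (entry X)" using frob_fip[OF M X(1)] by (simp add: frob_def)
    also have "\<dots> = fip N D (entry X) + tr M / N * fip N delta (entry X)"
      unfolding D_def[abs_def] by (simp only: fip_lin)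
    also have "fip N delta (entry X) = 1" using X tr_fip[OF X(1)] by (simp add: fip_commute)
    finally have "tr (M * X) = tr M / real N \<longleftrightarrow> fip N D (entry X) = 0" by simp
    also have "\<dots> \<longleftrightarrow> fip N M0 (entry X) = 0"
      unfolding M0_def[abs_def] fip_lin using D_pos by simp
    finally show ?thesis by (simp add: fip_commute)
  qed
  then show ?thesis
    unfolding central_section_def A_def by (auto simp: PSD_iff tr_fip)
qed

definition centre :: "nat \<Rightarrow> nat \<Rightarrow> real" where "centre i j = (1 / N) * delta i j"

lemma centre_A: "to_mat N centre \<in> A"
proof -
  have "sym_on N centre" by (auto simp: sym_on_def centre_def delta_def)
  moreover have "fip N (entry (to_mat N centre)) Y = (1 / N) * fip N delta Y" for Y
    unfolding fip_scale_left[symmetric] by (intro fip_cong) (auto simp: entry_to_mat centre_def)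
  ultimately show ?thesis
    using N3 M0_delta by (auto simp: A_def to_mat_Sym fip_delta_delta fip_commute[of N delta M0])
qed

lemma affine_A:
  assumes "\<And>l. l \<in> L \<Longrightarrow> X l \<in> A" "(\<Sum>l\<in>L. c l) = 1"
  shows "Matrix.mat N N (\<lambda>ij. \<Sum>l\<in>L. c l * X l $$ ij) \<in> A"
proof -
  define Y where "Y i j = (\<Sum>l\<in>L. c l * entry (X l) i j)" for i j
  have e: "Matrix.mat N N (\<lambda>ij. \<Sum>l\<in>L. c l * X l $$ ij) = to_mat N Y"
    by (auto simp: to_mat_def Y_def entry_def intro!: eq_matI)
  have "sym_on N Y"
    using assms(1) by (auto simp: sym_on_def Y_def A_def Sym_iff intro!: sum.cong)
  moreover have f: "fip N (entry (to_mat N Y)) Z = (\<Sum>l\<in>L. c l * fip N (entry (X l)) Z)" for Z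
    unfolding fip_sum[symmetric] by (intro fip_cong) (auto simp: entry_to_mat Y_def)
  moreover have "(\<Sum>l\<in>L. c l * fip N (entry (X l)) delta) = (\<Sum>l\<in>L. c l)" "(\<Sum>l\<in>L. c l * fip N (entry (X l)) M0) = 0"
    using assms(1) by (auto simp: A_def intro!: sum.cong sum.neutral)
  ultimately show ?thesis unfolding e using assms(2) by (simp add: A_def to_mat_Sym)
qed

text \<open>\<open>I/N\<close> lies in the section and is interior to the cone, so every point of the affine space is an
  affine combination of \<open>I/N\<close> and a nearby point of the section.\<close>

lemma hull_eq: "mat_affine_hull N S = A"
proof
  show "mat_affine_hull N S \<subseteq> A"
  proof
    fix Y assume "Y \<in> mat_affine_hull N S"
    then obtain m c X where "Y = Matrix.mat N N (\<lambda>ij. \<Sum>l<m. c l * X l $$ ij)" "\<forall>l<(m::nat). X l \<in> S" "(\<Sum>l<m. c l) = (1::real)"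
      unfolding mat_affine_hull_def by auto
    then show "Y \<in> A" using affine_A[of "{..<m}" X c] by (auto simp: S_eq)
  qed
  show "A \<subseteq> mat_affine_hull N S"
  proof
    fix X assume X: "X \<in> A"
    define Y where "Y i j = entry X i j - centre i j" for i j
    \<comment> \<open>Chosen so that \<open>\<epsilon>\<close> times the norm of \<open>Y\<close> is
      at most \<open>1 / N\<close>, which keeps \<open>Q\<close> in the cone; the added 1 covers the
      case that \<open>X\<close> is the centre.\<close>
    define \<epsilon> where "\<epsilon> = 1 / (N * (sqrt (fip N Y Y) + 1))"
    have nn: "sqrt (fip N Y Y) + 1 > 0"
      by (intro add_nonneg_pos) (auto simp: fip_def intro!: sum_nonneg)
    have eps: "\<epsilon> > 0" unfolding \<epsilon>_def using nn N3 by simp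
    define X1 where "X1 = (\<lambda>l::nat. if l = 0 then X else to_mat N centre)"
    define c1 where "c1 = (\<lambda>l::nat. if l = 0 then \<epsilon> else 1 - \<epsilon>)"
    define Q where "Q = Matrix.mat N N (\<lambda>ij. \<Sum>l\<in>{..<2}. c1 l * X1 l $$ ij)"
    have sum2: "(\<Sum>l<2. f l) = f 0 + f (Suc 0)" for f :: "nat \<Rightarrow> real" by (simp add: numeral_2_eq_2)
    have QA: "Q \<in> A" unfolding Q_def
      by (rule affine_A) (auto simp: X1_def c1_def X centre_A sum2)
    have Qf: "entry Q i j = (1 / N) * delta i j + \<epsilon> * Y i j" if "i < N" "j < N" for i j
      using that entry_to_mat[OF that, of centre] unfolding Q_def
      by (simp add: entry_def sum2 X1_def c1_def Y_def centre_def algebra_simps)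
    have "psd N (entry Q)"
    proof -
      have "\<epsilon> * sqrt (fip N Y Y) \<le> 1 / N"
      proof -
        have "\<epsilon> * sqrt (fip N Y Y) \<le> \<epsilon> * (sqrt (fip N Y Y) + 1)" using eps by simp
        also have "\<dots> = 1 / N" unfolding \<epsilon>_def using nn N3 by simp
        finally show ?thesis .
      qed
      then have "(\<epsilon> * sqrt (fip N Y Y))\<^sup>2 \<le> (1 / N)\<^sup>2"
      proof (rule power_mono)
        have "fip N Y Y \<ge> 0" by (auto simp: fip_def intro!: sum_nonneg)
        then show "0 \<le> \<epsilon> * sqrt (fip N Y Y)" using eps by simp
      qed
      moreover have "(\<epsilon> * sqrt (fip N Y Y))\<^sup>2 = fip N (\<lambda>i j. \<epsilon> * Y i j) (\<lambda>i j. \<epsilon> * Y i j)"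
      proof -
        have "fip N Y Y \<ge> 0" by (auto simp: fip_def intro!: sum_nonneg)
        then show ?thesis unfolding fip_lin by (subst fip_commute) (simp add: fip_lin power_mult_distrib power2_eq_square)
      qed
      ultimately have "psd N (\<lambda>i j. (1 / N) * delta i j + \<epsilon> * Y i j)"
        by (intro psd_shift_identity) auto
      then show ?thesis by (subst psd_cong[where Y = "\<lambda>i j. (1 / N) * delta i j + \<epsilon> * Y i j"]) (auto simp: Qf)
    qed
    then have QS: "Q \<in> S" using QA by (simp add: S_eq)
    have CS: "to_mat N centre \<in> S"
    proof -
      have "psd N (\<lambda>i j. (1 / N) * delta i j + 0)" by (intro psd_shift_identity) (auto simp: fip_def)
      then have "psd N (entry (to_mat N centre))"
        by (subst psd_cong[where Y = "\<lambda>i j. (1 / N) * delta i j + 0"]) (auto simp: entry_to_mat centre_def)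
      then show ?thesis using centre_A by (simp add: S_eq)
    qed
    define X2 where "X2 = (\<lambda>l::nat. if l = 0 then Q else to_mat N centre)"
    \<comment> \<open>Solves \<open>Q = \<epsilon> X + (1 - \<epsilon>) centre\<close> for
      \<open>X\<close>.\<close>
    define c2 where "c2 = (\<lambda>l::nat. if l = 0 then 1 / \<epsilon> else 1 - 1 / \<epsilon>)"
    have "X = Matrix.mat N N (\<lambda>ij. \<Sum>l<2. c2 l * X2 l $$ ij)"
    proof (rule eq_matI)
      fix i j assume "i < dim_row (Matrix.mat N N (\<lambda>ij. \<Sum>l<2. c2 l * X2 l $$ ij))" "j < dim_col (Matrix.mat N N (\<lambda>ij. \<Sum>l<2. c2 l * X2 l $$ ij))"
      then have ij: "i < N" "j < N" by auto
      have "(\<Sum>l<2. c2 l * X2 l $$ (i, j)) = 1 / \<epsilon> * entry Q i j + (1 - 1 / \<epsilon>) * centre i j"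
        using entry_to_mat[OF ij, of centre] by (simp add: sum2 c2_def X2_def entry_def)
      also have "\<dots> = X $$ (i, j)"
      proof -
        have "1 / e * (c + e * (x - c)) + (1 - 1 / e) * c = x" if "e > 0" for e c x :: real
          using that by (simp add: field_simps)
        from this[OF eps, of "centre i j" "entry X i j"] show ?thesis
          unfolding Qf[OF ij] Y_def by (simp only: centre_def entry_def)
      qed
      finally show "X $$ (i, j) = Matrix.mat N N (\<lambda>ij. \<Sum>l<2. c2 l * X2 l $$ ij) $$ (i, j)" using ij by simp
    qed (use X in \<open>auto simp: A_def Sym_def\<close>)
    moreover have "(\<Sum>l<2. c2 l) = 1" by (simp add: sum2 c2_def)
    moreover have "\<forall>l<2. X2 l \<in> S" using QS CS by (simp add: X2_def)
    ultimately show "X \<in> mat_affine_hull N S"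
      unfolding mat_affine_hull_def by blast
  qed
qed

lemma chart_entry: "i < N \<Longrightarrow> j < N \<Longrightarrow> entry (frob_chart N k P B x) i j = entry P i j + (\<Sum>l<k. x l * entry (B l) i j)"
  by (simp add: frob_chart_def entry_def)

lemma fip_chart: "fip N (entry (frob_chart N k P B x)) Z = fip N (entry P) Z + (\<Sum>l<k. x l * fip N (entry (B l)) Z)"
  unfolding fip_sum[symmetric] fip_add_left[symmetric] by (intro fip_cong) (auto simp: chart_entry)

text \<open>Evaluating the chart at 0 and at each coordinate vector shows that the base point
  satisfies the two linear equations and that the directions satisfy their homogeneous
  versions.\<close>

lemma frame_orthonormal:
  assumes fr: "frob_frame N A k P B"
  shows "orthonormal_frame N k (\<lambda>l. entry (B l)) M0"
proof -
  from fr have P: "P \<in> Sym N" and B: "\<And>l. l < k \<Longrightarrow> B l \<in> Sym N"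
    and on: "\<And>l l'. l < k \<Longrightarrow> l' < k \<Longrightarrow> frob (B l) (B l') = (if l = l' then 1 else 0)"
    and rg: "range (frob_chart N k P B) = A" by (auto simp: frob_frame_def)
  have ch: "frob_chart N k P B x \<in> A" for x using rg by blast
  have PZ: "fip N (entry P) delta = 1" "fip N (entry P) M0 = 0"
    using ch[of "\<lambda>_. 0"] unfolding A_def mem_Collect_eq fip_chart by auto
  have BZ: "fip N (entry (B l)) delta = 0 \<and> fip N (entry (B l)) M0 = 0" if "l < k" for l
  proof -
    have "(\<Sum>l'<k. delta l l' * fip N (entry (B l')) Z) = fip N (entry (B l)) Z" for Z
      using sum_delta[of "{..<k}" l "\<lambda>l'. fip N (entry (B l')) Z"] that
      by (simp add: delta_def mult.commute eq_commute)
    then show ?thesis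
      using ch[of "delta l"] PZ unfolding A_def mem_Collect_eq fip_chart by auto
  qed
  show ?thesis
  proof
    show "fip N (entry (B l)) (entry (B l')) = (if l = l' then 1 else 0)" if "l < k" "l' < k" for l l'
      using on[OF that] frob_fip[OF B B] that by simp
  qed (use N3 B BZ sym_M0 M0_delta M0_M0 in \<open>auto simp: Sym_iff\<close>)
qed

text \<open>If the frame with its two normals were not full, a unit \<open>v\<close> orthogonal to
  all of it would give a point \<open>P + v\<close> of \<open>A\<close> outside the range of the
  chart.\<close>

lemma frame_card:
  assumes fr: "frob_frame N A k P B"
  shows "k + 2 = card (upper N)"
proof -
  interpret orthonormal_frame N k "\<lambda>l. entry (B l)" M0 by (rule frame_orthonormal[OF fr])
  have le: "k + 2 \<le> card (upper N)" by (rule orthonormal_card_le[OF finite_upper orthonormal_frame_vec])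
  show ?thesis
  proof (rule ccontr)
    assume "k + 2 \<noteq> card (upper N)"
    with le have "k + 2 < card (upper N)" by simp
    from orthonormal_extend[OF finite_upper orthonormal_frame_vec this]
    obtain v where v1: "ipr (upper N) v v = 1" and v0: "\<And>l. l < k + 2 \<Longrightarrow> ipr (upper N) (coords (frame_vec l)) v = 0" by blast
    have perp: "fip N (frame_vec l) (symmat v) = 0" if "l < k + 2" for l
      using v0[OF that] fip_coords[OF sym_on_frame_vec sym_on_symmat, of l v] ipr_cong[of "upper N" "coords (frame_vec l)" "coords (frame_vec l)" "coords (symmat v)" v]
      by (simp add: coords_symmat)
    have p1: "fip N (symmat v) delta = 0"
    proof -
      have "rn * fip N delta (symmat v) = 0" using perp[of k] by (simp add: frame_vec_def fip_lin)
      moreover have "rn \<noteq> 0" using rn_sqrt by auto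
      ultimately show ?thesis by (simp add: fip_commute)
    qed
    have p2: "fip N (symmat v) M0 = 0" using perp[of "Suc k"] by (simp add: frame_vec_def fip_commute)
    have p3: "fip N (entry (B l)) (symmat v) = 0" if "l < k" for l using perp[of l] that by (simp add: frame_vec_def)
    have P: "P \<in> A"
    proof -
      have "frob_chart N k P B (\<lambda>_. 0) = P" using fr by (auto simp: frob_frame_def frob_chart_def Sym_def intro!: eq_matI)
      then show ?thesis using fr by (metis frob_frame_def rangeI)
    qed
    define X where "X = to_mat N (\<lambda>i j. entry P i j + symmat v i j)"
    have fX: "fip N (entry X) Z = fip N (entry P) Z + fip N (symmat v) Z" for Z
      unfolding fip_add_left[symmetric] X_def by (intro fip_cong) (auto simp: entry_to_mat)
    have "sym_on N (\<lambda>i j. entry P i j + symmat v i j)"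
      using P sym_on_symmat[of N v] by (auto simp: A_def Sym_iff sym_on_def)
    then have "X \<in> A" using P p1 p2 by (simp add: A_def fX X_def[symmetric]) (simp add: X_def to_mat_Sym)
    then have "X \<in> range (frob_chart N k P B)" using fr by (simp add: frob_frame_def)
    then obtain x where "X = frob_chart N k P B x" by blast
    then have "fip N (entry X) (symmat v) = fip N (entry P) (symmat v) + (\<Sum>l<k. x l * fip N (entry (B l)) (symmat v))"
      by (simp add: fip_chart)
    then have "fip N (symmat v) (symmat v) = 0" using p3 unfolding fX by simp
    then show False using v1 by (simp add: fip_symmat)
  qed
qed

text \<open>Extend the normalised identity and \<open>M0\<close> to an orthonormal basis and drop
  these two; the rest spans the directions of \<open>A\<close>. The choice operator in
  \<open>vol\<close> needs this witness.\<close>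

lemma frame_exists: "\<exists>k P B. frob_frame N A k P B"
proof -
  define r where "r = 1 / sqrt (real N)"
  have r: "r * (r * real N) = 1" using N3 by (simp add: r_def)
  define b0 where "b0 = (\<lambda>l::nat. if l = 0 then coords (\<lambda>i j. r * delta i j) else coords M0)"
  have sr: "sym_on N (\<lambda>i j. r * delta i j)" by (auto simp: sym_on_def delta_def)
  have on2: "orthonormal (upper N) 2 b0"
  proof -
    have "fip N Y (\<lambda>i j. r * delta i j) = r * fip N Y delta" for Y
      by (subst fip_commute) (simp add: fip_lin fip_commute)
    then have "ipr (upper N) (coords (\<lambda>i j. r * delta i j)) (coords (\<lambda>i j. r * delta i j)) = 1"
      "ipr (upper N) (coords (\<lambda>i j. r * delta i j)) (coords M0) = 0" "ipr (upper N) (coords M0) (coords M0) = 1"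
      using r M0_delta M0_M0 by (simp_all add: fip_coords[symmetric] sr sym_M0 fip_lin fip_delta_delta fip_commute[of N delta M0])
    then show ?thesis by (auto simp: orthonormal_def b0_def less_2_cases_iff ipr_commute[of "upper N" "coords M0" "coords (\<lambda>i j. r * delta i j)"])
  qed
  have card2: "2 \<le> card (upper N)" by (rule orthonormal_card_le[OF finite_upper on2])
  from orthonormal_basis_extend[OF finite_upper on2 card2]
  obtain b where b: "\<And>l. l < 2 \<Longrightarrow> b l = b0 l" and on: "orthonormal (upper N) (card (upper N)) b" by blast
  define k where "k = card (upper N) - 2"
  have k: "card (upper N) = k + 2" using card2 by (simp add: k_def)
  define B where "B l = to_mat N (symmat (b (l + 2)))" for l
  have B: "B l \<in> Sym N" for l unfolding B_def by (intro to_mat_Sym sym_on_symmat)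
  have fB: "fip N (entry (B l)) Z = fip N (symmat (b (l + 2))) Z" for l Z
    unfolding B_def by (intro fip_cong) (auto simp: entry_to_mat)
  have bd: "symmat (b 0) i j = r * delta i j" "symmat (b (Suc 0)) i j = M0 i j" if "i < N" "j < N" for i j
    using b[of 0] b[of "Suc 0"] symmat_coords[OF sr that] symmat_coords[OF sym_M0 that] by (simp_all add: b0_def)
  have fbb: "fip N (symmat (b l)) (symmat (b l')) = (if l = l' then 1 else 0)" if "l < k + 2" "l' < k + 2" for l l'
    using on that by (simp add: fip_symmat orthonormal_def k)
  have rne: "r \<noteq> 0" using r by auto
  have fdel: "fip N Z (symmat (b 0)) = r * fip N Z delta" for Z
  proof -
    have "fip N Z (symmat (b 0)) = fip N Z (\<lambda>i j. r * delta i j)" by (intro fip_cong) (auto simp: bd)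
    then show ?thesis by (subst (asm) (2) fip_commute) (simp add: fip_lin fip_commute)
  qed
  have fM0: "fip N Z (symmat (b (Suc 0))) = fip N Z M0" for Z by (intro fip_cong) (auto simp: bd)
  have Bdel: "fip N (entry (B l)) delta = 0" if "l < k" for l
    using fbb[of "l + 2" 0] that rne unfolding fB fdel by simp
  have BM0: "fip N (entry (B l)) M0 = 0" if "l < k" for l
    using fbb[of "l + 2" "Suc 0"] that unfolding fB fM0 by simp
  define P where "P = to_mat N centre"
  have PA: "P \<in> A" unfolding P_def by (rule centre_A)
  have "range (frob_chart N k P B) = A"
  proof
    show "range (frob_chart N k P B) \<subseteq> A"
    proof
      fix X assume "X \<in> range (frob_chart N k P B)"
      then obtain x where X: "X = frob_chart N k P B x" by blast
      have "sym_on N (entry X)"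
        unfolding sym_on_def X using PA B by (auto simp: chart_entry A_def Sym_iff sym_on_def)
      then have "X \<in> Sym N" by (simp add: Sym_iff X frob_chart_def)
      moreover have "fip N (entry X) delta = 1" "fip N (entry X) M0 = 0"
        unfolding X fip_chart using PA Bdel BM0 by (auto simp: A_def)
      ultimately show "X \<in> A" by (simp add: A_def)
    qed
    show "A \<subseteq> range (frob_chart N k P B)"
    proof
      fix X assume X: "X \<in> A"
      define Y where "Y i j = entry X i j - centre i j" for i j
      have sY: "sym_on N Y" using X by (auto simp: Y_def sym_on_def A_def Sym_iff centre_def delta_def)
      have fY: "fip N Y Z = fip N (entry X) Z - fip N (entry P) Z" for Z
        unfolding fip_diff_left[symmetric] by (intro fip_cong) (auto simp: Y_def P_def entry_to_mat)
      define y where "y l = ipr (upper N) (coords Y) (b l)" for l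
      have yl: "y l = fip N Y (symmat (b l))" for l
        unfolding y_def by (subst fip_coords[OF sY]) (auto intro!: ipr_cong simp: coords_symmat)
      have y0: "y 0 = 0" "y (Suc 0) = 0"
        using X PA unfolding yl fdel fM0 fY by (auto simp: A_def)
      have exp: "coords Y q = (\<Sum>l<k + 2. y l * b l q)" if q: "q \<in> upper N" for q
      proof -
        have "(\<Sum>l<k + 2. y l * b l q) = (\<Sum>l<k + 2. \<Sum>p\<in>upper N. coords Y p * (b l p * b l q))"
          by (simp add: y_def ipr_def sum_distrib_right mult.assoc)
        also have "\<dots> = (\<Sum>p\<in>upper N. coords Y p * (\<Sum>l<k + 2. b l p * b l q))"
          by (subst sum.swap) (simp only: sum_distrib_left)
        also have "\<dots> = (\<Sum>p\<in>upper N. coords Y p * delta q p)"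
          using orthonormal_complete[OF finite_upper on refl _ q] by (intro sum.cong refl) (auto simp: k delta_def)
        also have "\<dots> = (\<Sum>p\<in>upper N. coords Y p * delta p q)" by (simp add: delta_def eq_commute)
        also have "\<dots> = coords Y q" by (rule sum_delta) (use q in auto)
        finally show ?thesis ..
      qed
      have "frob_chart N k P B (\<lambda>l. y (l + 2)) = X"
      proof (rule eq_matI)
        fix i j assume "i < dim_row X" "j < dim_col X"
        then have ij: "i < N" "j < N" using X by (auto simp: A_def Sym_def)
        have "Y i j = symmat (coords Y) i j" using symmat_coords[OF sY ij] by simp
        also have "\<dots> = symmat (\<lambda>q. \<Sum>l<k + 2. y l * b l q) i j" using exp ij by (intro symmat_cong[of N]) auto
        also have "\<dots> = (\<Sum>l<k + 2. y l * symmat (b l) i j)" by (rule symmat_sum)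
        also have "(\<Sum>l<k + 2. y l * symmat (b l) i j) = (\<Sum>l<Suc (Suc k). y l * symmat (b l) i j)" by simp
        also have "\<dots> = (\<Sum>l<k. y (l + 2) * symmat (b (l + 2)) i j)"
          by (simp only: sum.lessThan_Suc_shift y0 o_def) simp
        finally have "Y i j = (\<Sum>l<k. y (l + 2) * entry (B l) i j)"
          using ij by (simp add: B_def entry_to_mat)
        moreover have "entry (frob_chart N k P B (\<lambda>l. y (l + 2))) i j = centre i j + (\<Sum>l<k. y (l + 2) * entry (B l) i j)"
          using ij by (simp add: chart_entry P_def entry_to_mat)
        ultimately show "frob_chart N k P B (\<lambda>l. y (l + 2)) $$ (i, j) = X $$ (i, j)"
          by (simp add: Y_def entry_def)
      qed (use X in \<open>auto simp: A_def Sym_def frob_chart_def\<close>)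
      then show "X \<in> range (frob_chart N k P B)" by blast
    qed
  qed
  moreover have "frob (B l) (B l') = (if l = l' then 1 else 0)" if "l < k" "l' < k" for l l'
  proof -
    have "frob (B l) (B l') = fip N (symmat (b (l + 2))) (symmat (b (l' + 2)))"
      unfolding frob_fip[OF B B] fB by (subst (1 2) fip_commute) (rule fB)
    then show ?thesis using fbb[of "l + 2" "l' + 2"] that by simp
  qed
  ultimately have "frob_frame N A k P B"
    using PA B by (simp add: frob_frame_def A_def)
  then show ?thesis by blast
qed

text \<open>Proved for every frame, because nothing is known about the one that \<open>vol\<close>
  selects.\<close>

lemma measure_frame:
  assumes fr: "frob_frame N A k P B"
  shows "\<exists>lam. (\<Sum>a<N. lam a) = 0 \<and> (\<Sum>a<N. (lam a)\<^sup>2) = 1 \<and>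
    complex_of_real (measure (lborelP {..<k}) {x \<in> {..<k} \<rightarrow>\<^sub>E UNIV. frob_chart N k P B x \<in> S}) =
      of_real (sqrt N * ellconst N * Gamma ((real N + 1) / 2) ^ N / (2 * pi * Gamma (real k + 1))) * (\<integral>\<theta>. cprod N lam \<theta> \<partial>lborel)"
proof -
  interpret orthonormal_frame N k "\<lambda>l. entry (B l)" M0 by (rule frame_orthonormal[OF fr])
  interpret section_frame N k "\<lambda>l. entry (B l)" M0 by standard (rule frame_card[OF fr])
  let ?T = "{x \<in> {..<k} \<rightarrow>\<^sub>E UNIV. frob_chart N k P B x \<in> S}"
  have ch: "frob_chart N k P B x \<in> A" for x using fr by (auto simp: frob_frame_def)
  have "to_mat N centre \<in> range (frob_chart N k P B)" using centre_A fr by (simp add: frob_frame_def)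
  \<comment> \<open>The base point \<open>P\<close> of the chart need not be the centre; translating
    the coordinates by \<open>x0\<close> moves the origin there without changing the
    measure.\<close>
  then obtain x0 where x0: "frob_chart N k P B x0 = to_mat N centre" by (metis rangeE)
  have rr: "rn * rn = 1 / N" using N3 by (simp add: rn_def)
  have in_S: "frob_chart N k P B x \<in> S \<longleftrightarrow> psd N (slice_pt (\<lambda>l\<in>{..<k}. x l + (- x0 l)) rn 0)" for x
  proof -
    have "psd N (entry (frob_chart N k P B x)) \<longleftrightarrow> psd N (slice_pt (\<lambda>l\<in>{..<k}. x l + (- x0 l)) rn 0)"
    proof (rule psd_cong)
      fix i j assume ij: "i < N" "j < N"
      have "entry P i j + (\<Sum>l<k. x0 l * entry (B l) i j) = (1 / N) * delta i j"
        using chart_entry[OF ij, of k P B x0] entry_to_mat[OF ij, of centre] unfolding x0 centre_def by simp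
      moreover have "slice_pt (\<lambda>l\<in>{..<k}. x l + (- x0 l)) rn 0 i j =
        (\<Sum>l<k. x l * entry (B l) i j) - (\<Sum>l<k. x0 l * entry (B l) i j) + (rn * rn) * delta i j"
        by (simp add: slice_pt_def left_diff_distrib sum_subtractf)
      ultimately show "entry (frob_chart N k P B x) i j = slice_pt (\<lambda>l\<in>{..<k}. x l + (- x0 l)) rn 0 i j"
        unfolding chart_entry[OF ij] rr by simp
    qed
    then show ?thesis using ch[of x] by (simp add: S_eq)
  qed
  have meas: "(\<lambda>x. psd_ind N (slice_pt x rn 0)) \<in> borel_measurable (lborelP {..<k})"
    by (rule measurable_slice_pt) auto
  have ind: "indicator ?T x = psd_ind N (slice_pt (\<lambda>l\<in>{..<k}. x l + (- x0 l)) rn 0)" if "x \<in> space (lborelP {..<k})" for x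
    using that in_S[of x] by (simp add: indicator_def psd_ind_def space_PiM)
  have T: "?T \<in> sets (lborelP {..<k})"
  proof -
    have "(\<lambda>x. \<lambda>l\<in>{..<k}. x l + (- x0 l)) \<in> measurable (lborelP {..<k}) (lborelP {..<k})"
      by (rule measurable_lborelP_restrict) (auto intro!: borel_measurable_add measurable_lborelP_component)
    from measurable_compose[OF this meas]
    have "(\<lambda>x. psd_ind N (slice_pt (\<lambda>l\<in>{..<k}. x l + (- x0 l)) rn 0)) \<in> borel_measurable (lborelP {..<k})" .
    then have "(indicator ?T :: _ \<Rightarrow> ennreal) \<in> borel_measurable (lborelP {..<k})"
      by (subst measurable_cong[OF ind])
    then have "?T \<inter> space (lborelP {..<k}) \<in> sets (lborelP {..<k})"
      by (simp add: borel_measurable_indicator_iff)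
    moreover have "?T \<inter> space (lborelP {..<k}) = ?T" by (auto simp: space_PiM)
    ultimately show ?thesis by simp
  qed
  have "emeasure (lborelP {..<k}) ?T = (\<integral>\<^sup>+x. indicator ?T x \<partial>lborelP {..<k})" using T by simp
  also have "\<dots> = (\<integral>\<^sup>+x. psd_ind N (slice_pt (\<lambda>l\<in>{..<k}. x l + (- x0 l)) rn 0) \<partial>lborelP {..<k})"
    by (rule nn_integral_cong) (rule ind)
  also have "\<dots> = F rn 0"
    unfolding F_def by (rule nn_integral_lborelP_translate[OF _ meas]) simp
  finally have "measure (lborelP {..<k}) ?T = enn2real (F rn 0)" by (simp add: measure_def)
  then show ?thesis using section_volume by auto
qed

lemma vol_eq:
  "\<exists>k lam. k + 2 = card (upper N) \<and> (\<Sum>a<N. lam a) = 0 \<and> (\<Sum>a<N. (lam a)\<^sup>2) = 1 \<and>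
    complex_of_real (vol N S) =
      of_real (sqrt N * ellconst N * Gamma ((real N + 1) / 2) ^ N / (2 * pi * Gamma (real k + 1))) * (\<integral>\<theta>. cprod N lam \<theta> \<partial>lborel)"
proof -
  define w where "w = (SOME (k, P, B). frob_frame N (mat_affine_hull N S) k P B)"
  obtain k P B where kPB: "w = (k, P, B)" by (cases w) auto
  have "\<exists>w. case w of (k, P, B) \<Rightarrow> frob_frame N (mat_affine_hull N S) k P B"
    using frame_exists unfolding hull_eq by auto
  then have "case w of (k, P, B) \<Rightarrow> frob_frame N (mat_affine_hull N S) k P B"
    unfolding w_def by (rule someI_ex)
  then have fr: "frob_frame N A k P B" by (simp add: kPB hull_eq)
  have veq: "vol N S = measure (lborelP {..<k}) {x \<in> {..<k} \<rightarrow>\<^sub>E UNIV. frob_chart N k P B x \<in> S}"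
    unfolding vol_def w_def[symmetric] kPB by simp
  show ?thesis unfolding veq using measure_frame[OF fr] frame_card[OF fr] by blast
qed

end

section \<open>The uniform asymptotic formula\<close>

lemma multi_Gamma_reindex:
  "multi_Gamma n ((real n + 1) / 2) = pi powr (real n * (real n - 1) / 4) * (\<Prod>i<n. Gamma (real i / 2 + 1))"
proof -
  have "(\<Prod>j=1..n. Gamma ((real n + 1) / 2 + (1 - real j) / 2)) = (\<Prod>i<n. Gamma (real i / 2 + 1))"
  proof (rule prod.reindex_bij_witness[of _ "\<lambda>i. n - i" "\<lambda>j. n - j"])
    fix j assume "j \<in> {1..n}"
    then have "real (n - j) = real n - real j" by (simp add: of_nat_diff)
    then have "real (n - j) / 2 + 1 = (real n + 1) / 2 + (1 - real j) / 2" by (simp add: field_simps)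
    then show "Gamma (real (n - j) / 2 + 1) = Gamma ((real n + 1) / 2 + (1 - real j) / 2)" by (simp only:)
  qed auto
  then show ?thesis by (simp only: multi_Gamma_def)
qed

text \<open>In the step to \<open>Suc n\<close> the old factors \<open>?g ^ n\<close> and the
  denominators \<open>?h ^ n\<close> cancel, leaving one new factor \<open>?h\<close> and
  \<open>2 * pi\<close> to the power \<open>n / 2\<close>.\<close>

lemma ellconst_closed_form:
  "ellconst n * Gamma ((real n + 1) / 2) ^ n = (2 * pi) powr (real n * (real n - 1) / 4) * (\<Prod>i<n. Gamma (real i / 2 + 1))"
proof (induction n)
  case (Suc n)
  let ?g = "Gamma ((real n + 1) / 2)" and ?h = "Gamma (real n / 2 + 1)"
  have h: "?h > 0" by (intro Gamma_real_pos) (simp add: add_nonneg_pos)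
  have e: "(real (Suc n) + 1) / 2 = real n / 2 + 1" by (simp add: field_simps)
  have "ellconst (Suc n) * Gamma ((real (Suc n) + 1) / 2) ^ Suc n = ellconst n * (sqrt 2 * (sqrt pi * ?g / ?h)) ^ n * (?h ^ n * ?h)"
    unfolding e ellconst.simps by (simp add: mult.commute)
  also have "\<dots> = (ellconst n * ?g ^ n) * (sqrt 2 * sqrt pi) ^ n * ?h"
    using h by (simp add: power_mult_distrib power_divide)
  also have "(sqrt 2 * sqrt pi) ^ n = (2 * pi) powr (real n / 2)"
  proof -
    have "sqrt 2 * sqrt pi = (2 * pi) powr (1 / 2)" by (simp add: powr_half_sqrt real_sqrt_mult)
    then have "(sqrt 2 * sqrt pi) ^ n = ((2 * pi) powr (1 / 2)) powr real n" by (simp add: powr_realpow)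
    then show ?thesis by (simp add: powr_powr)
  qed
  also have "(ellconst n * ?g ^ n) * (2 * pi) powr (real n / 2) * ?h =
      ((2 * pi) powr (real n * (real n - 1) / 4) * (2 * pi) powr (real n / 2)) * (\<Prod>i<Suc n. Gamma (real i / 2 + 1))"
    unfolding Suc.IH by simp
  also have "(2 * pi) powr (real n * (real n - 1) / 4) * (2 * pi) powr (real n / 2) = (2 * pi) powr (real (Suc n) * (real (Suc n) - 1) / 4)"
    unfolding powr_add[symmetric] by (simp add: field_simps)
  finally show ?case .
qed simp

text \<open>Splitting the power of \<open>2 * pi\<close> leaves its \<open>pi\<close> part to the
  multivariate gamma function, and its power of 2 is exactly the Frobenius density.\<close>

lemma ellconst_multi_Gamma:
  "ellconst n * Gamma ((real n + 1) / 2) ^ n = frob_density n * multi_Gamma n ((real n + 1) / 2)"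
  by (simp add: ellconst_closed_form multi_Gamma_reindex frob_density_def powr_mult)

lemma multi_Gamma_pos: "multi_Gamma n ((real n + 1) / 2) > 0"
  unfolding multi_Gamma_reindex by (intro mult_pos_pos prod_pos) (auto intro!: Gamma_real_pos add_nonneg_pos)

lemma exp_phi:
  assumes "n \<ge> 1"
  shows "exp (phi n ((1 / real n) \<cdot>\<^sub>m 1\<^sub>m n)) =
    (2 * exp 1 / (real n * (real n + 1))) powr (real n * (real n + 1) / 2) * multi_Gamma n ((real n + 1) / 2)"
proof -
  let ?d = "real n * (real n + 1) / 2"
  have n: "real n > 0" using assms by simp
  have "Determinant.det ((1 / real n) \<cdot>\<^sub>m 1\<^sub>m n) = (1 / real n) ^ n"
    by (simp add: det_smult)
  then have "ln (Determinant.det ((1 / real n) \<cdot>\<^sub>m 1\<^sub>m n)) = real n * ln (1 / real n)"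
    using n by (simp add: ln_realpow)
  then have "phi n ((1 / real n) \<cdot>\<^sub>m 1\<^sub>m n) =
      ln (multi_Gamma n ((real n + 1) / 2)) + ?d * (ln (1 / real n) - ln ((real n + 1) / (2 * exp 1)))"
    unfolding phi_def by (simp add: field_simps)
  also have "ln (1 / real n) - ln ((real n + 1) / (2 * exp 1)) = ln ((1 / real n) / ((real n + 1) / (2 * exp 1)))"
    using n by (subst ln_div) auto
  also have "(1 / real n) / ((real n + 1) / (2 * exp 1)) = 2 * exp 1 / (real n * (real n + 1))" by simp
  finally show ?thesis
    using n multi_Gamma_pos[of n] by (simp add: exp_add powr_def)
qed

definition approx_vol :: "nat \<Rightarrow> real" where
  "approx_vol n = frob_density n * ((real n)\<^sup>2 * (real n + 1) / (4 * pi) * exp (phi n ((1 / real n) \<cdot>\<^sub>m 1\<^sub>m n)))"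

definition sym_dim :: "nat \<Rightarrow> nat" where "sym_dim n = card (upper n)"

lemma sym_dim: "real (sym_dim n) = real n * (real n + 1) / 2"
  by (simp add: sym_dim_def card_upper)

definition stirling_ratio :: "nat \<Rightarrow> real" where
  "stirling_ratio d = fact d / (sqrt (2 * pi * real d) * (real d / exp 1) ^ d)"

text \<open>What remains of the ratio of the volume to its approximation besides the inversion integral.\<close>

definition corr_factor :: "nat \<Rightarrow> real" where
  "corr_factor n = sqrt (real n) * (4 * sqrt pi) * (real (sym_dim n) * (real (sym_dim n) - 1)) /
    (sqrt (real n + 1) * (real n)\<^sup>2 * (real n + 1) * sqrt (2 * pi * real (sym_dim n))) / stirling_ratio (sym_dim n)"

lemma approx_vol_pos: "n \<ge> 1 \<Longrightarrow> approx_vol n > 0"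
  by (simp add: approx_vol_def frob_density_def)

lemma approx_vol_eq:
  assumes "n \<ge> 1"
  shows "approx_vol n = ellconst n * Gamma ((real n + 1) / 2) ^ n * ((real n)\<^sup>2 * (real n + 1) / (4 * pi)) / (real (sym_dim n) / exp 1) ^ sym_dim n"
proof -
  have d: "real (sym_dim n) > 0" using assms unfolding sym_dim by simp
  have "2 * exp 1 / (real n * (real n + 1)) = inverse (real (sym_dim n) / exp 1)"
    unfolding sym_dim by (simp add: field_simps)
  then have "(2 * exp 1 / (real n * (real n + 1))) powr (real n * (real n + 1) / 2) = inverse ((real (sym_dim n) / exp 1) ^ sym_dim n)"
    unfolding sym_dim[symmetric] using d by (simp add: powr_realpow power_divide)
  then show ?thesis
    unfolding approx_vol_def exp_phi[OF assms] ellconst_multi_Gamma by (simp add: field_simps)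
qed

lemma corr_factor_tendsto: "corr_factor \<longlonglongrightarrow> 1"
proof -
  have "filterlim (\<lambda>n. real (sym_dim n)) at_top sequentially" unfolding sym_dim by real_asymp
  then have "filterlim sym_dim at_top sequentially" by (simp add: filterlim_sequentially_iff_filterlim_real)
  from filterlim_compose[OF stirling this] have "(\<lambda>n. stirling_ratio (sym_dim n)) \<longlonglongrightarrow> 1"
    unfolding stirling_ratio_def .
  moreover have "(\<lambda>n. sqrt (real n) * (4 * sqrt pi) * (real (sym_dim n) * (real (sym_dim n) - 1)) /
    (sqrt (real n + 1) * (real n)\<^sup>2 * (real n + 1) * sqrt (2 * pi * real (sym_dim n)))) \<longlonglongrightarrow> 1"
  proof -
    \<comment> \<open>The factors \<open>sqrt pi\<close> cancel beforehand, so this limit concerns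
      only powers of \<open>n\<close>.\<close>
    have "(\<lambda>n. sqrt (real n) * 4 * (real n * (real n + 1) / 2 * (real n * (real n + 1) / 2 - 1)) /
      (sqrt (real n + 1) * (real n)\<^sup>2 * (real n + 1) * sqrt (real n * (real n + 1)))) \<longlonglongrightarrow> 1"
      by real_asymp
    moreover have "sqrt (2 * pi * (real n * (real n + 1) / 2)) = sqrt pi * sqrt (real n * (real n + 1))" for n
      by (simp add: real_sqrt_mult)
    ultimately show ?thesis unfolding sym_dim by (simp add: mult_ac)
  qed
  ultimately show ?thesis unfolding corr_factor_def using tendsto_divide by fastforce
qed

text \<open>Splits the ratio into the rescaled inversion integral, the only part that sees the
  spectrum, and a factor depending on \<open>N\<close> alone.\<close>

lemma ratio_eq:
  assumes "matrix_section N M"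
  shows "\<exists>lam. (\<Sum>a<N. lam a) = 0 \<and> (\<Sum>a<N. (lam a)\<^sup>2) = 1 \<and>
    vol N (central_section N M) / approx_vol N =
      Re (of_real (sqrt (real N + 1)) * (\<integral>\<theta>. cprod N lam \<theta> \<partial>lborel)) / (2 * sqrt pi) * corr_factor N"
proof -
  interpret matrix_section N M by fact
  from vol_eq obtain k lam where k: "k + 2 = card (upper N)" and lam: "(\<Sum>a<N. lam a) = 0" "(\<Sum>a<N. (lam a)\<^sup>2) = 1"
    and v: "complex_of_real (vol N S) =
      of_real (sqrt N * ellconst N * Gamma ((real N + 1) / 2) ^ N / (2 * pi * Gamma (real k + 1))) * (\<integral>\<theta>. cprod N lam \<theta> \<partial>lborel)"
    by blast
  define I where "I = Re (\<integral>\<theta>. cprod N lam \<theta> \<partial>lborel)"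
  define C where "C = ellconst N * Gamma ((real N + 1) / 2) ^ N"
  have C: "C > 0" unfolding C_def using ellconst_pos[of N] by (simp add: Gamma_real_pos)
  define d where "d = sym_dim N"
  have d: "d = Suc (Suc k)" using k by (simp add: d_def sym_dim_def)
  have "vol N S = Re (complex_of_real (vol N S))" by simp
  also have "\<dots> = sqrt N * C / (2 * pi * Gamma (real k + 1)) * I"
    unfolding v by (simp add: I_def C_def mult.assoc del: of_real_mult of_real_divide of_real_power)
  also have "Gamma (real k + 1) = fact k" by (simp add: Gamma_fact add.commute)
  finally have vS: "vol N S = sqrt N * C / (2 * pi * fact k) * I" .
  define E where "E = (real d / exp 1) ^ d"
  have E: "E > 0" unfolding E_def using d by simp
  have aS: "approx_vol N = C * ((real N)\<^sup>2 * (real N + 1) / (4 * pi)) / E"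
    unfolding E_def d_def C_def by (rule approx_vol_eq) (use N3 in simp)
  \<comment> \<open>The volume involves \<open>fact (d - 2)\<close>; this brings in
    \<open>fact d\<close>, for which Stirling's formula is stated.\<close>
  have fd: "(fact d :: real) = real d * (real d - 1) * fact k"
    unfolding d by (simp add: algebra_simps)
  have st: "stirling_ratio d = fact d / (sqrt (2 * pi * real d) * E)" by (simp add: stirling_ratio_def E_def)
  have pos: "sqrt (2 * pi * real d) > 0" "real d > 0" "real d - 1 > 0" "(fact k :: real) > 0" "sqrt (real N + 1) > 0" "sqrt pi > 0"
    "real N > 0"
    using d N3 by auto
  have cr: "corr_factor N = sqrt N * (4 * sqrt pi) * E / (sqrt (real N + 1) * (real N)\<^sup>2 * (real N + 1) * fact k)"
    unfolding corr_factor_def d_def[symmetric] st fd using pos E by (simp add: divide_simps)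
  have "vol N S / approx_vol N = sqrt N * 4 * E * I / (2 * fact k * ((real N)\<^sup>2 * (real N + 1)))"
    unfolding vS aS using C E pos by (simp add: divide_simps)
  also have "\<dots> = sqrt (real N + 1) * I / (2 * sqrt pi) * corr_factor N"
    unfolding cr using pos by (simp add: divide_simps)
  also have "sqrt (real N + 1) * I = Re (of_real (sqrt (real N + 1)) * (\<integral>\<theta>. cprod N lam \<theta> \<partial>lborel))"
    by (simp add: I_def)
  finally show ?thesis using lam by blast
qed

text \<open>A failure for some \<open>\<epsilon>\<close> gives sizes tending to infinity with
  spectra whose ratios stay \<open>\<epsilon>\<close> away from 1, against the limit along
  sequences.\<close>

theorem uniform_approximation:
  assumes "\<epsilon> > 0"
  shows "\<exists>N0. \<forall>N\<ge>N0. \<forall>M\<in>Sym N. lin_indep_of_id N M \<longrightarrow> \<bar>vol N (central_section N M) / approx_vol N - 1\<bar> \<le> \<epsilon>"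
proof (rule ccontr)
  assume no: "\<not> ?thesis"
  have "\<exists>N M lam. N \<ge> 3 \<and> N \<ge> k \<and> (\<Sum>a<N. lam a) = 0 \<and> (\<Sum>a<N. (lam a)\<^sup>2) = (1::real) \<and>
    \<bar>Re (of_real (sqrt (real N + 1)) * (\<integral>\<theta>. cprod N lam \<theta> \<partial>lborel)) / (2 * sqrt pi) * corr_factor N - 1\<bar> > \<epsilon>" for k
  proof -
    from no have "\<forall>N0. \<exists>N\<ge>N0. \<exists>M\<in>Sym N. lin_indep_of_id N M \<and> \<bar>vol N (central_section N M) / approx_vol N - 1\<bar> > \<epsilon>"
      by (meson not_le)
    then obtain N M where N: "N \<ge> max 3 k" and M: "M \<in> Sym N" "lin_indep_of_id N M"
      and bad: "\<bar>vol N (central_section N M) / approx_vol N - 1\<bar> > \<epsilon>" by blast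
    have "matrix_section N M" by standard (use N M in auto)
    from ratio_eq[OF this] bad N show ?thesis by (metis max.bounded_iff)
  qed
  \<comment> \<open>Size and spectrum are packed into a pair so that one choice yields the
    sequence.\<close>
  then have "\<forall>k. \<exists>p. fst p \<ge> 3 \<and> fst p \<ge> k \<and> (\<Sum>a<fst p. snd p a) = 0 \<and> (\<Sum>a<fst p. (snd p a)\<^sup>2) = (1::real) \<and>
    \<bar>Re (of_real (sqrt (real (fst p) + 1)) * (\<integral>\<theta>. cprod (fst p) (snd p) \<theta> \<partial>lborel)) / (2 * sqrt pi) * corr_factor (fst p) - 1\<bar> > \<epsilon>"
    by (metis fst_conv snd_conv)
  then obtain p where p: "\<And>k. fst (p k) \<ge> 3" "\<And>k. fst (p k) \<ge> k" "\<And>k. (\<Sum>a<fst (p k). snd (p k) a) = 0"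
      "\<And>k. (\<Sum>a<fst (p k). (snd (p k) a)\<^sup>2) = (1::real)"
    and bad: "\<And>k. \<bar>Re (of_real (sqrt (real (fst (p k)) + 1)) * (\<integral>\<theta>. cprod (fst (p k)) (snd (p k)) \<theta> \<partial>lborel)) / (2 * sqrt pi) * corr_factor (fst (p k)) - 1\<bar> > \<epsilon>"
    by metis
  have N: "filterlim (\<lambda>k. fst (p k)) at_top sequentially"
    using p(2) by (intro filterlim_at_top_mono[OF filterlim_ident]) (auto intro: always_eventually)
  have "(\<lambda>k. Re (of_real (sqrt (real (fst (p k)) + 1)) * (\<integral>\<theta>. cprod (fst (p k)) (snd (p k)) \<theta> \<partial>lborel)) / (2 * sqrt pi) * corr_factor (fst (p k)))
    \<longlonglongrightarrow> Re (complex_of_real (2 * sqrt pi)) / (2 * sqrt pi) * 1"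
    by (intro tendsto_mult tendsto_divide tendsto_const tendsto_Re cprod_integral_tendsto[OF N p(3,4,1)]
        filterlim_compose[OF corr_factor_tendsto N]) simp
  then have "(\<lambda>k. Re (of_real (sqrt (real (fst (p k)) + 1)) * (\<integral>\<theta>. cprod (fst (p k)) (snd (p k)) \<theta> \<partial>lborel)) / (2 * sqrt pi) * corr_factor (fst (p k))) \<longlonglongrightarrow> 1"
    by simp
  from LIMSEQ_D[OF this assms] obtain k where
    "norm (Re (of_real (sqrt (real (fst (p k)) + 1)) * (\<integral>\<theta>. cprod (fst (p k)) (snd (p k)) \<theta> \<partial>lborel)) / (2 * sqrt pi) * corr_factor (fst (p k)) - 1) < \<epsilon>"
    by blast
  then show False using bad[of k] by simp
qed

theorem corollary2p5:
  shows "(\<forall>\<epsilon>::real. 0 < \<epsilon> \<and> \<epsilon> < exp (- 1) \<longrightarrow>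
            (\<exists>N\<^sub>\<epsilon>::nat. \<forall>N\<ge>N\<^sub>\<epsilon>. \<forall>M\<in>Sym N. lin_indep_of_id N M \<longrightarrow>
               approximates_within \<epsilon>
                 (frob_density N *
                   ((real N)\<^sup>2 * (real N + 1) / (4 * pi) * exp (phi N ((1 / real N) \<cdot>\<^sub>m 1\<^sub>m N))))
                 (vol N (central_section N M))))
       \<and> (\<forall>N\<ge>1.
            (real N)\<^sup>2 * (real N + 1) / (4 * pi) * exp (phi N ((1 / real N) \<cdot>\<^sub>m 1\<^sub>m N))
            = (real N)\<^sup>2 * (real N + 1) / (4 * pi)
                * (2 * exp 1 / (real N * (real N + 1))) powr (real N * (real N + 1) / 2)
                * multi_Gamma N ((real N + 1) / 2))
       \<and> (\<forall>(n :: nat \<Rightarrow> nat) (M :: nat \<Rightarrow> real Matrix.mat).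
            strict_mono n \<and> (\<forall>k. M k \<in> Sym (n k) \<and> lin_indep_of_id (n k) (M k)) \<longrightarrow>
            (\<lambda>k. vol (n k) (central_section (n k) (M k)))
              \<sim>[sequentially]
            (\<lambda>k. frob_density (n k) *
                   ((real (n k))\<^sup>2 * (real (n k) + 1) / (4 * pi)
                     * exp (phi (n k) ((1 / real (n k)) \<cdot>\<^sub>m 1\<^sub>m (n k))))))"
  unfolding approx_vol_def[symmetric]
proof (intro conjI allI impI)
  fix \<epsilon> :: real assume "0 < \<epsilon> \<and> \<epsilon> < exp (- 1)"
  then obtain N0 where N0: "\<forall>N\<ge>N0. \<forall>M\<in>Sym N. lin_indep_of_id N M \<longrightarrow> \<bar>vol N (central_section N M) / approx_vol N - 1\<bar> \<le> \<epsilon>"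
    using uniform_approximation by blast
  show "\<exists>N\<^sub>\<epsilon>. \<forall>N\<ge>N\<^sub>\<epsilon>. \<forall>M\<in>Sym N. lin_indep_of_id N M \<longrightarrow> approximates_within \<epsilon> (approx_vol N) (vol N (central_section N M))"
    unfolding approximates_within_def using N0 approx_vol_pos by (intro exI[of _ "max 1 N0"]) auto
next
  fix N :: nat assume "N \<ge> 1"
  then show "(real N)\<^sup>2 * (real N + 1) / (4 * pi) * exp (phi N ((1 / real N) \<cdot>\<^sub>m 1\<^sub>m N))
            = (real N)\<^sup>2 * (real N + 1) / (4 * pi)
                * (2 * exp 1 / (real N * (real N + 1))) powr (real N * (real N + 1) / 2)
                * multi_Gamma N ((real N + 1) / 2)"
    by (simp only: exp_phi mult.assoc)
next
  fix n :: "nat \<Rightarrow> nat" and M :: "nat \<Rightarrow> real Matrix.mat"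
  assume nM: "strict_mono n \<and> (\<forall>k. M k \<in> Sym (n k) \<and> lin_indep_of_id (n k) (M k))"
  then have lim: "filterlim n at_top sequentially" by (simp add: filterlim_subseq)
  show "(\<lambda>k. vol (n k) (central_section (n k) (M k))) \<sim>[sequentially] (\<lambda>k. approx_vol (n k))"
  proof (rule asymp_equivI', rule LIMSEQ_I)
    fix r :: real assume r: "0 < r"
    \<comment> \<open>Halving turns the non-strict error bound into the strict one required of a
      limit.\<close>
    from uniform_approximation[of "r / 2"] r obtain N0 where
      N0: "\<forall>N\<ge>N0. \<forall>M\<in>Sym N. lin_indep_of_id N M \<longrightarrow> \<bar>vol N (central_section N M) / approx_vol N - 1\<bar> \<le> r / 2"
      by auto
    from lim obtain k0 where k0: "\<And>k. k \<ge> k0 \<Longrightarrow> n k \<ge> N0"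
      unfolding filterlim_at_top eventually_sequentially by blast
    show "\<exists>k0. \<forall>k\<ge>k0. norm (vol (n k) (central_section (n k) (M k)) / approx_vol (n k) - 1) < r"
    proof (intro exI[of _ k0] allI impI)
      fix k assume "k \<ge> k0"
      then have "\<bar>vol (n k) (central_section (n k) (M k)) / approx_vol (n k) - 1\<bar> \<le> r / 2"
        using N0 k0 nM by blast
      then show "norm (vol (n k) (central_section (n k) (M k)) / approx_vol (n k) - 1) < r"
        using r by simp
    qed
  qed
qed

end
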